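(* Consider the linear-quadratic $N$-player stochastic differential game described in the context, and the sequence $\{\boldsymbol\alpha^n\}_{n\in\mathbb N}\subset\mathbb A^N$ generated from an initial belief $\boldsymbol\alpha^0\in\mathbb A^N$ by $$\alpha^{i,n+1}:=\operatorname*{arg\,min}_{\beta\in\mathbb A}J^{i}(\beta;\boldsymbol\alpha^{-i,n}),\qquad i\in\{1,\dots,N\},\ n\ge 0 .$$ Let $K$ be the solution on $[0,T]$ of the Riccati equation $$\dot K_t=2\Big(a+\big(1-\tfrac1N\big)q\Big)K_t+\Big(\tfrac{N-1}{N}\Big)^2K_t^2-(\epsilon-q^2),\qquad K_T=c,$$ let $\overline K$ and $\underline K$ be the maximum and minimum values of $K_t$ on $[0,T]$, and set $$\underline\gamma=a+\big(1-\tfrac1N\big)q+\big(1-\tfrac1N\big)^2\underline K,$$ $$C=\big(1-\tfrac1N\big)^2\left(\big(1-\tfrac1N\big)^2\overline K^2+\Big(q+\big(1-\tfrac1N\big)\overline K\Big)^2\left(\frac{1-e^{-2T\underline\gamma}}{\underline\gamma}\big(1-\tfrac1N\big)^4\overline K^2+2\right)\right).$$ If $$\frac{1-e^{-2T\underline\gamma}}{\underline\gamma}\,C<1,$$ then the sequence $\{\boldsymbol\alpha^n\}_{n\in\mathbb N}$ converges in $\mathbb A^N$; its limit $\boldsymbol\alpha^\infty$ is an open-loop Nash equilibrium of the $N$-player game; and $\boldsymbol\alpha^\infty$ does not depend on the choice of the initial belief $\boldsymbol\alpha^0$.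
   Context: Fix an integer $N\ge2$ (number of players), a horizon $T>0$, real parameters $a,\epsilon,c,q\ge0$ with $q^2\le\epsilon$, a constant $\sigma\in\mathbb R$, $\rho\in[-1,1]$, and deterministic initial states $x^1,\dots,x^N\in\mathbb R$. Let $W^0,W^1,\dots,W^N$ be independent standard one-dimensional Brownian motions on a probability space $(\Omega,\mathcal F,\mathbb P)$, and let $\mathbb F=(\mathcal F_t)_{0\le t\le T}$ be the augmented filtration they generate. Admissible controls: $\mathbb A=\mathbb H^2_T(\mathbb R)$ is the space of $\mathbb F$-progressively measurable real-valued processes $\alpha$ with $\mathbb E\big[\int_0^T|\alpha_t|^2\,dt\big]<\infty$, with its usual $L^2(\Omega\times[0,T])$ topology (processes equal $d\mathbb P\otimes dt$-a.e. are identified); $\mathbb A^N$ is the $N$-fold product. State dynamics: for $\boldsymbol\alpha=(\alpha^1,\dots,\alpha^N)\in\mathbb A^N$, $$dX^i_t=\big[a(\overline X_t-X^i_t)+\alpha^i_t\big]dt+\sigma\Big(\rho\,dW^0_t+\sqrt{1-\rho^2}\,dW^i_t\Big),\quad X^i_0=x^i,\quad \overline X_t=\frac1N\sum_{j=1}^NX^j_t,\quad i=1,\dots,N.$$ Costs: player $i$ minimizes $$J^i(\boldsymbol\alpha)=\mathbb E\left[\int_0^T\Big(\tfrac12(\alpha^i_t)^2-q\,\alpha^i_t(\overline X_t-X^i_t)+\tfrac{\epsilon}{2}(\overline X_t-X^i_t)^2\Big)dt+\tfrac c2(\overline X_T-X^i_T)^2\right].$$ For $\beta\in\mathbb A$ and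 $\boldsymbol\alpha^{-i}=(\alpha^j)_{j\ne i}\in\mathbb A^{N-1}$, $J^i(\beta;\boldsymbol\alpha^{-i})$ denotes the cost $J^i$ when player $i$ uses $\beta$ and every player $j\neq i$ uses the process $\alpha^j$. Fictitious play: given $\boldsymbol\alpha^n=(\alpha^{1,n},\dots,\alpha^{N,n})\in\mathbb A^N$, write $\boldsymbol\alpha^{-i,n}=(\alpha^{j,n})_{j\ne i}$. For each $i$ and $n$ the map $\beta\mapsto J^i(\beta;\boldsymbol\alpha^{-i,n})$ has a unique minimizer in $\mathbb A$, so $\boldsymbol\alpha^{n+1}=(\alpha^{1,n+1},\dots,\alpha^{N,n+1})$ is well defined (all players update simultaneously). Open-loop Nash equilibrium: $\boldsymbol\alpha^*\in\mathbb A^N$ such that for all $i$ and all $\beta\in\mathbb A$, $J^i(\boldsymbol\alpha^* )\le J^i(\beta;\boldsymbol\alpha^{*,-i})$, where $\boldsymbol\alpha^{*,-i}=(\alpha^{*,j})_{j\neq i}$ (as processes) is kept fixed. Convention: if $\underline\gamma=0$, the quotient $\frac{1-e^{-2T\underline\gamma}}{\underline\gamma}$ is read as its limit $2T$. *)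

theory Defs
  imports "HOL-Probability.Probability"
begin

definition standard_brownian_motion :: "'a measure \<Rightarrow> (real \<Rightarrow> 'a \<Rightarrow> real) \<Rightarrow> bool" where
  "standard_brownian_motion M B \<longleftrightarrow>
     (\<forall>t\<ge>0. B t \<in> borel_measurable M) \<and>
     (AE \<omega> in M. B 0 \<omega> = 0) \<and>
     (AE \<omega> in M. continuous_on {0..} (\<lambda>t. B t \<omega>)) \<and>
     (\<forall>s t. 0 \<le> s \<and> s < t \<longrightarrow>
        distributed M lborel (\<lambda>\<omega>. B t \<omega> - B s \<omega>) (normal_density 0 (sqrt (t - s)))) \<and>
     (\<forall>\<tau> :: nat \<Rightarrow> real. incseq \<tau> \<and> 0 \<le> \<tau> 0 \<longrightarrow>
        prob_space.indep_vars M (\<lambda>_. borel)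
          (\<lambda>k \<omega>. B (\<tau> (Suc k)) \<omega> - B (\<tau> k) \<omega>) UNIV)"

text \<open>Independence of the processes is independence of the path-valued random variables
  with respect to the product sigma-algebra.\<close>

definition independent_brownian_motions ::
    "'a measure \<Rightarrow> nat \<Rightarrow> (nat \<Rightarrow> real \<Rightarrow> 'a \<Rightarrow> real) \<Rightarrow> bool" where
  "independent_brownian_motions M N W \<longleftrightarrow>
     (\<forall>k\<le>N. standard_brownian_motion M (W k)) \<and>
     prob_space.indep_vars M (\<lambda>_. \<Pi>\<^sub>M t\<in>{0..}. borel)
       (\<lambda>k \<omega>. \<lambda>t\<in>{0..}. W k t \<omega>) {..N}"

text \<open>Players are numbered \<open>1, \<dots>, N\<close>; \<open>W 0\<close> is the common noise and \<open>W i\<close> the noise of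
  player \<open>i\<close>. A profile is a function on all of \<open>nat\<close>, of which only the values at the
  players matter. The locale only declares the parameters; it carries no assumptions.\<close>

locale lq_game =
  fixes M :: "'a measure"
    and W :: "nat \<Rightarrow> real \<Rightarrow> 'a \<Rightarrow> real"
    and N :: nat
    and T :: real
    and a \<sigma> \<rho> :: real
    and x :: "nat \<Rightarrow> real"
    and q \<epsilon> c :: real
begin

text \<open>The augmentation adjoins all null sets of the completed space, so the members of the
  filtration are sub-sigma-algebras of \<open>completion M\<close>, and expectations are taken there.\<close>

definition aug_filtration :: "real \<Rightarrow> 'a measure" where
  "aug_filtration t = sigma (space M)
     ({W k s -` B \<inter> space M | k s B. k \<le> N \<and> 0 \<le> s \<and> s \<le> t \<and> B \<in> sets borel}
      \<union> null_sets (completion M))"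

definition progressively_measurable :: "(real \<Rightarrow> 'a \<Rightarrow> real) \<Rightarrow> bool" where
  "progressively_measurable \<beta> \<longleftrightarrow> (\<forall>t\<in>{0..T}.
     (\<lambda>(s, \<omega>). \<beta> s \<omega>) \<in> borel_measurable (restrict_space borel {0..t} \<Otimes>\<^sub>M aug_filtration t))"

definition sq_norm :: "(real \<Rightarrow> 'a \<Rightarrow> real) \<Rightarrow> ennreal" where
  "sq_norm \<beta> = (\<integral>\<^sup>+\<omega>. (\<integral>\<^sup>+t\<in>{0..T}. ennreal ((\<beta> t \<omega>)\<^sup>2) \<partial>lborel) \<partial>completion M)"

definition admissible :: "(real \<Rightarrow> 'a \<Rightarrow> real) set" where
  "admissible = {\<beta>. progressively_measurable \<beta> \<and> sq_norm \<beta> < \<infinity>}"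

definition admissible_profiles :: "(nat \<Rightarrow> real \<Rightarrow> 'a \<Rightarrow> real) set" where
  "admissible_profiles = {\<alpha>. \<forall>i\<in>{1..N}. \<alpha> i \<in> admissible}"

definition average :: "(nat \<Rightarrow> real \<Rightarrow> 'a \<Rightarrow> real) \<Rightarrow> real \<Rightarrow> 'a \<Rightarrow> real" where
  "average X t \<omega> = (\<Sum>j = 1..N. X j t \<omega>) / real N"

text \<open>The noise is additive with constant coefficients, so the stochastic integral is just
  \<open>\<sigma> * (\<rho> * W 0 t + sqrt (1 - \<rho>\<^sup>2) * W i t)\<close>.\<close>

definition is_state :: "(nat \<Rightarrow> real \<Rightarrow> 'a \<Rightarrow> real) \<Rightarrow> (nat \<Rightarrow> real \<Rightarrow> 'a \<Rightarrow> real) \<Rightarrow> bool" where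
  "is_state \<alpha> X \<longleftrightarrow> (\<forall>i\<in>{1..N}.
     (\<forall>t\<in>{0..T}. X i t \<in> borel_measurable (aug_filtration t)) \<and>
     (\<forall>\<omega>\<in>space M. continuous_on {0..T} (\<lambda>t. X i t \<omega>)) \<and>
     (AE \<omega> in completion M. \<forall>t\<in>{0..T}.
        X i t \<omega> = x i
          + (LINT s:{0..t}|lborel. a * (average X s \<omega> - X i s \<omega>) + \<alpha> i s \<omega>)
          + \<sigma> * (\<rho> * W 0 t \<omega> + sqrt (1 - \<rho>\<^sup>2) * W i t \<omega>)))"

text \<open>For admissible \<open>\<alpha>\<close> the solution is unique up to indistinguishability, so the choice
  does not affect the cost.\<close>

definition state :: "(nat \<Rightarrow> real \<Rightarrow> 'a \<Rightarrow> real) \<Rightarrow> nat \<Rightarrow> real \<Rightarrow> 'a \<Rightarrow> real" where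
  "state \<alpha> = (SOME X. is_state \<alpha> X)"

definition cost :: "nat \<Rightarrow> (nat \<Rightarrow> real \<Rightarrow> 'a \<Rightarrow> real) \<Rightarrow> real" where
  "cost i \<alpha> = (let X = state \<alpha>; Z = (\<lambda>t \<omega>. average X t \<omega> - X i t \<omega>) in
     \<integral>\<omega>. (LINT t:{0..T}|lborel.
             1 / 2 * (\<alpha> i t \<omega>)\<^sup>2 - q * \<alpha> i t \<omega> * Z t \<omega> + \<epsilon> / 2 * (Z t \<omega>)\<^sup>2)
          + c / 2 * (Z T \<omega>)\<^sup>2 \<partial>completion M)"

definition open_loop_nash :: "(nat \<Rightarrow> real \<Rightarrow> 'a \<Rightarrow> real) \<Rightarrow> bool" where
  "open_loop_nash \<alpha> \<longleftrightarrow> \<alpha> \<in> admissible_profiles \<and>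
     (\<forall>i\<in>{1..N}. \<forall>\<beta>\<in>admissible. cost i \<alpha> \<le> cost i (\<alpha>(i := \<beta>)))"

text \<open>Minimizers are unique only up to null sets of the product measure, hence a relation that covers
  every choice of representatives.\<close>

definition fictitious_play ::
    "(nat \<Rightarrow> real \<Rightarrow> 'a \<Rightarrow> real) \<Rightarrow> (nat \<Rightarrow> nat \<Rightarrow> real \<Rightarrow> 'a \<Rightarrow> real) \<Rightarrow> bool" where
  "fictitious_play \<alpha>\<^sub>0 \<alpha> \<longleftrightarrow> \<alpha> 0 = \<alpha>\<^sub>0 \<and>
     (\<forall>n. \<forall>i\<in>{1..N}.
        is_arg_min (\<lambda>\<beta>. cost i ((\<alpha> n)(i := \<beta>))) (\<lambda>\<beta>. \<beta> \<in> admissible) (\<alpha> (Suc n) i))"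

definition converges_to ::
    "(nat \<Rightarrow> nat \<Rightarrow> real \<Rightarrow> 'a \<Rightarrow> real) \<Rightarrow> (nat \<Rightarrow> real \<Rightarrow> 'a \<Rightarrow> real) \<Rightarrow> bool" where
  "converges_to \<alpha> \<alpha>' \<longleftrightarrow>
     (\<forall>i\<in>{1..N}. (\<lambda>n. sq_norm (\<lambda>t \<omega>. \<alpha> n i t \<omega> - \<alpha>' i t \<omega>)) \<longlonglongrightarrow> 0)"

end

definition riccati_solution ::
    "nat \<Rightarrow> real \<Rightarrow> real \<Rightarrow> real \<Rightarrow> real \<Rightarrow> real \<Rightarrow> (real \<Rightarrow> real) \<Rightarrow> bool" where
  "riccati_solution N T a q \<epsilon> c K \<longleftrightarrow> K T = c \<and>
     (\<forall>t\<in>{0..T}. (K has_real_derivative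
        (2 * (a + (1 - 1 / real N) * q) * K t + ((real N - 1) / real N)\<^sup>2 * (K t)\<^sup>2
          - (\<epsilon> - q\<^sup>2))) (at t within {0..T}))"

definition K_max :: "real \<Rightarrow> (real \<Rightarrow> real) \<Rightarrow> real" where
  "K_max T K = (SUP t\<in>{0..T}. K t)"

definition K_min :: "real \<Rightarrow> (real \<Rightarrow> real) \<Rightarrow> real" where
  "K_min T K = (INF t\<in>{0..T}. K t)"

definition gamma_min :: "nat \<Rightarrow> real \<Rightarrow> real \<Rightarrow> real \<Rightarrow> (real \<Rightarrow> real) \<Rightarrow> real" where
  "gamma_min N T a q K = a + (1 - 1 / real N) * q + (1 - 1 / real N)\<^sup>2 * K_min T K"

definition exp_quotient :: "real \<Rightarrow> real \<Rightarrow> real" where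
  "exp_quotient T \<gamma> = (if \<gamma> = 0 then 2 * T else (1 - exp (- 2 * T * \<gamma>)) / \<gamma>)"

definition C_const :: "nat \<Rightarrow> real \<Rightarrow> real \<Rightarrow> real \<Rightarrow> (real \<Rightarrow> real) \<Rightarrow> real" where
  "C_const N T a q K = (1 - 1 / real N)\<^sup>2 *
     ((1 - 1 / real N)\<^sup>2 * (K_max T K)\<^sup>2
      + (q + (1 - 1 / real N) * K_max T K)\<^sup>2
        * (exp_quotient T (gamma_min N T a q K) * (1 - 1 / real N) ^ 4 * (K_max T K)\<^sup>2 + 2))"

end

theory Submission
  imports Defs
begin

text \<open>Write \<open>Z\<^sup>i\<close> for the average state minus the state of player \<open>i\<close>, \<open>\<kappa> = 1 - 1/N\<close> and
  \<open>u = \<alpha>\<^sup>i - q Z\<^sup>i\<close>. The cost is \<open>(\<parallel>u\<parallel>\<^sup>2 + A(Z\<^sup>i, Z\<^sup>i)) / 2\<close> with a positive semidefinite form \<open>A\<close>,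
  hence strongly convex in \<open>u\<close>, so best responses exist and are characterised by the vanishing of the
  first variation. The noise cancels in the difference of two best responses. If \<open>m\<close> is the difference
  of the inputs \<open>\<Sum>j\<noteq>i. \<alpha>\<^sup>j / N\<close>, then \<open>\<delta>Z\<close> solves \<open>Z' = e - (a + \<kappa> q) Z\<close> with \<open>e = m - \<kappa> \<delta>u\<close>, and the
  first order condition says \<open>E(e, h) = \<langle>m, h\<rangle>\<close> for the energy form \<open>E = \<langle>\<cdot>, \<cdot>\<rangle> + F\<close>, where \<open>F\<close> is the
  pullback of \<open>\<kappa>\<^sup>2 A\<close> under the solution operator. Therefore
  \<open>\<kappa> \<langle>\<delta>\<alpha>\<^sup>i, h\<rangle> = F(e, h) + \<kappa> q \<langle>\<delta>Z, h\<rangle>\<close>. Since \<open>F \<le> \<Lambda> \<parallel>\<cdot>\<parallel>\<^sup>2\<close> and \<open>\<kappa> q \<parallel>\<delta>Z\<parallel> \<le> v \<parallel>e\<parallel>\<close> with \<open>v < 1\<close> (the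
  decay rate is at least \<open>\<kappa> q\<close> and the horizon is finite), the right-hand side is at most
  \<open>(\<Lambda> + v) / (\<Lambda> + 1)\<close> times the product of the energy norms of \<open>e\<close> and \<open>h\<close>. Thus the simultaneous
  best response is a contraction in the dual energy norm.\<close>

text \<open>Open-loop deviations leave the opponents' processes fixed, so the deviation of player
  \<open>i\<close> solves a scalar equation that is affine in the own control. With S the solution
  operator, the difference of deviations is S e, and a test increment h moves the deviation by y = -
  kappa S h. The first order condition reads <u, h> + A(S e, y) = 0; multiplied by - kappa and added
  to <m, h>, it becomes <e, h> + F(e, h) = <m, h>, because e = m - kappa u. So e represents m with
  respect to E, and the energy norm of e is controlled by the dual norm of m. This dictates the
  choice of norm: the opponents enter only through the pairing with m. Averaging N - 1 opponents
  with weight 1/N costs a factor kappa, which cancels the kappa in front of the difference of best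
  responses. In the plain norm an equivalence constant would be lost in every round. The contraction
  compares two arbitrary plays. Applied to a play and its own shift it yields a limit; applied to a
  play and the constant play at an equilibrium it yields independence of the initial belief.\<close>

section \<open>Integration by parts for primitives of integrable functions\<close>

lemma set_integral_by_parts:
  fixes f g :: "real \<Rightarrow> real"
  assumes f: "set_integrable lborel {0..t} f" and g: "set_integrable lborel {0..t} g"
  shows "set_integrable lborel {0..t} (\<lambda>s. f s * (LINT r:{0..s}|lborel. g r))"
    and "set_integrable lborel {0..t} (\<lambda>s. (LINT r:{0..s}|lborel. f r) * g s)"
    and "(LINT s:{0..t}|lborel. f s) * (LINT s:{0..t}|lborel. g s) =
    (LINT s:{0..t}|lborel. f s * (LINT r:{0..s}|lborel. g r) + (LINT r:{0..s}|lborel. f r) * g s)"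
proof -
  define f' where "f' s = indicator {0..t} s * f s" for s
  define g' where "g' s = indicator {0..t} s * g s" for s
  have f'i[simp]: "integrable lborel f'" and g'i[simp]: "integrable lborel g'"
    using f g by (auto simp: set_integrable_def f'_def[abs_def] g'_def[abs_def])
  have [measurable]: "f' \<in> borel_measurable borel" "g' \<in> borel_measurable borel"
    using borel_measurable_integrable[OF f'i] borel_measurable_integrable[OF g'i] by auto
  have pi: "integrable (lborel \<Otimes>\<^sub>M lborel) (\<lambda>(s, r). f' s * g' r)"
    by (intro lborel_pair.Fubini_integrable) (auto simp: abs_mult)
  \<comment> \<open>The product of the two integrals is the integral of \<open>f' s * g' r\<close>
    over a square. \<open>p1\<close> is the part with \<open>r \<le> s\<close>, \<open>p2\<close>
    the part with \<open>s < r\<close>; Fubini in opposite orders turns them into the two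
    summands.\<close>
  define p1 where "p1 = (\<lambda>(s, r). f' s * (g' r * indicator {..s} r))"
  define p2 where "p2 = (\<lambda>(s, r). f' s * (g' r * indicator {s<..} r))"
  have i1: "integrable (lborel \<Otimes>\<^sub>M lborel) p1"
    unfolding p1_def by (rule Bochner_Integration.integrable_bound[OF pi])
      (auto simp: indicator_def abs_mult case_prod_beta' split: if_splits intro!: AE_I2)
  have i2: "integrable (lborel \<Otimes>\<^sub>M lborel) p2"
    unfolding p2_def by (rule Bochner_Integration.integrable_bound[OF pi])
      (auto simp: indicator_def abs_mult case_prod_beta' split: if_splits intro!: AE_I2)
  have e1: "(LINT r|lborel. p1 (s, r)) = indicator {0..t} s * (f s * (LINT r:{0..s}|lborel. g r))" for s
  proof (cases "s \<in> {0..t}")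
    case True
    have "(LINT r|lborel. p1 (s, r)) = f' s * (LINT r|lborel. g' r * indicator {..s} r)"
      by (simp add: p1_def)
    also have "(LINT r|lborel. g' r * indicator {..s} r) = (LINT r:{0..s}|lborel. g r)"
      unfolding set_lebesgue_integral_def g'_def using True
      by (intro Bochner_Integration.integral_cong) (auto simp: indicator_def)
    finally show ?thesis by (simp add: f'_def)
  qed (simp add: p1_def f'_def)
  have e2: "(LINT s|lborel. p2 (s, r)) = indicator {0..t} r * ((LINT s:{0..r}|lborel. f s) * g r)" for r
  proof (cases "r \<in> {0..t}")
    case True
    have "(LINT s|lborel. p2 (s, r)) = (LINT s|lborel. f' s * indicator {..<r} s * g' r)"
      by (intro Bochner_Integration.integral_cong) (auto simp: p2_def indicator_def)
    also have "\<dots> = (LINT s|lborel. f' s * indicator {..<r} s) * g' r"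
      by simp
    \<comment> \<open>\<open>p2\<close> excludes the diagonal while the target integral includes
      \<open>s = r\<close>; the difference is a null set.\<close>
    also have "(LINT s|lborel. f' s * indicator {..<r} s) = (LINT s:{0..r}|lborel. f s)"
      unfolding set_lebesgue_integral_def f'_def
    proof (rule integral_cong_AE)
      show "AE s in lborel. indicat_real {0..t} s * f s * indicat_real {..<r} s = indicat_real {0..r} s *\<^sub>R f s"
        using AE_lborel_singleton[of r] by eventually_elim (use True in \<open>auto simp: indicator_def\<close>)
      show "(\<lambda>s. indicat_real {0..t} s * f s * indicat_real {..<r} s) \<in> borel_measurable lborel"
        unfolding f'_def[symmetric] by measurable
      have "(\<lambda>s. indicat_real {0..r} s *\<^sub>R f s) = (\<lambda>s. indicat_real {0..r} s * f' s)"
        using True by (auto simp: f'_def indicator_def)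
      then show "(\<lambda>s. indicat_real {0..r} s *\<^sub>R f s) \<in> borel_measurable lborel" by simp
    qed
    finally show ?thesis by (simp add: g'_def)
  qed (simp add: p2_def g'_def)
  show I1: "set_integrable lborel {0..t} (\<lambda>s. f s * (LINT r:{0..s}|lborel. g r))"
    using lborel_pair.integrable_fst'[OF i1] unfolding set_integrable_def e1 by simp
  show I2: "set_integrable lborel {0..t} (\<lambda>s. (LINT r:{0..s}|lborel. f r) * g s)"
  proof -
    have "integrable lborel (\<lambda>y. LINT x|lborel. p2 (x, y))"
      using lborel_pair.integrable_snd[of "\<lambda>x y. p2 (x, y)"] i2 by (simp add: case_prod_beta')
    then show ?thesis unfolding set_integrable_def e2 by simp
  qed
  have "(LINT s:{0..t}|lborel. f s) * (LINT s:{0..t}|lborel. g s) = (LINT s|lborel. f' s) * (LINT r|lborel. g' r)"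
    by (simp add: set_lebesgue_integral_def f'_def g'_def)
  also have "\<dots> = (LINT s|lborel. LINT r|lborel. f' s * g' r)" by simp
  also have "\<dots> = integral\<^sup>L (lborel \<Otimes>\<^sub>M lborel) (\<lambda>(s, r). f' s * g' r)"
    using lborel_pair.integral_fst'[OF pi] by simp
  also have "(\<lambda>(s, r). f' s * g' r) = (\<lambda>z. p1 z + p2 z)"
    by (auto simp: p1_def p2_def indicator_def fun_eq_iff)
  also have "integral\<^sup>L (lborel \<Otimes>\<^sub>M lborel) \<dots> = integral\<^sup>L (lborel \<Otimes>\<^sub>M lborel) p1 + integral\<^sup>L (lborel \<Otimes>\<^sub>M lborel) p2"
    using i1 i2 by simp
  also have "integral\<^sup>L (lborel \<Otimes>\<^sub>M lborel) p1 = (LINT s:{0..t}|lborel. f s * (LINT r:{0..s}|lborel. g r))"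
    using lborel_pair.integral_fst'[OF i1] unfolding e1 set_lebesgue_integral_def by simp
  also have "integral\<^sup>L (lborel \<Otimes>\<^sub>M lborel) p2 = (LINT s:{0..t}|lborel. (LINT r:{0..s}|lborel. f r) * g s)"
    using lborel_pair.integral_snd[of "\<lambda>x y. p2 (x, y)"] i2 unfolding e2 set_lebesgue_integral_def
    by (simp add: case_prod_beta')
  finally show "(LINT s:{0..t}|lborel. f s) * (LINT s:{0..t}|lborel. g s) =
    (LINT s:{0..t}|lborel. f s * (LINT r:{0..s}|lborel. g r) + (LINT r:{0..s}|lborel. f r) * g s)"
    using I1 I2 by (simp add: set_integral_add)
qed

section \<open>Square integrable functions\<close>

definition sq_integrable :: "'b measure \<Rightarrow> ('b \<Rightarrow> real) \<Rightarrow> bool" where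
  "sq_integrable M f \<longleftrightarrow> f \<in> borel_measurable M \<and> integrable M (\<lambda>x. (f x)\<^sup>2)"

lemma sq_integrableD:
  assumes "sq_integrable M f"
  shows "f \<in> borel_measurable M" "integrable M (\<lambda>x. (f x)\<^sup>2)"
  using assms by (auto simp: sq_integrable_def)

lemma sq_integrable_mult:
  assumes "sq_integrable M f" "sq_integrable M g"
  shows "integrable M (\<lambda>x. f x * g x)"
proof (rule Bochner_Integration.integrable_bound)
  show "integrable M (\<lambda>x. (f x)\<^sup>2 + (g x)\<^sup>2)"
    using assms by (auto simp: sq_integrable_def)
  show "(\<lambda>x. f x * g x) \<in> borel_measurable M"
    using assms by (auto simp: sq_integrable_def)
  have "\<bar>u * v\<bar> \<le> u\<^sup>2 + v\<^sup>2" for u v :: real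
    using zero_le_power2[of "\<bar>u\<bar> - \<bar>v\<bar>"] zero_le_power2[of u] zero_le_power2[of v]
      mult_nonneg_nonneg[OF abs_ge_zero[of u] abs_ge_zero[of v]]
    unfolding abs_mult power2_diff power2_abs by linarith
  then show "AE x in M. norm (f x * g x) \<le> norm ((f x)\<^sup>2 + (g x)\<^sup>2)"
    by auto
qed

lemma sq_integrable_zero [simp]: "sq_integrable M (\<lambda>x. 0)"
  by (simp add: sq_integrable_def)

lemma sq_integrable_cmult [intro]:
  "sq_integrable M f \<Longrightarrow> sq_integrable M (\<lambda>x. c * f x)"
  by (auto simp: sq_integrable_def power_mult_distrib)

lemma sq_integrable_add [intro]:
  assumes "sq_integrable M f" "sq_integrable M g"
  shows "sq_integrable M (\<lambda>x. f x + g x)"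
proof -
  have "integrable M (\<lambda>x. (f x)\<^sup>2 + (g x)\<^sup>2 + 2 * (f x * g x))"
    using assms sq_integrable_mult[OF assms] by (auto simp: sq_integrable_def)
  then show ?thesis
    using assms by (auto simp: sq_integrable_def power2_eq_square algebra_simps)
qed

lemma sq_integrable_diff [intro]:
  assumes "sq_integrable M f" "sq_integrable M g"
  shows "sq_integrable M (\<lambda>x. f x - g x)"
  using sq_integrable_add[OF assms(1) sq_integrable_cmult[OF assms(2), of "-1"]] by simp

lemma sq_integrable_sum:
  assumes "\<And>i. i \<in> I \<Longrightarrow> sq_integrable M (f i)"
  shows "sq_integrable M (\<lambda>x. \<Sum>i\<in>I. f i x)"
  using assms by (induction I rule: infinite_finite_induct) auto

lemma sq_integrable_cong_AE:
  assumes "sq_integrable M f" "g \<in> borel_measurable M" "AE x in M. f x = g x"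
  shows "sq_integrable M g"
proof -
  have "integrable M (\<lambda>x. (f x)\<^sup>2) \<longleftrightarrow> integrable M (\<lambda>x. (g x)\<^sup>2)"
    by (rule integrable_cong_AE) (use assms in \<open>auto simp: sq_integrable_def\<close>)
  then show ?thesis using assms by (auto simp: sq_integrable_def)
qed

text \<open>Degenerate coefficients are allowed on purpose: \<open>A = 0\<close> forces
  \<open>B = 0\<close>, which turns minimality into a first order condition, and
  \<open>C = 0\<close> may occur in the Cauchy-Schwarz inequality of a semidefinite form.\<close>

lemma quadratic_nonneg_imp_discriminant:
  fixes A B C :: real
  assumes nonneg: "\<And>t. 0 \<le> A + 2 * t * B + t\<^sup>2 * C"
  shows "B\<^sup>2 \<le> A * C"
proof (cases "C = 0")
  case True
  have "B = 0"
  proof (rule ccontr)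
    assume "B \<noteq> 0"
    \<comment> \<open>For \<open>C = 0\<close> the quadratic takes the value -1 at this
      point.\<close>
    then show False using nonneg[of "- (A + 1) / (2 * B)"] True by (simp add: field_simps)
  qed
  then show ?thesis using True by simp
next
  case False
  have "0 \<le> C"
  proof (rule ccontr)
    assume n: "\<not> 0 \<le> C"
    \<comment> \<open>For \<open>C < 0\<close> this makes \<open>t * (- C)\<close> exceed
      \<open>\<bar>A\<bar> + 2 * \<bar>B\<bar>\<close>, so the quadratic term outweighs the
      others.\<close>
    define t where "t = (\<bar>A\<bar> + 2 * \<bar>B\<bar>) / (- C) + 1"
    have t1: "t \<ge> 1" using n by (auto simp: t_def intro!: divide_nonneg_neg)
    have "\<bar>A\<bar> + 2 * \<bar>B\<bar> = (t - 1) * (- C)"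
      using n by (simp add: t_def)
    then have "\<bar>A\<bar> + 2 * \<bar>B\<bar> < t * (- C)"
      using n by (simp add: algebra_simps)
    then have "t * (\<bar>A\<bar> + 2 * \<bar>B\<bar>) < t * (t * (- C))"
      using t1 by (intro mult_strict_left_mono) auto
    moreover have "A + 2 * t * B \<le> t * (\<bar>A\<bar> + 2 * \<bar>B\<bar>)"
    proof -
      have "A \<le> t * \<bar>A\<bar>" using t1 mult_right_mono[of 1 t "\<bar>A\<bar>"] by simp
      moreover have "t * B \<le> t * \<bar>B\<bar>" using t1 by (intro mult_left_mono) auto
      ultimately show ?thesis by (simp add: algebra_simps)
    qed
    ultimately show False using nonneg[of t] by (simp add: power2_eq_square)
  qed
  with False have C: "C > 0" by simp
  have "0 \<le> A + 2 * (- B / C) * B + (- B / C)\<^sup>2 * C" by (rule nonneg)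
  also have "\<dots> = A - B\<^sup>2 / C" using C by (simp add: field_simps power2_eq_square)
  finally show ?thesis using C by (simp add: field_simps)
qed

lemma integral_Cauchy_Schwarz:
  assumes f: "sq_integrable M f" and g: "sq_integrable M g"
  shows "(\<integral>x. f x * g x \<partial>M)\<^sup>2 \<le> (\<integral>x. (f x)\<^sup>2 \<partial>M) * (\<integral>x. (g x)\<^sup>2 \<partial>M)"
proof (rule quadratic_nonneg_imp_discriminant)
  fix t :: real
  have "0 \<le> (\<integral>x. (f x + t * g x)\<^sup>2 \<partial>M)" by simp
  also have "\<dots> = (\<integral>x. (f x)\<^sup>2 + 2 * t * (f x * g x) + t\<^sup>2 * (g x)\<^sup>2 \<partial>M)"
    by (intro Bochner_Integration.integral_cong) (auto simp: power2_eq_square algebra_simps)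
  also have "\<dots> = (\<integral>x. (f x)\<^sup>2 \<partial>M) + 2 * t * (\<integral>x. f x * g x \<partial>M) + t\<^sup>2 * (\<integral>x. (g x)\<^sup>2 \<partial>M)"
    using f g sq_integrable_mult[OF f g] by (simp add: sq_integrable_def)
  finally show "0 \<le> (\<integral>x. (f x)\<^sup>2 \<partial>M) + 2 * t * (\<integral>x. f x * g x \<partial>M) + t\<^sup>2 * (\<integral>x. (g x)\<^sup>2 \<partial>M)" .
qed

lemma (in finite_measure) sq_integrable_imp_integrable:
  assumes "sq_integrable M f"
  shows "integrable M f"
proof -
  have "sq_integrable M (\<lambda>x. 1)" by (simp add: sq_integrable_def)
  from sq_integrable_mult[OF assms this] show ?thesis by simp
qed

section \<open>The scalar linear equation\<close>

abbreviation lborel_upto :: "real \<Rightarrow> real measure" where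
  "lborel_upto t \<equiv> restrict_space lborel {0..t}"

lemma finite_measure_lborel_upto: "finite_measure (lborel_upto t)"
  by (intro finite_measureI) (simp add: emeasure_restrict_space space_restrict_space emeasure_lborel_Icc_eq)

lemma lborel_upto_integral:
  fixes f :: "real \<Rightarrow> real"
  shows "integral\<^sup>L (lborel_upto t) f = (LINT s:{0..t}|lborel. f s)"
    and "integrable (lborel_upto t) f \<longleftrightarrow> set_integrable lborel {0..t} f"
  by (simp_all add: integral_restrict_space integrable_restrict_space set_lebesgue_integral_def set_integrable_def)

lemma measurable_lborel_upto_mono:
  assumes "s \<le> t" "f \<in> borel_measurable (lborel_upto t)"
  shows "f \<in> borel_measurable (lborel_upto s)"
proof -
  have "f \<in> borel_measurable (restrict_space (lborel_upto t) {0..s})"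
    using assms(2) by (rule measurable_restrict_space1)
  also have "restrict_space (lborel_upto t) {0..s} = lborel_upto s"
    using assms(1) by (simp add: restrict_restrict_space Int_absorb1)
  finally show ?thesis .
qed

lemma sq_integrable_upto_mono:
  assumes "s \<le> t" "sq_integrable (lborel_upto t) f"
  shows "sq_integrable (lborel_upto s) f"
proof -
  have "set_integrable lborel {0..t} (\<lambda>x. (f x)\<^sup>2)"
    using assms(2) by (simp add: sq_integrable_def lborel_upto_integral)
  then have "set_integrable lborel {0..s} (\<lambda>x. (f x)\<^sup>2)"
    by (rule set_integrable_subset) (use assms(1) in auto)
  moreover have "f \<in> borel_measurable (lborel_upto s)"
    by (rule measurable_lborel_upto_mono[OF assms(1) sq_integrableD(1)[OF assms(2)]])
  ultimately show ?thesis
    unfolding sq_integrable_def lborel_upto_integral by (rule conjI[rotated])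
qed

lemma integral_square_le:
  assumes "0 \<le> t" "sq_integrable (lborel_upto t) f"
  shows "(LINT s:{0..t}|lborel. f s)\<^sup>2 \<le> t * (LINT s:{0..t}|lborel. (f s)\<^sup>2)"
proof -
  have 1: "sq_integrable (lborel_upto t) (\<lambda>s. 1)"
    using finite_measure.integrable_const[OF finite_measure_lborel_upto] by (simp add: sq_integrable_def)
  show ?thesis
    using integral_Cauchy_Schwarz[OF 1 assms(2)] assms(1)
    by (simp add: lborel_upto_integral measure_restrict_space)
qed

lemma sq_integrable_continuous:
  fixes z :: "real \<Rightarrow> real"
  assumes "continuous_on {0..t} z"
  shows "sq_integrable (lborel_upto t) z"
proof -
  have "z \<in> borel_measurable (restrict_space borel {0..t})"
    using assms by (rule borel_measurable_continuous_on_restrict)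
  then have "z \<in> borel_measurable (lborel_upto t)"
    by (simp cong: measurable_cong_sets sets_restrict_space_cong)
  moreover have "set_integrable lborel {0..t} (\<lambda>s. (z s)\<^sup>2)"
    using assms unfolding set_integrable_def by (intro borel_integrable_compact continuous_intros) auto
  ultimately show ?thesis
    by (simp add: sq_integrable_def lborel_upto_integral)
qed

text \<open>The equation z' = f - b z with z(0) = 0, in integrated form because \<open>f\<close> is
  only square integrable. The zero initial value fits because initial states and noise are
  subtracted beforehand.\<close>

definition lin_sol :: "real \<Rightarrow> real \<Rightarrow> (real \<Rightarrow> real) \<Rightarrow> (real \<Rightarrow> real) \<Rightarrow> bool" where
  "lin_sol T b f z \<longleftrightarrow> continuous_on {0..T} z \<and> sq_integrable (lborel_upto T) f \<and>
     (\<forall>t\<in>{0..T}. z t = (LINT s:{0..t}|lborel. f s - b * z s))"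

text \<open>Testing z' = g = f - b z with z gives b |z|^2 \<le> <f, z>. Inserted into the expansion
  of |g|^2 this leaves |g|^2 \<le> |f|^2 - b^2 |z|^2, and Cauchy-Schwarz for z as the primitive of g
  yields both bounds. Keeping the term b^2 |z|^2 produces the factor 1 + T^2 b^2, on which the
  strictness of the contraction rests.\<close>

lemma lin_sol_bound:
  assumes sol: "lin_sol T b f z" and "0 \<le> T" "0 \<le> b"
  shows "t \<in> {0..T} \<Longrightarrow> (z t)\<^sup>2 \<le> T * (LINT s:{0..T}|lborel. (f s)\<^sup>2)"
    and "(1 + T\<^sup>2 * b\<^sup>2) * (LINT s:{0..T}|lborel. (z s)\<^sup>2) \<le> T\<^sup>2 * (LINT s:{0..T}|lborel. (f s)\<^sup>2)"
proof -
  define g where "g s = f s - b * z s" for s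
  interpret L: finite_measure "lborel_upto T" by (rule finite_measure_lborel_upto)
  have z: "sq_integrable (lborel_upto T) z" and f: "sq_integrable (lborel_upto T) f"
    using sol by (auto simp: lin_sol_def intro: sq_integrable_continuous)
  then have g: "sq_integrable (lborel_upto T) g" unfolding g_def by auto
  have zg: "z t = (LINT s:{0..t}|lborel. g s)" if "t \<in> {0..T}" for t
    using sol that by (auto simp: lin_sol_def g_def)
  have gz: "integrable (lborel_upto T) (\<lambda>s. g s * z s)" and fz: "integrable (lborel_upto T) (\<lambda>s. f s * z s)"
    using f g z by (auto intro: sq_integrable_mult)
  have gi: "set_integrable lborel {0..T} g"
    using L.sq_integrable_imp_integrable[OF g] by (simp add: lborel_upto_integral)
  \<comment> \<open>Energy identity: half of this square is the integral of
    \<open>g s * z s\<close>, which is therefore nonnegative.\<close>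
  have "(z T)\<^sup>2 = (LINT s:{0..T}|lborel. g s * (LINT r:{0..s}|lborel. g r) + (LINT r:{0..s}|lborel. g r) * g s)"
    using zg[of T] \<open>0 \<le> T\<close> set_integral_by_parts(3)[OF gi gi] by (simp add: power2_eq_square)
  also have "\<dots> = (LINT s:{0..T}|lborel. 2 * (g s * z s))"
    by (intro set_lebesgue_integral_cong) (auto simp: zg)
  finally have "0 \<le> (LINT s:{0..T}|lborel. g s * z s)"
    using zero_le_power2[of "z T"] by simp
  moreover have "(\<integral>s. g s * z s \<partial>lborel_upto T) = (\<integral>s. f s * z s \<partial>lborel_upto T) - b * (\<integral>s. (z s)\<^sup>2 \<partial>lborel_upto T)"
    using f z fz by (simp add: g_def left_diff_distrib power2_eq_square sq_integrable_def mult.assoc)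
  ultimately have energy: "b * (\<integral>s. (z s)\<^sup>2 \<partial>lborel_upto T) \<le> (\<integral>s. f s * z s \<partial>lborel_upto T)"
    by (simp add: lborel_upto_integral)
  have "(\<integral>s. (g s)\<^sup>2 \<partial>lborel_upto T) = (\<integral>s. (f s)\<^sup>2 - 2 * b * (f s * z s) + b\<^sup>2 * (z s)\<^sup>2 \<partial>lborel_upto T)"
    by (intro Bochner_Integration.integral_cong) (auto simp: g_def power2_eq_square algebra_simps)
  also have "\<dots> = (\<integral>s. (f s)\<^sup>2 \<partial>lborel_upto T) - 2 * b * (\<integral>s. f s * z s \<partial>lborel_upto T) + b\<^sup>2 * (\<integral>s. (z s)\<^sup>2 \<partial>lborel_upto T)"
    using f z fz by (simp add: sq_integrable_def)
  also have "\<dots> \<le> (\<integral>s. (f s)\<^sup>2 \<partial>lborel_upto T) - b\<^sup>2 * (\<integral>s. (z s)\<^sup>2 \<partial>lborel_upto T)"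
    using mult_left_mono[OF energy \<open>0 \<le> b\<close>] by (simp add: power2_eq_square mult.assoc)
  finally have g_le: "(LINT s:{0..T}|lborel. (g s)\<^sup>2) \<le> (LINT s:{0..T}|lborel. (f s)\<^sup>2) - b\<^sup>2 * (LINT s:{0..T}|lborel. (z s)\<^sup>2)"
    by (simp add: lborel_upto_integral)
  have z_le: "(z t)\<^sup>2 \<le> T * (LINT s:{0..T}|lborel. (g s)\<^sup>2)" if t: "t \<in> {0..T}" for t
  proof -
    have "(z t)\<^sup>2 \<le> t * (LINT s:{0..t}|lborel. (g s)\<^sup>2)"
      using t sq_integrable_upto_mono[OF _ g, of t] by (simp add: zg integral_square_le)
    also have "\<dots> \<le> T * (LINT s:{0..T}|lborel. (g s)\<^sup>2)"
    proof (rule mult_mono)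
      show "(LINT s:{0..t}|lborel. (g s)\<^sup>2) \<le> (LINT s:{0..T}|lborel. (g s)\<^sup>2)"
        using sq_integrable_upto_mono[OF _ g, of t] g t
        unfolding set_lebesgue_integral_def sq_integrable_def lborel_upto_integral set_integrable_def
        by (intro integral_mono) (auto simp: indicator_def)
    qed (use t in \<open>auto simp: set_lebesgue_integral_def\<close>)
    finally show ?thesis .
  qed
  show "(z t)\<^sup>2 \<le> T * (LINT s:{0..T}|lborel. (f s)\<^sup>2)" if "t \<in> {0..T}" for t
  proof -
    have "0 \<le> b\<^sup>2 * (LINT s:{0..T}|lborel. (z s)\<^sup>2)"
      by (simp add: set_lebesgue_integral_def)
    then have "(LINT s:{0..T}|lborel. (g s)\<^sup>2) \<le> (LINT s:{0..T}|lborel. (f s)\<^sup>2)"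
      using g_le by linarith
    from mult_left_mono[OF this \<open>0 \<le> T\<close>] z_le[OF that] show ?thesis by linarith
  qed
  have "(LINT s:{0..T}|lborel. (z s)\<^sup>2) \<le> (\<integral>s. T * (LINT s:{0..T}|lborel. (g s)\<^sup>2) \<partial>lborel_upto T)"
    unfolding lborel_upto_integral(1)[symmetric]
    by (intro integral_mono sq_integrableD z L.integrable_const)
      (use z_le in \<open>auto simp: lborel_upto_integral space_restrict_space\<close>)
  also have "\<dots> = T\<^sup>2 * (LINT s:{0..T}|lborel. (g s)\<^sup>2)"
    using \<open>0 \<le> T\<close> by (simp add: measure_restrict_space power2_eq_square)
  also have "\<dots> \<le> T\<^sup>2 * ((LINT s:{0..T}|lborel. (f s)\<^sup>2) - b\<^sup>2 * (LINT s:{0..T}|lborel. (z s)\<^sup>2))"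
    by (intro mult_left_mono g_le) auto
  finally show "(1 + T\<^sup>2 * b\<^sup>2) * (LINT s:{0..T}|lborel. (z s)\<^sup>2) \<le> T\<^sup>2 * (LINT s:{0..T}|lborel. (f s)\<^sup>2)"
    by (simp add: algebra_simps)
qed

text \<open>Trades forcing against decay, with \<open>c\<close> of either sign. With
  \<open>kappa * q\<close> it passes from controls to residuals, with the negative of it
  back.\<close>

lemma lin_sol_add_rate:
  assumes "lin_sol T b f z"
  shows "lin_sol T (b + c) (\<lambda>s. f s + c * z s) z"
  using assms sq_integrable_continuous[of T z] by (auto simp: lin_sol_def algebra_simps)

text \<open>Variation of constants. The primitive \<open>F\<close> need not be differentiable
  everywhere, so the integrated equation is checked by parts.\<close>

lemma lin_sol_exists:
  assumes f: "sq_integrable (lborel_upto T) f"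
  shows "lin_sol T b f (\<lambda>t. exp (- b * t) * (LINT s:{0..t}|lborel. exp (b * s) * f s))"
proof -
  interpret L: finite_measure "lborel_upto T" by (rule finite_measure_lborel_upto)
  define e where "e s = exp (b * s) * f s" for s
  define F where "F t = (LINT s:{0..t}|lborel. e s)" for t
  have fi: "set_integrable lborel {0..T} f"
    using L.sq_integrable_imp_integrable[OF f] by (simp add: lborel_upto_integral)
  have ei: "set_integrable lborel {0..T} e"
    using sq_integrable_mult[OF sq_integrable_continuous f, of "\<lambda>s. exp (b * s)"]
    by (simp add: lborel_upto_integral e_def[abs_def] continuous_intros)
  have Fi: "F t = integral {0..t} e" if "t \<in> {0..T}" for t
    unfolding F_def using that set_integrable_subset[OF ei, of "{0..t}"]
    by (intro set_borel_integral_eq_integral) auto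
  have "continuous_on {0..T} (\<lambda>t. integral {0..t} e)"
    by (intro indefinite_integral_continuous_1 set_borel_integral_eq_integral ei)
  then have "continuous_on {0..T} F" using Fi by (subst continuous_on_cong[OF refl]) auto
  then have cont: "continuous_on {0..T} (\<lambda>t. exp (- b * t) * F t)"
    by (intro continuous_intros)
  have "exp (- b * t) * F t = (LINT s:{0..t}|lborel. f s - b * (exp (- b * s) * F s))" if t: "t \<in> {0..T}" for t
  proof -
    \<comment> \<open>The derivative of \<open>exp (- b * t)\<close>. Its primitive from 0 is
      \<open>exp (- b * t) - 1\<close>, which accounts for the separate summand \<open>F t\<close>
      below.\<close>
    define g where "g s = - b * exp (- b * s)" for s
    have G: "(LINT r:{0..s}|lborel. g r) = exp (- b * s) - 1" if "0 \<le> s" for s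
    proof -
      have "(g has_integral exp (- b * s) - exp (- b * 0)) {0..s}"
        unfolding g_def using that
        by (intro fundamental_theorem_of_calculus)
          (auto intro!: derivative_eq_intros simp: has_real_derivative_iff_has_vector_derivative[symmetric])
      moreover have "set_integrable lborel {0..s} g"
        unfolding set_integrable_def g_def by (intro borel_integrable_compact continuous_intros) auto
      ultimately show ?thesis
        by (simp add: set_borel_integral_eq_integral integral_unique)
    qed
    have gi: "set_integrable lborel {0..t} g"
      unfolding set_integrable_def g_def by (intro borel_integrable_compact continuous_intros) auto
    have ei': "set_integrable lborel {0..t} e"
      by (rule set_integrable_subset[OF ei]) (use t in auto)
    note ibp = set_integral_by_parts[OF ei' gi]
    have "exp (- b * t) * F t = F t + F t * (LINT s:{0..t}|lborel. g s)"
      using t by (simp add: G algebra_simps)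
    also have "\<dots> = (LINT s:{0..t}|lborel. e s + (e s * (LINT r:{0..s}|lborel. g r) + (LINT r:{0..s}|lborel. e r) * g s))"
      unfolding F_def ibp(3) using ibp(1,2) ei' by (subst set_integral_add(2)[of _ _ e]) auto
    also have "\<dots> = (LINT s:{0..t}|lborel. f s - b * (exp (- b * s) * F s))"
    proof (rule set_lebesgue_integral_cong, simp, intro allI impI)
      fix s assume "s \<in> {0..t}"
      then have "e s + (e s * (LINT r:{0..s}|lborel. g r) + (LINT r:{0..s}|lborel. e r) * g s) =
          e s + (e s * (exp (- b * s) - 1) + F s * g s)"
        by (simp add: G F_def)
      also have "\<dots> = f s - b * (exp (- b * s) * F s)"
        by (simp add: e_def g_def exp_minus field_simps)
      finally show "e s + (e s * (LINT r:{0..s}|lborel. g r) + (LINT r:{0..s}|lborel. e r) * g s) =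
          f s - b * (exp (- b * s) * F s)" .
    qed
    finally show ?thesis .
  qed
  then show ?thesis
    using cont f by (auto simp: lin_sol_def F_def[symmetric] e_def[symmetric])
qed

lemma lin_sol_lincomb:
  assumes "lin_sol T b f y" "lin_sol T b g z"
  shows "lin_sol T b (\<lambda>s. u * f s + v * g s) (\<lambda>s. u * y s + v * z s)"
  unfolding lin_sol_def
proof (intro conjI ballI)
  interpret L: finite_measure "lborel_upto T" by (rule finite_measure_lborel_upto)
  show "continuous_on {0..T} (\<lambda>s. u * y s + v * z s)" "sq_integrable (lborel_upto T) (\<lambda>s. u * f s + v * g s)"
    using assms by (auto simp: lin_sol_def intro!: continuous_intros)
  fix t assume t: "t \<in> {0..T}"
  have sq: "sq_integrable (lborel_upto t) f" "sq_integrable (lborel_upto t) g"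
     "sq_integrable (lborel_upto t) y" "sq_integrable (lborel_upto t) z"
    using t assms by (auto simp: lin_sol_def intro: sq_integrable_upto_mono[of t T] sq_integrable_continuous)
  have i: "integrable (lborel_upto t) (\<lambda>s. f s - b * y s)" "integrable (lborel_upto t) (\<lambda>s. g s - b * z s)"
    by (intro finite_measure.sq_integrable_imp_integrable[OF finite_measure_lborel_upto]
      sq_integrable_diff sq_integrable_cmult sq)+
  have "u * y t + v * z t = u * (\<integral>s. f s - b * y s \<partial>lborel_upto t) + v * (\<integral>s. g s - b * z s \<partial>lborel_upto t)"
    using assms t by (simp add: lin_sol_def lborel_upto_integral)
  also have "\<dots> = (\<integral>s. u * (f s - b * y s) + v * (g s - b * z s) \<partial>lborel_upto t)"
    using i by simp
  finally show "u * y t + v * z t = (LINT s:{0..t}|lborel. u * f s + v * g s - b * (u * y s + v * z s))"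
    by (simp add: lborel_upto_integral algebra_simps)
qed

lemma lin_sol_unique:
  assumes "lin_sol T b f y" "lin_sol T b f z" "0 \<le> T" "0 \<le> b" "t \<in> {0..T}"
  shows "y t = z t"
proof -
  have "lin_sol T b (\<lambda>s. 0) (\<lambda>s. y s - z s)"
    using lin_sol_lincomb[OF assms(1,2), of 1 "-1"] by simp
  from lin_sol_bound(1)[OF this assms(3-5)] show ?thesis by (simp add: set_lebesgue_integral_def)
qed



section \<open>Completeness of square integrable functions, and the inequality behind the
  contraction factor\<close>

text \<open>Riesz-Fischer with an explicit limit. A pointwise \<open>lim\<close> along a subsequence
  inherits measurability with respect to every sigma-algebra for which the sequence is measurable;
  progressive measurability of limits depends on this.\<close>

lemma sq_integrable_LIMSEQ_complete:
  fixes f :: "nat \<Rightarrow> 'b \<Rightarrow> real"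
  assumes "finite_measure M" and f: "\<And>n. sq_integrable M (f n)"
    and Cauchy: "\<And>e. 0 < e \<Longrightarrow> \<exists>K. \<forall>m\<ge>K. \<forall>n\<ge>K. (\<integral>x. (f m x - f n x)\<^sup>2 \<partial>M) < e"
  obtains r where "strict_mono (r :: nat \<Rightarrow> nat)" "sq_integrable M (\<lambda>x. lim (\<lambda>k. f (r k) x))"
    "(\<lambda>n. \<integral>x. (f n x - lim (\<lambda>k. f (r k) x))\<^sup>2 \<partial>M) \<longlonglongrightarrow> 0"
proof -
  interpret finite_measure M by fact
  have L1: "\<exists>K. \<forall>m\<ge>K. \<forall>n\<ge>K. (\<integral>x. norm (f m x - f n x) \<partial>M) < e" if e: "0 < e" for e
  proof -
    \<comment> \<open>The summand 1 keeps the divisor positive when \<open>M\<close> has total mass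
      zero.\<close>
    define m1 where "m1 = measure M (space M) + 1"
    have m1: "m1 > 0" unfolding m1_def by (simp add: add_nonneg_pos)
    from Cauchy[of "e\<^sup>2 / m1"] obtain K where K: "\<forall>m\<ge>K. \<forall>n\<ge>K. (\<integral>x. (f m x - f n x)\<^sup>2 \<partial>M) < e\<^sup>2 / m1"
      using e m1 by auto
    have "(\<integral>x. norm (f m x - f n x) \<partial>M) < e" if "m \<ge> K" "n \<ge> K" for m n
    proof -
      have d: "sq_integrable M (\<lambda>x. \<bar>f m x - f n x\<bar>)"
        using sq_integrable_diff[OF f f, of m n] by (auto simp: sq_integrable_def)
      have one: "sq_integrable M (\<lambda>x. 1)" by (simp add: sq_integrable_def)
      have "(\<integral>x. \<bar>f m x - f n x\<bar> \<partial>M)\<^sup>2 \<le> (\<integral>x. (f m x - f n x)\<^sup>2 \<partial>M) * measure M (space M)"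
        using integral_Cauchy_Schwarz[OF d one] by simp
      also have "\<dots> \<le> (\<integral>x. (f m x - f n x)\<^sup>2 \<partial>M) * m1"
        by (intro mult_left_mono) (auto simp: m1_def)
      also have "\<dots> < e\<^sup>2 / m1 * m1"
        using K that m1 by (intro mult_strict_right_mono) auto
      finally have "(\<integral>x. \<bar>f m x - f n x\<bar> \<partial>M)\<^sup>2 < e\<^sup>2" using m1 by simp
      then show ?thesis using \<open>0 < e\<close> by (simp add: power_less_imp_less_base)
    qed
    then show ?thesis by blast
  qed
  obtain r where r: "strict_mono r" and AEC: "AE x in M. Cauchy (\<lambda>i. f (r i) x)"
    using cauchy_L1_AE_cauchy_subseq[of M f] sq_integrable_imp_integrable[OF f] L1 by metis
  define g where "g x = lim (\<lambda>k. f (r k) x)" for x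
  have meas[measurable]: "f n \<in> borel_measurable M" for n using f by (auto simp: sq_integrable_def)
  have gm[measurable]: "g \<in> borel_measurable M" unfolding g_def[abs_def] by measurable
  have AEl: "AE x in M. (\<lambda>k. f (r k) x) \<longlonglongrightarrow> g x"
    using AEC by eventually_elim (auto simp: g_def convergent_LIMSEQ_iff[symmetric] Cauchy_convergent)
  \<comment> \<open>Fatou along the almost everywhere convergent subsequence turns mutual distances
    into distances to the limit; \<open>r k \<ge> k\<close> keeps the subsequence beyond
    \<open>K\<close>.\<close>
  have fatou: "(\<integral>\<^sup>+x. ennreal ((f n x - g x)\<^sup>2) \<partial>M) \<le> ennreal e"
    if K: "\<forall>m\<ge>K. \<forall>n\<ge>K. (\<integral>x. (f m x - f n x)\<^sup>2 \<partial>M) < e" and "n \<ge> K" for e K n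
  proof -
    have "(\<integral>\<^sup>+x. ennreal ((f n x - g x)\<^sup>2) \<partial>M) = (\<integral>\<^sup>+x. liminf (\<lambda>k. ennreal ((f n x - f (r k) x)\<^sup>2)) \<partial>M)"
    proof (rule nn_integral_cong_AE)
      show "AE x in M. ennreal ((f n x - g x)\<^sup>2) = liminf (\<lambda>k. ennreal ((f n x - f (r k) x)\<^sup>2))"
        using AEl
      proof eventually_elim
        case (elim x)
        then have "(\<lambda>k. ennreal ((f n x - f (r k) x)\<^sup>2)) \<longlonglongrightarrow> ennreal ((f n x - g x)\<^sup>2)"
          by (intro tendsto_intros)
        then show ?case by (intro lim_imp_Liminf[symmetric]) simp_all
      qed
    qed
    also have "\<dots> \<le> liminf (\<lambda>k. \<integral>\<^sup>+x. ennreal ((f n x - f (r k) x)\<^sup>2) \<partial>M)"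
      by (intro nn_integral_liminf) measurable
    also have "\<dots> \<le> ennreal e"
    proof (rule Liminf_le)
      show "\<forall>\<^sub>F k in sequentially. (\<integral>\<^sup>+x. ennreal ((f n x - f (r k) x)\<^sup>2) \<partial>M) \<le> ennreal e"
        using eventually_ge_at_top[of K]
      proof eventually_elim
        case (elim k)
        then have "r k \<ge> K" using seq_suble[OF r, of k] by simp
        then have "(\<integral>x. (f n x - f (r k) x)\<^sup>2 \<partial>M) \<le> e" using K \<open>n \<ge> K\<close> by (simp add: less_imp_le)
        then show ?case
          using sq_integrable_diff[OF f f, of n "r k"]
          by (subst nn_integral_eq_integral) (auto simp: sq_integrable_def ennreal_leI)
      qed
    qed simp
    finally show ?thesis .
  qed
  have sqd: "sq_integrable M (\<lambda>x. f n x - g x)" if "n \<ge> K" "\<forall>m\<ge>K. \<forall>n\<ge>K. (\<integral>x. (f m x - f n x)\<^sup>2 \<partial>M) < e" for n K e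
    using le_less_trans[OF fatou[OF that(2,1)] ennreal_less_top]
    by (simp add: sq_integrable_def integrable_iff_bounded)
  have g: "sq_integrable M g"
  proof -
    obtain K where "\<forall>m\<ge>K. \<forall>n\<ge>K. (\<integral>x. (f m x - f n x)\<^sup>2 \<partial>M) < 1" using Cauchy[of 1] by auto
    from sq_integrable_diff[OF f sqd[OF order_refl this], of K] show ?thesis by simp
  qed
  have lim: "(\<lambda>n. \<integral>x. (f n x - g x)\<^sup>2 \<partial>M) \<longlonglongrightarrow> 0"
  proof (rule LIMSEQ_I)
    fix e :: real assume "0 < e"
    obtain K where K: "\<forall>m\<ge>K. \<forall>n\<ge>K. (\<integral>x. (f m x - f n x)\<^sup>2 \<partial>M) < e / 2" using Cauchy[of "e/2"] \<open>0 < e\<close> by auto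
    show "\<exists>no. \<forall>n\<ge>no. norm ((\<integral>x. (f n x - g x)\<^sup>2 \<partial>M) - 0) < e"
    proof (intro exI[of _ K] allI impI)
      fix n assume n: "n \<ge> K"
      have "ennreal (\<integral>x. (f n x - g x)\<^sup>2 \<partial>M) \<le> ennreal (e / 2)"
        using fatou[OF K n] sqd[OF n K] by (subst (asm) nn_integral_eq_integral) (auto simp: sq_integrable_def)
      then have "(\<integral>x. (f n x - g x)\<^sup>2 \<partial>M) \<le> e / 2" using \<open>0 < e\<close> by (subst (asm) ennreal_le_iff) auto
      then show "norm ((\<integral>x. (f n x - g x)\<^sup>2 \<partial>M) - 0) < e" using \<open>0 < e\<close> by simp
    qed
  qed
  show thesis using that[OF r] g lim unfolding g_def[abs_def] by simp
qed

text \<open>\<open>A\<close> and \<open>B\<close> stand for values of the form F, \<open>x\<close>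
  and \<open>z\<close> for norms. Cauchy-Schwarz in the plane merges the two products into one. The
  constant is the value of the ratio of \<open>A + v * x^2\<close> to \<open>A + x^2\<close> at the
  extreme case \<open>A = L * x^2\<close>; since \<open>v \<le> 1\<close>, this ratio does not
  decrease in \<open>A\<close>.\<close>

lemma sqrt_mult_add_le:
  fixes A B L v x z :: real
  assumes "0 \<le> A" "A \<le> L * x\<^sup>2" "0 \<le> B" "B \<le> L * z\<^sup>2" "0 \<le> x" "0 \<le> z" "0 \<le> v" "v \<le> 1" "0 \<le> L"
  shows "sqrt A * sqrt B + v * x * z \<le> (L + v) / (L + 1) * (sqrt (A + x\<^sup>2) * sqrt (B + z\<^sup>2))"
proof -
  define k where "k = (L + v) / (L + 1)"
  have k: "0 \<le> k" "k * (L + 1) = L + v" "k \<le> 1" using assms by (auto simp: k_def)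
  have *: "A + v * x\<^sup>2 \<le> k * (A + x\<^sup>2)" if "A \<le> L * x\<^sup>2" for A x
  proof -
    have "(1 - k) * A \<le> (1 - k) * (L * x\<^sup>2)" using that k by (intro mult_left_mono) auto
    also have "\<dots> = (k * (L + 1) - v - k * L) * x\<^sup>2" unfolding k(2) by (simp add: algebra_simps)
    also have "\<dots> = (k - v) * x\<^sup>2" by (simp add: algebra_simps)
    finally show ?thesis by (simp add: algebra_simps)
  qed
  have "sqrt A * sqrt B + v * x * z \<le> sqrt (A + v * x\<^sup>2) * sqrt (B + v * z\<^sup>2)"
  proof (rule power2_le_imp_le)
    have "0 \<le> v * (sqrt A * z - sqrt B * x)\<^sup>2" using assms by simp
    also have "\<dots> = (A + v * x\<^sup>2) * (B + v * z\<^sup>2) - (sqrt A * sqrt B + v * x * z)\<^sup>2"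
      using assms by (simp add: power2_diff power2_sum power_mult_distrib algebra_simps power2_eq_square[of v])
    also have "(A + v * x\<^sup>2) * (B + v * z\<^sup>2) = (sqrt (A + v * x\<^sup>2) * sqrt (B + v * z\<^sup>2))\<^sup>2"
      using assms by (simp add: power_mult_distrib)
    finally show "(sqrt A * sqrt B + v * x * z)\<^sup>2 \<le> (sqrt (A + v * x\<^sup>2) * sqrt (B + v * z\<^sup>2))\<^sup>2" by simp
  qed (use assms in auto)
  also have "\<dots> \<le> sqrt (k * (A + x\<^sup>2)) * sqrt (k * (B + z\<^sup>2))"
    using assms k * by (intro mult_mono real_sqrt_le_mono) (auto intro!: mult_nonneg_nonneg add_nonneg_nonneg)
  also have "\<dots> = k * (sqrt (A + x\<^sup>2) * sqrt (B + z\<^sup>2))"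
    using k by (simp add: real_sqrt_mult)
  finally show ?thesis unfolding k_def .
qed

section \<open>Progressively measurable processes\<close>

locale lq_game_assumptions = prob_space M + lq_game M W N T a \<sigma> \<rho> x q \<epsilon> c
  for M :: "'a measure" and W :: "nat \<Rightarrow> real \<Rightarrow> 'a \<Rightarrow> real" and N T a \<sigma> \<rho> x q \<epsilon> c +
  assumes brownian: "k \<le> N \<Longrightarrow> standard_brownian_motion M (W k)"
    and N_ge_2: "2 \<le> N" and T_pos: "0 < T"
    and a_nonneg: "0 \<le> a" and q_nonneg: "0 \<le> q" and c_nonneg: "0 \<le> c" and q_le: "q\<^sup>2 \<le> \<epsilon>"
begin

abbreviation Q :: "('a \<times> real) measure" where
  "Q \<equiv> completion M \<Otimes>\<^sub>M lborel_upto T"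

sublocale P: prob_space "completion M" by (rule prob_space_completion)
sublocale L: finite_measure "lborel_upto T" by (rule finite_measure_lborel_upto)
sublocale PL: pair_sigma_finite "completion M" "lborel_upto T" ..

lemma finite_measure_Q: "finite_measure Q"
  by (intro finite_measure_pair_measure P.finite_measure_axioms L.finite_measure_axioms)

lemma space_lborel_upto [simp]: "space (lborel_upto t) = {0..t}"
  by (simp add: space_restrict_space)

lemma W_measurable: "k \<le> N \<Longrightarrow> 0 \<le> t \<Longrightarrow> W k t \<in> borel_measurable M"
  using brownian by (auto simp: standard_brownian_motion_def)

abbreviation aug_generator where
  "aug_generator t \<equiv> {W k s -` B \<inter> space M | k s B. k \<le> N \<and> 0 \<le> s \<and> s \<le> t \<and> B \<in> sets borel}
      \<union> null_sets (completion M)"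

lemma aug_generator_subset: "aug_generator t \<subseteq> sets (completion M)"
proof -
  have "W k s -` B \<inter> space M \<in> sets M" if "k \<le> N" "0 \<le> s" "B \<in> sets borel" for k s B
    using measurable_sets[OF W_measurable[OF that(1,2)] that(3)] .
  then show ?thesis using null_setsD2[of _ "completion M"] by (auto intro: sets_completionI_sets)
qed

lemma aug_generator_Pow: "aug_generator t \<subseteq> Pow (space M)"
  using aug_generator_subset[of t] sets.space_closed[of "completion M"] by auto

lemma space_aug_filtration [simp]: "space (aug_filtration t) = space M"
  unfolding aug_filtration_def using aug_generator_Pow by (rule space_measure_of)

lemma sets_aug_filtration: "sets (aug_filtration t) = sigma_sets (space M) (aug_generator t)"
  unfolding aug_filtration_def using aug_generator_Pow by (rule sets_measure_of)

lemma sets_aug_filtration_le: "sets (aug_filtration t) \<subseteq> sets (completion M)"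
  using sets.sigma_sets_subset[OF aug_generator_subset[of t]] by (simp add: sets_aug_filtration)

lemma sets_aug_filtration_mono: "s \<le> t \<Longrightarrow> sets (aug_filtration s) \<subseteq> sets (aug_filtration t)"
  unfolding sets_aug_filtration
proof (intro sigma_sets_mono' Un_mono order_refl subsetI)
  fix A assume st: "s \<le> t"
    and "A \<in> {W k r -` B \<inter> space M | k r B. k \<le> N \<and> 0 \<le> r \<and> r \<le> s \<and> B \<in> sets borel}"
  then obtain k r B where "A = W k r -` B \<inter> space M" "k \<le> N" "0 \<le> r" "r \<le> s" "B \<in> sets borel"
    by blast
  with st show "A \<in> {W k r -` B \<inter> space M | k r B. k \<le> N \<and> 0 \<le> r \<and> r \<le> t \<and> B \<in> sets borel}"
    by (intro CollectI exI[of _ k] exI[of _ r] exI[of _ B]) simp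
qed

lemma measurable_aug_mono:
  "s \<le> t \<Longrightarrow> f \<in> borel_measurable (aug_filtration s) \<Longrightarrow> f \<in> borel_measurable (aug_filtration t)"
  by (rule borel_measurable_subalgebra[OF sets_aug_filtration_mono]) auto

lemma measurable_aug_imp_completion:
  "f \<in> borel_measurable (aug_filtration t) \<Longrightarrow> f \<in> borel_measurable (completion M)"
  by (rule borel_measurable_subalgebra[OF sets_aug_filtration_le]) auto

lemma null_set_in_aug_filtration: "A \<in> null_sets (completion M) \<Longrightarrow> A \<in> sets (aug_filtration t)"
  unfolding sets_aug_filtration by (auto intro: sigma_sets.Basic)

lemma W_adapted: "k \<le> N \<Longrightarrow> 0 \<le> t \<Longrightarrow> W k t \<in> borel_measurable (aug_filtration t)"
  unfolding sets_aug_filtration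
  by (rule measurableI) (auto simp: sets_aug_filtration intro!: sigma_sets.Basic)

text \<open>Every \<open>aug_filtration t\<close> contains all null sets, so a process can be set to
  0 on a null set without losing adaptedness. This turns almost sure path properties into properties
  of all paths.\<close>

lemma measurable_aug_AE_restrict:
  assumes "f \<in> borel_measurable (aug_filtration t)" "A \<in> null_sets (completion M)"
  shows "(\<lambda>\<omega>. if \<omega> \<in> A then 0 else f \<omega>) \<in> borel_measurable (aug_filtration t)"
proof (rule measurable_If_set)
  show "A \<inter> space (aug_filtration t) \<in> sets (aug_filtration t)"
    by (intro sets.Int sets.top null_set_in_aug_filtration assms)
qed (use assms in auto)

lemma progressively_measurable_continuous:
  assumes adapted: "\<And>t. t \<in> {0..T} \<Longrightarrow> z t \<in> borel_measurable (aug_filtration t)"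
    and cont: "\<And>\<omega>. \<omega> \<in> space M \<Longrightarrow> continuous_on {0..T} (\<lambda>t. z t \<omega>)"
  shows "progressively_measurable z"
  unfolding progressively_measurable_def
proof
  fix t assume t: "t \<in> {0..T}"
  let ?R = "restrict_space borel {0..t} \<Otimes>\<^sub>M aug_filtration t"
  have zt: "z s \<in> borel_measurable (aug_filtration t)" if "s \<in> {0..t}" for s
    using adapted[of s] that t by (auto intro: measurable_aug_mono)
  \<comment> \<open>Rounds \<open>s\<close> down to a multiple of \<open>t / (n + 1)\<close>, so
    that the sampled process uses no information beyond time \<open>s\<close>. For
    \<open>t = 0\<close>, division by zero makes it 0.\<close>
  define r where "r n s = t * real_of_int \<lfloor>real (Suc n) * s / t\<rfloor> / real (Suc n)" for n s
  have r_bounds: "r n s \<in> {0..s}" "\<bar>r n s - s\<bar> \<le> t / real (Suc n)" if s: "s \<in> {0..t}" for n s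
  proof -
    have *: "0 \<le> r n s \<and> r n s \<le> s \<and> s - r n s \<le> t / real (Suc n)"
    proof (cases "t = 0")
      case False
      then have t0: "0 < t" using t by auto
      let ?u = "real (Suc n) * s / t"
      have su: "s = t * ?u / real (Suc n)" using t0 by simp
      have fl: "0 \<le> real_of_int \<lfloor>?u\<rfloor>" "real_of_int \<lfloor>?u\<rfloor> \<le> ?u" "?u \<le> real_of_int \<lfloor>?u\<rfloor> + 1"
        using s t0 by auto
      have "t * real_of_int \<lfloor>?u\<rfloor> / real (Suc n) \<le> t * ?u / real (Suc n)"
        using fl t0 by (intro divide_right_mono mult_left_mono) auto
      moreover have "t * ?u / real (Suc n) \<le> t * (real_of_int \<lfloor>?u\<rfloor> + 1) / real (Suc n)"
        using fl t0 by (intro divide_right_mono mult_left_mono) auto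
      moreover have "0 \<le> t * real_of_int \<lfloor>?u\<rfloor> / real (Suc n)" using fl t0 by auto
      ultimately show ?thesis using su unfolding r_def by (simp add: distrib_left add_divide_distrib)
    qed (use s in \<open>simp add: r_def\<close>)
    then show "r n s \<in> {0..s}" "\<bar>r n s - s\<bar> \<le> t / real (Suc n)" by auto
  qed
  define Z where "Z n = (\<lambda>(s, \<omega>). z (r n s) \<omega>)" for n
  have Zm: "Z n \<in> borel_measurable ?R" for n
  proof -
    define k where "k = (\<lambda>p :: real \<times> 'a. \<lfloor>real (Suc n) * fst p / t\<rfloor>)"
    \<comment> \<open>The grid point is clamped to \<open>{0..t}\<close> so that \<open>zz i\<close>
      is measurable for every integer \<open>i\<close>; at the indices \<open>k p\<close> that occur
      the clamping has no effect.\<close>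
    define zz where "zz i = (\<lambda>p :: real \<times> 'a. z (max 0 (min t (t * real_of_int i / real (Suc n)))) (snd p))" for i
    have "zz i \<in> borel_measurable ?R" for i
      unfolding zz_def using t by (intro measurable_compose[OF measurable_snd zt]) auto
    moreover have "k \<in> measurable ?R (count_space UNIV)"
    proof -
      have "fst \<in> measurable ?R borel"
        by (rule measurable_compose[OF measurable_fst]) (auto intro: measurable_restrict_space1)
      then show ?thesis unfolding k_def by measurable
    qed
    ultimately have "(\<lambda>p. zz (k p) p) \<in> borel_measurable ?R"
      by (rule measurable_compose_countable)
    moreover have "zz (k p) p = Z n p" if "p \<in> space ?R" for p
    proof -
      have "fst p \<in> {0..t}" using that by (auto simp: space_pair_measure space_restrict_space)
      from r_bounds(1)[OF this, of n] this have "max 0 (min t (r n (fst p))) = r n (fst p)" by auto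
      then show ?thesis by (simp add: zz_def Z_def k_def case_prod_beta' r_def)
    qed
    ultimately show ?thesis by (simp cong: measurable_cong)
  qed
  have lim: "(\<lambda>n. Z n p) \<longlonglongrightarrow> (\<lambda>(s, \<omega>). z s \<omega>) p" if pR: "p \<in> space ?R" for p
  proof -
    obtain s \<omega> where p: "p = (s, \<omega>)" "s \<in> {0..t}" "\<omega> \<in> space M"
      using pR by (auto simp: space_pair_measure space_restrict_space)
    have "(\<lambda>n. r n s) \<longlonglongrightarrow> s"
    proof (rule LIM_zero_cancel, rule Lim_null_comparison)
      show "\<forall>\<^sub>F n in sequentially. norm (r n s - s) \<le> t / real (Suc n)"
        using r_bounds(2)[OF p(2)] by simp
      show "(\<lambda>n. t / real (Suc n)) \<longlonglongrightarrow> 0"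
        by (rule LIMSEQ_Suc[OF lim_const_over_n])
    qed
    moreover have "r n s \<in> {0..T}" for n
      using r_bounds(1)[OF p(2), of n] p(2) t by simp
    ultimately have "(\<lambda>n. z (r n s) \<omega>) \<longlonglongrightarrow> z s \<omega>"
      using p(2) t by (intro continuous_on_tendsto_compose[OF cont[OF p(3)]]) auto
    then show ?thesis by (simp add: p Z_def)
  qed
  show "(\<lambda>(s, \<omega>). z s \<omega>) \<in> borel_measurable ?R"
    by (rule borel_measurable_LIMSEQ_real[OF lim Zm])
qed

text \<open>The sample point comes first, opposite to \<open>progressively_measurable\<close>, so
  that Fubini integrates over time first, as \<open>cost\<close> and \<open>sq_norm\<close>
  do.\<close>

definition on_Q :: "(real \<Rightarrow> 'a \<Rightarrow> real) \<Rightarrow> 'a \<times> real \<Rightarrow> real" where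
  "on_Q f = (\<lambda>(\<omega>, t). f t \<omega>)"

lemma progressive_imp_measurable_Q:
  assumes "progressively_measurable f"
  shows "on_Q f \<in> borel_measurable Q"
proof -
  have "(\<lambda>(s, \<omega>). f s \<omega>) \<in> borel_measurable (restrict_space borel {0..T} \<Otimes>\<^sub>M aug_filtration T)"
    using assms T_pos by (auto simp: progressively_measurable_def)
  moreover have "(\<lambda>p. (snd p, fst p)) \<in> measurable Q (restrict_space borel {0..T} \<Otimes>\<^sub>M aug_filtration T)"
  proof (rule measurable_Pair)
    have "(\<lambda>x. x) \<in> measurable (lborel_upto T) (restrict_space borel {0..T})"
      by (rule measurable_ident_sets) (simp cong: sets_restrict_space_cong)
    then show "snd \<in> measurable Q (restrict_space borel {0..T})"
      using measurable_compose[OF measurable_snd] by blast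
    have "(\<lambda>x. x) \<in> measurable (completion M) (aug_filtration T)"
      using sets_aug_filtration_le[of T] sets.sets_into_space[of _ "aug_filtration T"]
      by (auto intro!: measurableI simp: Int_absorb2)
    then show "fst \<in> measurable Q (aug_filtration T)"
      using measurable_compose[OF measurable_fst] by blast
  qed
  ultimately have "(\<lambda>p. (\<lambda>(s, \<omega>). f s \<omega>) (snd p, fst p)) \<in> borel_measurable Q"
    by (rule measurable_compose[rotated])
  then show ?thesis by (simp add: on_Q_def case_prod_beta')
qed

lemma sq_norm_eq:
  assumes "progressively_measurable f"
  shows "sq_norm f = (\<integral>\<^sup>+p. ennreal ((on_Q f p)\<^sup>2) \<partial>Q)"
proof -
  have [measurable]: "on_Q f \<in> borel_measurable Q" using assms by (rule progressive_imp_measurable_Q)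
  have "sq_norm f = (\<integral>\<^sup>+\<omega>. (\<integral>\<^sup>+t. ennreal ((on_Q f (\<omega>, t))\<^sup>2) \<partial>lborel_upto T) \<partial>completion M)"
    by (simp add: sq_norm_def on_Q_def nn_integral_restrict_space)
  also have "\<dots> = (\<integral>\<^sup>+p. ennreal ((on_Q f p)\<^sup>2) \<partial>Q)"
    by (rule L.nn_integral_fst) measurable
  finally show ?thesis .
qed

lemma admissible_iff: "f \<in> admissible \<longleftrightarrow> progressively_measurable f \<and> sq_integrable Q (on_Q f)"
  using progressive_imp_measurable_Q[of f]
  by (auto simp: admissible_def sq_norm_eq sq_integrable_def integrable_iff_bounded)

lemma sq_norm_admissible:
  assumes "f \<in> admissible"
  shows "sq_norm f = ennreal (\<integral>p. (on_Q f p)\<^sup>2 \<partial>Q)"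
  using assms by (auto simp: admissible_iff sq_norm_eq sq_integrable_def intro!: nn_integral_eq_integral)

lemma on_Q_simps:
  "on_Q (\<lambda>t \<omega>. f t \<omega> + g t \<omega>) = (\<lambda>p. on_Q f p + on_Q g p)"
  "on_Q (\<lambda>t \<omega>. f t \<omega> - g t \<omega>) = (\<lambda>p. on_Q f p - on_Q g p)"
  "on_Q (\<lambda>t \<omega>. u * f t \<omega>) = (\<lambda>p. u * on_Q f p)"
  by (auto simp: on_Q_def)

lemma admissible_add [intro]:
  "f \<in> admissible \<Longrightarrow> g \<in> admissible \<Longrightarrow> (\<lambda>t \<omega>. f t \<omega> + g t \<omega>) \<in> admissible"
  by (auto simp: admissible_iff on_Q_simps progressively_measurable_def case_prod_beta' intro!: borel_measurable_add)

lemma admissible_cmult [intro]: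
  "f \<in> admissible \<Longrightarrow> (\<lambda>t \<omega>. u * f t \<omega>) \<in> admissible"
  by (auto simp: admissible_iff on_Q_simps progressively_measurable_def case_prod_beta')

lemma admissible_diff [intro]:
  "f \<in> admissible \<Longrightarrow> g \<in> admissible \<Longrightarrow> (\<lambda>t \<omega>. f t \<omega> - g t \<omega>) \<in> admissible"
  by (auto simp: admissible_iff on_Q_simps progressively_measurable_def case_prod_beta' intro!: borel_measurable_diff)

lemma admissible_zero [simp]: "(\<lambda>t \<omega>. 0) \<in> admissible"
  by (auto simp: admissible_iff on_Q_def progressively_measurable_def case_prod_beta')

lemma admissible_sum:
  "(\<And>i. i \<in> I \<Longrightarrow> f i \<in> admissible) \<Longrightarrow> (\<lambda>t \<omega>. \<Sum>i\<in>I. f i t \<omega>) \<in> admissible"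
  by (induction I rule: infinite_finite_induct) auto

text \<open>An L2 limit must itself be a progressively measurable function, not merely a class
  modulo null sets. The pointwise \<open>lim\<close> of a subsequence is measurable at every time
  level simultaneously.\<close>

lemma admissible_complete:
  assumes f: "\<And>n. f n \<in> admissible"
    and Cauchy: "\<And>e. 0 < e \<Longrightarrow> \<exists>K. \<forall>m\<ge>K. \<forall>n\<ge>K. (\<integral>p. (on_Q (f m) p - on_Q (f n) p)\<^sup>2 \<partial>Q) < e"
  obtains g where "g \<in> admissible" "(\<lambda>n. \<integral>p. (on_Q (f n) p - on_Q g p)\<^sup>2 \<partial>Q) \<longlonglongrightarrow> 0"
proof -
  have "sq_integrable Q (on_Q (f n))" for n using f by (simp add: admissible_iff)
  from sq_integrable_LIMSEQ_complete[OF finite_measure_Q this Cauchy]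
  obtain r where r: "strict_mono (r :: nat \<Rightarrow> nat)" "sq_integrable Q (\<lambda>x. lim (\<lambda>k. on_Q (f (r k)) x))"
    "(\<lambda>n. \<integral>x. (on_Q (f n) x - lim (\<lambda>k. on_Q (f (r k)) x))\<^sup>2 \<partial>Q) \<longlonglongrightarrow> 0"
    by blast
  define g where "g t \<omega> = lim (\<lambda>k. f (r k) t \<omega>)" for t \<omega>
  have g: "on_Q g = (\<lambda>x. lim (\<lambda>k. on_Q (f (r k)) x))"
    by (auto simp: on_Q_def g_def)
  have "progressively_measurable g"
    using f unfolding progressively_measurable_def g_def admissible_iff case_prod_beta'
    by (auto intro!: borel_measurable_lim_metric)
  then show thesis using that[of g] r by (simp add: g admissible_iff)
qed

lemma progressive_swap:
  assumes "progressively_measurable f" "t \<in> {0..T}"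
  shows "(\<lambda>(\<omega>, s). f s \<omega>) \<in> borel_measurable (aug_filtration t \<Otimes>\<^sub>M lborel_upto t)"
proof -
  have "(\<lambda>(s, \<omega>). f s \<omega>) \<in> borel_measurable (restrict_space borel {0..t} \<Otimes>\<^sub>M aug_filtration t)"
    using assms by (auto simp: progressively_measurable_def)
  also have "borel_measurable (restrict_space borel {0..t} \<Otimes>\<^sub>M aug_filtration t) =
      borel_measurable (lborel_upto t \<Otimes>\<^sub>M aug_filtration t)"
    by (intro measurable_cong_sets sets_pair_measure_cong sets_restrict_space_cong) auto
  finally show ?thesis
    by (subst measurable_pair_swap_iff) (simp add: case_prod_beta')
qed

lemma on_Q_section_measurable:
  assumes "progressively_measurable f" "\<omega> \<in> space M"
  shows "(\<lambda>t. f t \<omega>) \<in> borel_measurable (lborel_upto T)"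
  using measurable_compose[OF measurable_Pair1' progressive_imp_measurable_Q[OF assms(1)], of \<omega>] assms(2)
  by (simp add: on_Q_def)

lemma admissible_section:
  assumes "f \<in> admissible"
  shows "AE \<omega> in completion M. sq_integrable (lborel_upto T) (\<lambda>t. f t \<omega>)"
proof -
  have "AE \<omega> in completion M. integrable (lborel_upto T) (\<lambda>t. (on_Q f (\<omega>, t))\<^sup>2)"
    using assms by (intro PL.AE_integrable_fst') (simp add: admissible_iff sq_integrable_def)
  then show ?thesis
    using AE_space
  proof eventually_elim
    case (elim \<omega>)
    then show ?case
      using on_Q_section_measurable[of f \<omega>] assms by (simp add: sq_integrable_def on_Q_def admissible_iff)
  qed
qed

lemma integral_Q_square:
  assumes "f \<in> admissible"
  shows "integrable (completion M) (\<lambda>\<omega>. LINT t:{0..T}|lborel. (f t \<omega>)\<^sup>2)"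
    and "(\<integral>\<omega>. (LINT t:{0..T}|lborel. (f t \<omega>)\<^sup>2) \<partial>completion M) = (\<integral>p. (on_Q f p)\<^sup>2 \<partial>Q)"
proof -
  have i: "integrable Q (\<lambda>p. (on_Q f p)\<^sup>2)" using assms by (simp add: admissible_iff sq_integrable_def)
  show "integrable (completion M) (\<lambda>\<omega>. LINT t:{0..T}|lborel. (f t \<omega>)\<^sup>2)"
    using PL.integrable_fst'[OF i] by (simp add: on_Q_def lborel_upto_integral)
  show "(\<integral>\<omega>. (LINT t:{0..T}|lborel. (f t \<omega>)\<^sup>2) \<partial>completion M) = (\<integral>p. (on_Q f p)\<^sup>2 \<partial>Q)"
    using PL.integral_fst'[OF i] by (simp add: on_Q_def lborel_upto_integral)
qed

section \<open>Linear equations driven by admissible processes\<close>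

definition solves :: "real \<Rightarrow> (real \<Rightarrow> 'a \<Rightarrow> real) \<Rightarrow> (real \<Rightarrow> 'a \<Rightarrow> real) \<Rightarrow> bool" where
  "solves b f z \<longleftrightarrow> (AE \<omega> in completion M. lin_sol T b (\<lambda>t. f t \<omega>) (\<lambda>t. z t \<omega>))"

text \<open>Square integrability on \<open>Q\<close> says nothing about a single time, so the
  terminal value needs its own condition; together they make \<open>energy\<close>
  meaningful.\<close>

definition regular :: "(real \<Rightarrow> 'a \<Rightarrow> real) \<Rightarrow> bool" where
  "regular z \<longleftrightarrow> z \<in> admissible \<and> sq_integrable (completion M) (z T)"

text \<open>The path conditions of \<open>is_state\<close>: continuity for every sample point, not
  only almost surely.\<close>

definition continuous_adapted :: "(real \<Rightarrow> 'a \<Rightarrow> real) \<Rightarrow> bool" where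
  "continuous_adapted z \<longleftrightarrow> (\<forall>t\<in>{0..T}. z t \<in> borel_measurable (aug_filtration t)) \<and>
     (\<forall>\<omega>\<in>space M. continuous_on {0..T} (\<lambda>t. z t \<omega>))"

lemma continuous_adaptedD:
  assumes "continuous_adapted z"
  shows "progressively_measurable z" "z T \<in> borel_measurable (completion M)"
  using assms T_pos
  by (auto simp: continuous_adapted_def intro: progressively_measurable_continuous measurable_aug_imp_completion)

lemma continuous_adapted_add:
  "continuous_adapted y \<Longrightarrow> continuous_adapted z \<Longrightarrow> continuous_adapted (\<lambda>t \<omega>. y t \<omega> + z t \<omega>)"
  by (auto simp: continuous_adapted_def intro!: continuous_intros borel_measurable_add)

lemma continuous_adapted_cmult:
  "continuous_adapted z \<Longrightarrow> continuous_adapted (\<lambda>t \<omega>. u * z t \<omega>)"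
  by (auto simp: continuous_adapted_def intro!: continuous_intros)

lemma continuous_adapted_diff:
  "continuous_adapted y \<Longrightarrow> continuous_adapted z \<Longrightarrow> continuous_adapted (\<lambda>t \<omega>. y t \<omega> - z t \<omega>)"
  by (auto simp: continuous_adapted_def intro!: continuous_intros borel_measurable_diff)

lemma continuous_adapted_const: "continuous_adapted (\<lambda>t \<omega>. u)"
  by (auto simp: continuous_adapted_def)

lemma continuous_adapted_sum:
  "(\<And>i. i \<in> I \<Longrightarrow> continuous_adapted (f i)) \<Longrightarrow> continuous_adapted (\<lambda>t \<omega>. \<Sum>i\<in>I. f i t \<omega>)"
  by (induction I rule: infinite_finite_induct)
    (auto intro!: continuous_adapted_add continuous_adapted_const)

lemma regular_add: "regular y \<Longrightarrow> regular z \<Longrightarrow> regular (\<lambda>t \<omega>. y t \<omega> + z t \<omega>)"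
  by (auto simp: regular_def)

lemma regular_diff: "regular y \<Longrightarrow> regular z \<Longrightarrow> regular (\<lambda>t \<omega>. y t \<omega> - z t \<omega>)"
  by (auto simp: regular_def)

lemma regular_cmult: "regular z \<Longrightarrow> regular (\<lambda>t \<omega>. u * z t \<omega>)"
  by (auto simp: regular_def)

lemma regular_const: "regular (\<lambda>t \<omega>. u)"
proof -
  interpret Q: finite_measure Q by (rule finite_measure_Q)
  show ?thesis
    by (auto simp: regular_def admissible_iff on_Q_def sq_integrable_def progressively_measurable_def case_prod_beta')
qed

lemma regular_sum:
  "(\<And>i. i \<in> I \<Longrightarrow> regular (f i)) \<Longrightarrow> regular (\<lambda>t \<omega>. \<Sum>i\<in>I. f i t \<omega>)"
  by (induction I rule: infinite_finite_induct) (auto intro!: regular_add regular_const)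

lemma solves_lincomb:
  assumes "solves b f y" "solves b g z"
  shows "solves b (\<lambda>t \<omega>. u * f t \<omega> + v * g t \<omega>) (\<lambda>t \<omega>. u * y t \<omega> + v * z t \<omega>)"
  using assms unfolding solves_def by eventually_elim (rule lin_sol_lincomb)

lemma solves_cmult: "solves b f y \<Longrightarrow> solves b (\<lambda>t \<omega>. u * f t \<omega>) (\<lambda>t \<omega>. u * y t \<omega>)"
  using solves_lincomb[of b f y f y u 0] by simp

lemma solves_diff:
  "solves b f y \<Longrightarrow> solves b g z \<Longrightarrow> solves b (\<lambda>t \<omega>. f t \<omega> - g t \<omega>) (\<lambda>t \<omega>. y t \<omega> - z t \<omega>)"
  using solves_lincomb[of b f y g z 1 "-1"] by simp

lemma solves_add:
  "solves b f y \<Longrightarrow> solves b g z \<Longrightarrow> solves b (\<lambda>t \<omega>. f t \<omega> + g t \<omega>) (\<lambda>t \<omega>. y t \<omega> + z t \<omega>)"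
  using solves_lincomb[of b f y g z 1 1] by simp

lemma solves_zero: "solves b (\<lambda>t \<omega>. 0) (\<lambda>t \<omega>. 0)"
  by (auto simp: solves_def lin_sol_def set_lebesgue_integral_def)

lemma solves_sum:
  "(\<And>i. i \<in> I \<Longrightarrow> solves b (f i) (z i)) \<Longrightarrow>
    solves b (\<lambda>t \<omega>. \<Sum>i\<in>I. f i t \<omega>) (\<lambda>t \<omega>. \<Sum>i\<in>I. z i t \<omega>)"
  by (induction I rule: infinite_finite_induct) (auto intro!: solves_add solves_zero)

lemma solves_add_rate: "solves b f z \<Longrightarrow> solves (b + u) (\<lambda>t \<omega>. f t \<omega> + u * z t \<omega>) z"
  unfolding solves_def by (auto elim!: eventually_mono intro: lin_sol_add_rate)

lemma solves_unique:
  assumes "solves b f y" "solves b f z" "0 \<le> b"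
  shows "AE \<omega> in completion M. \<forall>t\<in>{0..T}. y t \<omega> = z t \<omega>"
  using assms(1,2) unfolding solves_def
  by eventually_elim (use T_pos assms(3) in \<open>auto intro: lin_sol_unique\<close>)

text \<open>Apart from the equation only measurability of \<open>z\<close> is assumed. The pathwise
  bounds by the forcing supply both integrability and, after taking expectations, the
  estimates.\<close>

lemma solves_regular:
  assumes f: "f \<in> admissible" and sol: "solves b f z" and "0 \<le> b"
    and z: "progressively_measurable z" "z T \<in> borel_measurable (completion M)"
  shows "regular z"
    and "(1 + T\<^sup>2 * b\<^sup>2) * (\<integral>p. (on_Q z p)\<^sup>2 \<partial>Q) \<le> T\<^sup>2 * (\<integral>p. (on_Q f p)\<^sup>2 \<partial>Q)"
    and "(\<integral>\<omega>. (z T \<omega>)\<^sup>2 \<partial>completion M) \<le> T * (\<integral>p. (on_Q f p)\<^sup>2 \<partial>Q)"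
proof -
  note fi = integral_Q_square[OF f]
  have zQ[measurable]: "on_Q z \<in> borel_measurable Q" using z by (intro progressive_imp_measurable_Q)
  have zT_le: "AE \<omega> in completion M. (z T \<omega>)\<^sup>2 \<le> T * (LINT t:{0..T}|lborel. (f t \<omega>)\<^sup>2)"
    using sol unfolding solves_def
    by eventually_elim (use T_pos \<open>0 \<le> b\<close> in \<open>auto intro: lin_sol_bound\<close>)
  have zT_i: "integrable (completion M) (\<lambda>\<omega>. (z T \<omega>)\<^sup>2)"
  proof (rule Bochner_Integration.integrable_bound)
    show "integrable (completion M) (\<lambda>\<omega>. T * (LINT t:{0..T}|lborel. (f t \<omega>)\<^sup>2))"
      using fi(1) by simp
    show "(\<lambda>\<omega>. (z T \<omega>)\<^sup>2) \<in> borel_measurable (completion M)"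
      using z(2) by simp
    show "AE \<omega> in completion M. norm ((z T \<omega>)\<^sup>2) \<le> norm (T * (LINT t:{0..T}|lborel. (f t \<omega>)\<^sup>2))"
      using zT_le unfolding real_norm_def abs_power2 by eventually_elim linarith
  qed
  show "(\<integral>\<omega>. (z T \<omega>)\<^sup>2 \<partial>completion M) \<le> T * (\<integral>p. (on_Q f p)\<^sup>2 \<partial>Q)"
    using integral_mono_AE[OF zT_i integrable_mult_right[OF fi(1)] zT_le] fi(2) by simp
  have z_le: "AE \<omega> in completion M. (1 + T\<^sup>2 * b\<^sup>2) * (LINT t:{0..T}|lborel. (z t \<omega>)\<^sup>2) \<le> T\<^sup>2 * (LINT t:{0..T}|lborel. (f t \<omega>)\<^sup>2)"
    using sol unfolding solves_def
    by eventually_elim (use T_pos \<open>0 \<le> b\<close> in \<open>auto intro: lin_sol_bound\<close>)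
  have zi: "AE \<omega> in completion M. integrable (lborel_upto T) (\<lambda>t. (z t \<omega>)\<^sup>2)"
    using sol unfolding solves_def
    by eventually_elim (auto simp: lin_sol_def dest: sq_integrable_continuous intro: sq_integrableD)
  have mz: "(\<lambda>\<omega>. LINT t:{0..T}|lborel. (z t \<omega>)\<^sup>2) \<in> borel_measurable (completion M)"
  proof -
    have "(\<lambda>(\<omega>, t). (z t \<omega>)\<^sup>2) \<in> borel_measurable Q"
      using borel_measurable_power[OF zQ, of 2] by (simp add: on_Q_def case_prod_beta')
    from L.borel_measurable_lebesgue_integral[OF this] show ?thesis by (simp add: lborel_upto_integral)
  qed
  have nonneg: "0 \<le> (LINT t:{0..T}|lborel. (z t \<omega>)\<^sup>2)" for \<omega> by (simp add: set_lebesgue_integral_def)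
  have z_i: "integrable (completion M) (\<lambda>\<omega>. LINT t:{0..T}|lborel. (z t \<omega>)\<^sup>2)"
  proof (rule Bochner_Integration.integrable_bound[OF _ mz])
    show "integrable (completion M) (\<lambda>\<omega>. T\<^sup>2 * (LINT t:{0..T}|lborel. (f t \<omega>)\<^sup>2))"
      using fi(1) by simp
    show "AE \<omega> in completion M. norm (LINT t:{0..T}|lborel. (z t \<omega>)\<^sup>2) \<le> norm (T\<^sup>2 * (LINT t:{0..T}|lborel. (f t \<omega>)\<^sup>2))"
      using z_le
    proof eventually_elim
      case (elim \<omega>)
      have "0 \<le> T\<^sup>2 * b\<^sup>2 * (LINT t:{0..T}|lborel. (z t \<omega>)\<^sup>2)" using nonneg by simp
      then have "(LINT t:{0..T}|lborel. (z t \<omega>)\<^sup>2) \<le> T\<^sup>2 * (LINT t:{0..T}|lborel. (f t \<omega>)\<^sup>2)"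
        using elim by (simp add: distrib_right)
      then show ?case using nonneg[of \<omega>] unfolding real_norm_def by linarith
    qed
  qed
  have "integrable Q (\<lambda>p. (on_Q z p)\<^sup>2)"
  proof (rule PL.Fubini_integrable)
    show "integrable (completion M) (\<lambda>\<omega>. LINT t|lborel_upto T. norm ((on_Q z (\<omega>, t))\<^sup>2))"
      using z_i by (simp add: on_Q_def lborel_upto_integral)
    show "AE \<omega> in completion M. integrable (lborel_upto T) (\<lambda>t. (on_Q z (\<omega>, t))\<^sup>2)"
      using zi by (simp add: on_Q_def)
  qed simp
  then have za: "z \<in> admissible" using z zQ by (simp add: admissible_iff sq_integrable_def)
  then show "regular z" using z zT_i by (simp add: regular_def sq_integrable_def)
  show "(1 + T\<^sup>2 * b\<^sup>2) * (\<integral>p. (on_Q z p)\<^sup>2 \<partial>Q) \<le> T\<^sup>2 * (\<integral>p. (on_Q f p)\<^sup>2 \<partial>Q)"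
    using integral_mono_AE[OF integrable_mult_right[OF z_i] integrable_mult_right[OF fi(1)] z_le]
      integral_Q_square(2)[OF za] fi(2) by simp
qed

text \<open>Variation of constants path by path, set to 0 on the null set of paths where
  \<open>f\<close> is not square integrable. At time \<open>t\<close> the formula integrates a
  progressively measurable process over \<open>{0..t}\<close>, hence it is adapted.\<close>

lemma solves_exists:
  assumes f: "f \<in> admissible" and "0 \<le> b"
  obtains z where "regular z" "continuous_adapted z" "solves b f z"
proof -
  obtain A where A: "{\<omega> \<in> space (completion M). \<not> sq_integrable (lborel_upto T) (\<lambda>t. f t \<omega>)} \<subseteq> A"
    "A \<in> null_sets (completion M)"
    using admissible_section[OF f] by (auto simp: eventually_ae_filter)
  define y where "y t \<omega> = exp (- b * t) * (LINT s:{0..t}|lborel. exp (b * s) * f s \<omega>)" for t \<omega>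
  define z where "z t \<omega> = (if \<omega> \<in> A then 0 else y t \<omega>)" for t \<omega>
  have sol: "lin_sol T b (\<lambda>t. f t \<omega>) (\<lambda>t. y t \<omega>)" if "\<omega> \<in> space M" "\<omega> \<notin> A" for \<omega>
    unfolding y_def using that A by (intro lin_sol_exists) auto
  have ad: "z t \<in> borel_measurable (aug_filtration t)" if t: "t \<in> {0..T}" for t
    unfolding z_def
  proof (rule measurable_aug_AE_restrict[OF _ A(2)])
    interpret Lt: finite_measure "lborel_upto t" by (rule finite_measure_lborel_upto)
    have [measurable]: "(\<lambda>(\<omega>, s). f s \<omega>) \<in> borel_measurable (aug_filtration t \<Otimes>\<^sub>M lborel_upto t)"
      using f t by (intro progressive_swap) (auto simp: admissible_iff)
    have [measurable]: "(\<lambda>s. exp (b * s)) \<in> borel_measurable (lborel_upto t)"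
      by (rule measurable_restrict_space1) simp
    have "(\<lambda>\<omega>. LINT s|lborel_upto t. exp (b * s) * f s \<omega>) \<in> borel_measurable (aug_filtration t)"
      by (rule Lt.borel_measurable_lebesgue_integral) measurable
    then show "y t \<in> borel_measurable (aug_filtration t)"
      by (simp add: y_def[abs_def] lborel_upto_integral)
  qed
  have "continuous_on {0..T} (\<lambda>t. z t \<omega>)" if "\<omega> \<in> space M" for \<omega>
    using sol[OF that] by (cases "\<omega> \<in> A") (auto simp: z_def lin_sol_def)
  with ad have ca: "continuous_adapted z" by (simp add: continuous_adapted_def)
  have s: "solves b f z"
    unfolding solves_def using AE_not_in[OF A(2)] AE_space
    by eventually_elim (use sol in \<open>simp add: z_def\<close>)
  show thesis
    using that[OF _ ca s] solves_regular(1)[OF f s \<open>0 \<le> b\<close>] continuous_adaptedD[OF ca] by blast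
qed


section \<open>The state process\<close>

lemma brownian_second_moment:
  assumes "k \<le> N" "0 \<le> t"
  shows "sq_integrable M (W k t)" "expectation (\<lambda>\<omega>. (W k t \<omega>)\<^sup>2) = t"
proof -
  note B = brownian[OF assms(1), unfolded standard_brownian_motion_def]
  have Wm: "W k t \<in> borel_measurable M" using W_measurable assms by auto
  have W0: "AE \<omega> in M. W k 0 \<omega> = 0" using B by blast
  have *: "sq_integrable M (W k t) \<and> expectation (\<lambda>\<omega>. (W k t \<omega>)\<^sup>2) = t"
  proof (cases "t = 0")
    case True
    have "AE \<omega> in M. (W k t \<omega>)\<^sup>2 = 0" using W0 True by auto
    then have "integrable M (\<lambda>\<omega>. (W k t \<omega>)\<^sup>2)" "expectation (\<lambda>\<omega>. (W k t \<omega>)\<^sup>2) = 0"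
      using Wm integrable_cong_AE[of "\<lambda>\<omega>. (W k t \<omega>)\<^sup>2" M "\<lambda>_. 0"]
        integral_cong_AE[of "\<lambda>\<omega>. (W k t \<omega>)\<^sup>2" M "\<lambda>_. 0"] by auto
    then show ?thesis using Wm True by (simp add: sq_integrable_def)
  next
    case False
    define X where "X = (\<lambda>\<omega>. W k t \<omega> - W k 0 \<omega>)"
    have t: "0 < t" using False assms by simp
    have D: "distributed M lborel X (normal_density 0 (sqrt (t - 0)))"
      unfolding X_def using B t by blast
    have s: "0 < sqrt (t - 0)" using t by simp
    have v: "expectation (\<lambda>\<omega>. (X \<omega>)\<^sup>2) = t"
      using normal_distributed_variance[OF s D] normal_distributed_expectation[OF s D] t by simp
    \<comment> \<open>A function that is not integrable has Bochner integral 0, whereas this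
      integral is \<open>t > 0\<close>.\<close>
    then have i: "integrable M (\<lambda>\<omega>. (X \<omega>)\<^sup>2)" using t not_integrable_integral_eq by fastforce
    have Xm: "X \<in> borel_measurable M" unfolding X_def using W_measurable assms by auto
    have ae: "AE \<omega> in M. (X \<omega>)\<^sup>2 = (W k t \<omega>)\<^sup>2" using W0 by eventually_elim (simp add: X_def)
    have "integrable M (\<lambda>\<omega>. (W k t \<omega>)\<^sup>2)" "expectation (\<lambda>\<omega>. (W k t \<omega>)\<^sup>2) = t"
      using integrable_cong_AE[OF _ _ ae] integral_cong_AE[OF _ _ ae] Xm Wm i v by auto
    then show ?thesis using Wm by (simp add: sq_integrable_def)
  qed
  then show "sq_integrable M (W k t)" "expectation (\<lambda>\<omega>. (W k t \<omega>)\<^sup>2) = t" by auto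
qed

lemma regular_brownian_version:
  assumes "k \<le> N"
  obtains B where "regular B" "continuous_adapted B" "AE \<omega> in completion M. \<forall>t\<in>{0..T}. B t \<omega> = W k t \<omega>"
proof -
  have "AE \<omega> in completion M. continuous_on {0..} (\<lambda>t. W k t \<omega>)"
    using brownian[OF assms] by (auto simp: standard_brownian_motion_def intro: AE_completion)
  then obtain A where A: "{\<omega> \<in> space (completion M). \<not> continuous_on {0..} (\<lambda>t. W k t \<omega>)} \<subseteq> A"
    "A \<in> null_sets (completion M)"
    by (auto simp: eventually_ae_filter)
  define B where "B t \<omega> = (if \<omega> \<in> A then 0 else W k t \<omega>)" for t \<omega>
  have ae: "AE \<omega> in completion M. \<forall>t\<in>{0..T}. B t \<omega> = W k t \<omega>"
    using AE_not_in[OF A(2)] by eventually_elim (simp add: B_def)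
  have "B t \<in> borel_measurable (aug_filtration t)" if "t \<in> {0..T}" for t
    unfolding B_def using measurable_aug_AE_restrict[OF W_adapted[OF assms] A(2), of t] that by simp
  moreover have "continuous_on {0..T} (\<lambda>t. B t \<omega>)" if "\<omega> \<in> space M" for \<omega>
  proof (cases "\<omega> \<in> A")
    case False
    then have "continuous_on {0..} (\<lambda>t. W k t \<omega>)" using that A by auto
    then show ?thesis using False by (auto simp: B_def intro: continuous_on_subset)
  qed (simp add: B_def)
  ultimately have ca: "continuous_adapted B" by (simp add: continuous_adapted_def)
  note cB = continuous_adaptedD[OF ca]
  have Bt: "sq_integrable (completion M) (B t) \<and> (\<integral>\<omega>. (B t \<omega>)\<^sup>2 \<partial>completion M) = t" if t: "t \<in> {0..T}" for t
  proof -
    have 1: "sq_integrable (completion M) (W k t)"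
      using brownian_second_moment(1)[OF assms, of t] t integrable_completion[of "\<lambda>\<omega>. (W k t \<omega>)\<^sup>2"]
      by (auto simp: sq_integrable_def measurable_completion)
    have 2: "(\<integral>\<omega>. (W k t \<omega>)\<^sup>2 \<partial>completion M) = t"
      using brownian_second_moment[OF assms, of t] t integral_completion[of "\<lambda>\<omega>. (W k t \<omega>)\<^sup>2"]
      by (auto simp: sq_integrable_def)
    have m: "B t \<in> borel_measurable (completion M)"
      using ca t by (auto simp: continuous_adapted_def intro: measurable_aug_imp_completion)
    have ae': "AE \<omega> in completion M. W k t \<omega> = B t \<omega>" using ae by eventually_elim (use t in auto)
    have "(\<integral>\<omega>. (W k t \<omega>)\<^sup>2 \<partial>completion M) = (\<integral>\<omega>. (B t \<omega>)\<^sup>2 \<partial>completion M)"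
      using ae' m 1 by (intro integral_cong_AE) (auto simp: sq_integrable_def)
    then show ?thesis using sq_integrable_cong_AE[OF 1 m ae'] 2 by simp
  qed
  have [measurable]: "on_Q B \<in> borel_measurable Q" by (intro progressive_imp_measurable_Q cB)
  \<comment> \<open>Tonelli with the sample point inside, because the second moment is known at each
    fixed time and is at most \<open>T\<close>.\<close>
  have "(\<integral>\<^sup>+p. ennreal ((on_Q B p)\<^sup>2) \<partial>Q) = (\<integral>\<^sup>+t. (\<integral>\<^sup>+\<omega>. ennreal ((on_Q B (\<omega>, t))\<^sup>2) \<partial>completion M) \<partial>lborel_upto T)"
    by (rule PL.nn_integral_snd[symmetric]) measurable
  also have "\<dots> \<le> (\<integral>\<^sup>+t. ennreal T \<partial>lborel_upto T)"
  proof (rule nn_integral_mono)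
    fix t assume "t \<in> space (lborel_upto T)"
    then have t: "t \<in> {0..T}" by simp
    have "(\<integral>\<^sup>+\<omega>. ennreal ((on_Q B (\<omega>, t))\<^sup>2) \<partial>completion M) = ennreal t"
      using Bt[OF t] unfolding on_Q_def
      by (subst nn_integral_eq_integral) (auto simp: sq_integrable_def)
    also have "\<dots> \<le> ennreal T" using t by (simp add: ennreal_leI)
    finally show "(\<integral>\<^sup>+\<omega>. ennreal ((on_Q B (\<omega>, t))\<^sup>2) \<partial>completion M) \<le> ennreal T" .
  qed
  also have "\<dots> < \<infinity>" by (simp add: ennreal_mult_less_top L.emeasure_eq_measure)
  finally have "B \<in> admissible" using cB by (simp add: admissible_def sq_norm_eq)
  then have "regular B" using Bt[of T] T_pos by (simp add: regular_def)
  from that[OF this ca ae] show thesis .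
qed


text \<open>Applied to states, controls and noise alike: the deviation of the controls is the
  control part of the drift of the deviation of the states.\<close>

definition deviation :: "(nat \<Rightarrow> real \<Rightarrow> 'a \<Rightarrow> real) \<Rightarrow> nat \<Rightarrow> real \<Rightarrow> 'a \<Rightarrow> real" where
  "deviation X i t \<omega> = average X t \<omega> - X i t \<omega>"

lemma average_eq: "average X = (\<lambda>t \<omega>. 1 / real N * (\<Sum>j = 1..N. X j t \<omega>))"
  by (simp add: average_def fun_eq_iff)

lemma sum_deviation: "(\<Sum>j = 1..N. deviation X j t \<omega>) = 0"
  using N_ge_2 by (simp add: deviation_def average_def sum_subtractf)

lemma admissible_average: "\<alpha> \<in> admissible_profiles \<Longrightarrow> average \<alpha> \<in> admissible"
  unfolding average_eq by (intro admissible_cmult admissible_sum) (auto simp: admissible_profiles_def)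

lemma admissible_deviation: "\<alpha> \<in> admissible_profiles \<Longrightarrow> i \<in> {1..N} \<Longrightarrow> deviation \<alpha> i \<in> admissible"
  unfolding deviation_def[abs_def] using admissible_average[of \<alpha>]
  by (intro admissible_diff) (auto simp: admissible_profiles_def)

text \<open>The Brownian paths are continuous only almost surely, whereas \<open>is_state\<close> demands continuity
  everywhere; a noise version is modified on a null set, which the augmented filtration contains.\<close>

definition noise_version :: "(nat \<Rightarrow> real \<Rightarrow> 'a \<Rightarrow> real) \<Rightarrow> bool" where
  "noise_version \<nu> \<longleftrightarrow> (\<forall>i\<in>{1..N}. regular (\<nu> i) \<and> continuous_adapted (\<nu> i) \<and>
     (AE \<omega> in completion M. \<forall>t\<in>{0..T}.
        \<nu> i t \<omega> = x i + \<sigma> * (\<rho> * W 0 t \<omega> + sqrt (1 - \<rho>\<^sup>2) * W i t \<omega>)))"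

lemma noise_version_exists: "\<exists>\<nu>. noise_version \<nu>"
proof -
  have "\<exists>\<nu>i. regular \<nu>i \<and> continuous_adapted \<nu>i \<and>
     (AE \<omega> in completion M. \<forall>t\<in>{0..T}.
        \<nu>i t \<omega> = x i + \<sigma> * (\<rho> * W 0 t \<omega> + sqrt (1 - \<rho>\<^sup>2) * W i t \<omega>))" if i: "i \<in> {1..N}" for i
  proof -
    obtain B0 where B0: "regular B0" "continuous_adapted B0" "AE \<omega> in completion M. \<forall>t\<in>{0..T}. B0 t \<omega> = W 0 t \<omega>"
      using regular_brownian_version[of 0] by auto
    obtain B where B: "regular B" "continuous_adapted B" "AE \<omega> in completion M. \<forall>t\<in>{0..T}. B t \<omega> = W i t \<omega>"
      using regular_brownian_version[of i] i by auto
    show ?thesis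
    proof (intro exI conjI)
      let ?\<nu> = "\<lambda>t \<omega>. x i + \<sigma> * (\<rho> * B0 t \<omega> + sqrt (1 - \<rho>\<^sup>2) * B t \<omega>)"
      show "regular ?\<nu>" by (intro regular_add regular_const regular_cmult B0 B)
      show "continuous_adapted ?\<nu>"
        by (intro continuous_adapted_add continuous_adapted_const continuous_adapted_cmult B0 B)
      show "AE \<omega> in completion M. \<forall>t\<in>{0..T}.
        ?\<nu> t \<omega> = x i + \<sigma> * (\<rho> * W 0 t \<omega> + sqrt (1 - \<rho>\<^sup>2) * W i t \<omega>)"
        using B0(3) B(3) by eventually_elim simp
    qed
  qed
  then have "\<forall>i\<in>{1..N}. \<exists>\<nu>i. regular \<nu>i \<and> continuous_adapted \<nu>i \<and>
     (AE \<omega> in completion M. \<forall>t\<in>{0..T}.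
        \<nu>i t \<omega> = x i + \<sigma> * (\<rho> * W 0 t \<omega> + sqrt (1 - \<rho>\<^sup>2) * W i t \<omega>))" by blast
  from bchoice[OF this] show ?thesis unfolding noise_version_def by blast
qed

lemma noise_versionD:
  assumes "noise_version \<nu>"
  shows "i \<in> {1..N} \<Longrightarrow> regular (\<nu> i)" "i \<in> {1..N} \<Longrightarrow> continuous_adapted (\<nu> i)"
    "regular (average \<nu>)" "continuous_adapted (average \<nu>)"
proof -
  show *: "i \<in> {1..N} \<Longrightarrow> regular (\<nu> i)" "i \<in> {1..N} \<Longrightarrow> continuous_adapted (\<nu> i)" for i
    using assms unfolding noise_version_def by blast+
  show "regular (average \<nu>)" "continuous_adapted (average \<nu>)"
    unfolding average_eq by (intro regular_cmult regular_sum continuous_adapted_cmult continuous_adapted_sum *; assumption)+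
qed

lemma noise_version_AE:
  assumes "noise_version \<nu>"
  shows "AE \<omega> in completion M. \<forall>i\<in>{1..N}. \<forall>t\<in>{0..T}.
    \<nu> i t \<omega> = x i + \<sigma> * (\<rho> * W 0 t \<omega> + sqrt (1 - \<rho>\<^sup>2) * W i t \<omega>)"
  using assms unfolding noise_version_def by (subst AE_ball_countable) auto

lemma regular_admissible: "regular z \<Longrightarrow> z \<in> admissible"
  by (simp add: regular_def)

lemma solves_AE:
  assumes "solves b f z"
  shows "AE \<omega> in completion M. \<forall>t\<in>{0..T}. z t \<omega> = (LINT s:{0..t}|lborel. f s \<omega> - b * z s \<omega>)"
  using assms unfolding solves_def by eventually_elim (simp add: lin_sol_def)

text \<open>The players are coupled only through the average, and mean reversion cancels in the sum
  over all players. So the average is found first, then each player solves a scalar equation with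
  the average inserted.\<close>

lemma is_state_exists:
  assumes \<alpha>: "\<alpha> \<in> admissible_profiles"
  shows "\<exists>X. is_state \<alpha> X"
proof -
  obtain \<nu> where \<nu>: "noise_version \<nu>" using noise_version_exists by blast
  note \<nu>D = noise_versionD[OF \<nu>]
  have \<alpha>i: "\<alpha> i \<in> admissible" if "i \<in> {1..N}" for i using \<alpha> that by (auto simp: admissible_profiles_def)
  \<comment> \<open>Candidate for the average of the states minus the average noise: rate 0, because
    the mean reversion has cancelled.\<close>
  obtain D where D: "regular D" "continuous_adapted D" "solves 0 (average \<alpha>) D"
    using solves_exists[OF admissible_average[OF \<alpha>], of 0] by auto
  define F where "F i t \<omega> = \<alpha> i t \<omega> + a * (average \<nu> t \<omega> + D t \<omega> - \<nu> i t \<omega>)" for i t \<omega>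
  have F: "F i \<in> admissible" if "i \<in> {1..N}" for i
    unfolding F_def
    by (intro admissible_add admissible_cmult admissible_diff \<alpha>i[OF that]
        regular_admissible[OF \<nu>D(1)[OF that]] regular_admissible[OF \<nu>D(3)] regular_admissible[OF D(1)])
  have "\<forall>i\<in>{1..N}. \<exists>Y. continuous_adapted Y \<and> solves a (F i) Y"
    using solves_exists[OF F a_nonneg] by blast
  from bchoice[OF this] obtain Y where Y: "\<And>i. i \<in> {1..N} \<Longrightarrow> continuous_adapted (Y i)"
    "\<And>i. i \<in> {1..N} \<Longrightarrow> solves a (F i) (Y i)" by blast
  have sY: "solves a (average F) (average Y)"
    unfolding average_eq by (intro solves_cmult solves_sum Y)
  have "average F = (\<lambda>t \<omega>. average \<alpha> t \<omega> + a * D t \<omega>)"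
  proof (intro ext)
    fix t \<omega>
    have "(\<Sum>j = 1..N. F j t \<omega>) = (\<Sum>j = 1..N. \<alpha> j t \<omega>) + a * (\<Sum>j = 1..N. deviation \<nu> j t \<omega> + D t \<omega>)"
    proof -
      have "F j t \<omega> = \<alpha> j t \<omega> + a * (deviation \<nu> j t \<omega> + D t \<omega>)" for j
        by (simp add: F_def deviation_def algebra_simps)
      then show ?thesis by (simp only: sum.distrib sum_distrib_left[symmetric])
    qed
    also have "(\<Sum>j = 1..N. deviation \<nu> j t \<omega> + D t \<omega>) = N * D t \<omega>"
      unfolding sum.distrib sum_deviation by simp
    finally show "average F t \<omega> = average \<alpha> t \<omega> + a * D t \<omega>"
      using N_ge_2 by (simp add: average_def add_divide_distrib)
  qed
  \<comment> \<open>Consistency: raised to rate \<open>a\<close>, the equation of \<open>D\<close>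
    coincides with the averaged equation of the \<open>Y i\<close>, so by uniqueness the inserted
    average is the true one.\<close>
  with solves_add_rate[OF D(3), of a] sY
  have avgY: "AE \<omega> in completion M. \<forall>t\<in>{0..T}. average Y t \<omega> = D t \<omega>"
    using solves_unique[of a "average F" "average Y" D] a_nonneg by simp
  define X where "X i t \<omega> = \<nu> i t \<omega> + Y i t \<omega>" for i t \<omega>
  have "is_state \<alpha> X"
    unfolding is_state_def
  proof (intro ballI conjI)
    fix i assume i: "i \<in> {1..N}"
    have "continuous_adapted (X i)"
      unfolding X_def using Y(1)[OF i] \<nu>D(2)[OF i] by (intro continuous_adapted_add)
    then show "\<And>t. t \<in> {0..T} \<Longrightarrow> X i t \<in> borel_measurable (aug_filtration t)"
      "\<And>\<omega>. \<omega> \<in> space M \<Longrightarrow> continuous_on {0..T} (\<lambda>t. X i t \<omega>)"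
      by (auto simp: continuous_adapted_def)
    show "AE \<omega> in completion M. \<forall>t\<in>{0..T}.
        X i t \<omega> = x i
          + (LINT s:{0..t}|lborel. a * (average X s \<omega> - X i s \<omega>) + \<alpha> i s \<omega>)
          + \<sigma> * (\<rho> * W 0 t \<omega> + sqrt (1 - \<rho>\<^sup>2) * W i t \<omega>)"
      using avgY noise_version_AE[OF \<nu>] solves_AE[OF Y(2)[OF i]]
    proof eventually_elim
      case (elim \<omega>)
      show ?case
      proof
        fix t assume t: "t \<in> {0..T}"
        have avgX: "average X s \<omega> = average \<nu> s \<omega> + average Y s \<omega>" for s
          by (simp add: average_def X_def sum.distrib add_divide_distrib)
        have "(LINT s:{0..t}|lborel. F i s \<omega> - a * Y i s \<omega>) =
            (LINT s:{0..t}|lborel. a * (average X s \<omega> - X i s \<omega>) + \<alpha> i s \<omega>)"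
        proof (rule set_lebesgue_integral_cong, simp, intro allI impI)
          fix s assume "s \<in> {0..t}"
          then have "D s \<omega> = average Y s \<omega>" using elim(1) t by auto
          then show "F i s \<omega> - a * Y i s \<omega> = a * (average X s \<omega> - X i s \<omega>) + \<alpha> i s \<omega>"
            by (simp add: F_def avgX X_def algebra_simps)
        qed
        moreover have "Y i t \<omega> = (LINT s:{0..t}|lborel. F i s \<omega> - a * Y i s \<omega>)"
          using elim(3) t by blast
        moreover have "\<nu> i t \<omega> = x i + \<sigma> * (\<rho> * W 0 t \<omega> + sqrt (1 - \<rho>\<^sup>2) * W i t \<omega>)"
          using elim(2) i t by blast
        ultimately show "X i t \<omega> = x i
          + (LINT s:{0..t}|lborel. a * (average X s \<omega> - X i s \<omega>) + \<alpha> i s \<omega>)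
          + \<sigma> * (\<rho> * W 0 t \<omega> + sqrt (1 - \<rho>\<^sup>2) * W i t \<omega>)"
          by (simp add: X_def)
      qed
    qed
  qed
  then show ?thesis by blast
qed

abbreviation dstate :: "(nat \<Rightarrow> real \<Rightarrow> 'a \<Rightarrow> real) \<Rightarrow> nat \<Rightarrow> real \<Rightarrow> 'a \<Rightarrow> real" where
  "dstate \<alpha> \<equiv> deviation (state \<alpha>)"

lemma state_is_state: "\<alpha> \<in> admissible_profiles \<Longrightarrow> is_state \<alpha> (state \<alpha>)"
  unfolding state_def by (rule someI_ex[OF is_state_exists])

lemma dstate_continuous_adapted:
  assumes "\<alpha> \<in> admissible_profiles" "i \<in> {1..N}"
  shows "continuous_adapted (dstate \<alpha> i)"
proof -
  have "continuous_adapted (state \<alpha> j)" if "j \<in> {1..N}" for j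
    using state_is_state[OF assms(1)] that by (auto simp: is_state_def continuous_adapted_def)
  then show ?thesis
    unfolding deviation_def[abs_def] average_eq using assms(2)
    by (intro continuous_adapted_diff continuous_adapted_cmult continuous_adapted_sum)
qed

text \<open>Averaging the state equations removes mean reversion; subtracting the equation of player
  \<open>i\<close> then leaves one closed scalar equation. Taking off the noise part makes it
  pathwise with zero initial value, at the price of the forcing
  \<open>- a * deviation \<nu> i\<close>.\<close>

lemma dstate_solves:
  assumes \<alpha>: "\<alpha> \<in> admissible_profiles" and \<nu>: "noise_version \<nu>" and i: "i \<in> {1..N}"
  shows "solves a (\<lambda>t \<omega>. deviation \<alpha> i t \<omega> - a * deviation \<nu> i t \<omega>) (\<lambda>t \<omega>. dstate \<alpha> i t \<omega> - deviation \<nu> i t \<omega>)"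
  unfolding solves_def
proof -
  let ?X = "state \<alpha>"
  have st: "AE \<omega> in completion M. \<forall>i\<in>{1..N}. \<forall>t\<in>{0..T}.
      ?X i t \<omega> = x i + (LINT s:{0..t}|lborel. a * deviation ?X i s \<omega> + \<alpha> i s \<omega>)
          + \<sigma> * (\<rho> * W 0 t \<omega> + sqrt (1 - \<rho>\<^sup>2) * W i t \<omega>)"
    using state_is_state[OF \<alpha>] unfolding is_state_def deviation_def by (subst AE_ball_countable) auto
  have int: "AE \<omega> in completion M. \<forall>i\<in>{1..N}. sq_integrable (lborel_upto T) (\<lambda>t. \<alpha> i t \<omega>)"
    using \<alpha> admissible_section by (subst AE_ball_countable) (auto simp: admissible_profiles_def)
  let ?F = "\<lambda>t \<omega>. deviation \<alpha> i t \<omega> - a * deviation \<nu> i t \<omega>"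
  have d: "regular (deviation \<nu> i)" "continuous_adapted (deviation \<nu> i)"
    unfolding deviation_def[abs_def]
    by (intro regular_diff continuous_adapted_diff noise_versionD[OF \<nu>] i)+
  have ca: "continuous_adapted (\<lambda>t \<omega>. dstate \<alpha> i t \<omega> - deviation \<nu> i t \<omega>)"
    by (intro continuous_adapted_diff dstate_continuous_adapted \<alpha> i d)
  have "?F \<in> admissible"
    by (intro admissible_diff admissible_cmult admissible_deviation \<alpha> i regular_admissible d)
  from admissible_section[OF this] st int AE_space noise_version_AE[OF \<nu>]
  show "AE \<omega> in completion M. lin_sol T a (\<lambda>t. ?F t \<omega>) (\<lambda>t. dstate \<alpha> i t \<omega> - deviation \<nu> i t \<omega>)"
  proof eventually_elim
    case (elim \<omega>)
    then have \<omega>: "\<omega> \<in> space M" by simp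
    show ?case
      unfolding lin_sol_def
    proof (intro conjI ballI)
      show "sq_integrable (lborel_upto T) (\<lambda>t. ?F t \<omega>)" by fact
      show "continuous_on {0..T} (\<lambda>t. dstate \<alpha> i t \<omega> - deviation \<nu> i t \<omega>)"
        using ca \<omega> by (auto simp: continuous_adapted_def)
      fix t assume t: "t \<in> {0..T}"
      define G where "G j = (LINT s:{0..t}|lborel. a * deviation ?X j s \<omega> + \<alpha> j s \<omega>)" for j
      have Gi: "set_integrable lborel {0..t} (\<lambda>s. a * deviation ?X j s \<omega> + \<alpha> j s \<omega>)" if j: "j \<in> {1..N}" for j
      proof -
        have "sq_integrable (lborel_upto T) (\<lambda>s. deviation ?X j s \<omega>)"
          using dstate_continuous_adapted[OF \<alpha> j] \<omega> by (auto simp: continuous_adapted_def intro: sq_integrable_continuous)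
        then have "sq_integrable (lborel_upto t) (\<lambda>s. a * deviation ?X j s \<omega> + \<alpha> j s \<omega>)"
          using elim(3) j t by (intro sq_integrable_upto_mono[of t T] sq_integrable_add sq_integrable_cmult) auto
        then show ?thesis
          using finite_measure.sq_integrable_imp_integrable[OF finite_measure_lborel_upto]
          by (simp add: lborel_upto_integral)
      qed
      have X: "?X j t \<omega> = \<nu> j t \<omega> + G j" if "j \<in> {1..N}" for j
        using elim(2,5) that t by (simp add: G_def)
      have "(\<Sum>j = 1..N. ?X j t \<omega>) = (\<Sum>j = 1..N. \<nu> j t \<omega>) + (\<Sum>j = 1..N. G j)"
        using X by (simp add: sum.distrib)
      also have "(\<Sum>j = 1..N. G j) = (LINT s:{0..t}|lborel. (\<Sum>j = 1..N. a * deviation ?X j s \<omega> + \<alpha> j s \<omega>))"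
        unfolding G_def lborel_upto_integral(1)[symmetric]
        by (rule Bochner_Integration.integral_sum[symmetric]) (use Gi in \<open>simp add: lborel_upto_integral\<close>)
      also have "(\<lambda>s. \<Sum>j = 1..N. a * deviation ?X j s \<omega> + \<alpha> j s \<omega>) = (\<lambda>s. real N * average \<alpha> s \<omega>)"
        using N_ge_2 unfolding sum.distrib sum_distrib_left[symmetric] sum_deviation by (simp add: average_def)
      finally have "average ?X t \<omega> = average \<nu> t \<omega> + (LINT s:{0..t}|lborel. average \<alpha> s \<omega>)"
        using N_ge_2 by (simp add: average_def add_divide_distrib)
      then have "dstate \<alpha> i t \<omega> - deviation \<nu> i t \<omega> = (LINT s:{0..t}|lborel. average \<alpha> s \<omega>) - G i"
        using X[OF i] by (simp add: deviation_def)
      also have "\<dots> = (LINT s:{0..t}|lborel. average \<alpha> s \<omega> - (a * deviation ?X i s \<omega> + \<alpha> i s \<omega>))"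
      proof -
        have "sq_integrable (lborel_upto t) (\<lambda>s. average \<alpha> s \<omega>)"
          unfolding average_eq using elim(3) t
          by (intro sq_integrable_upto_mono[of t T] sq_integrable_cmult sq_integrable_sum) auto
        then have "set_integrable lborel {0..t} (\<lambda>s. average \<alpha> s \<omega>)"
          using finite_measure.sq_integrable_imp_integrable[OF finite_measure_lborel_upto]
          by (simp add: lborel_upto_integral)
        then show ?thesis unfolding G_def using Gi[OF i] by (simp add: set_integral_diff)
      qed
      also have "\<dots> = (LINT s:{0..t}|lborel. ?F s \<omega> - a * (dstate \<alpha> i s \<omega> - deviation \<nu> i s \<omega>))"
        by (rule arg_cong[where f="set_lebesgue_integral lborel {0..t}"]) (simp add: deviation_def fun_eq_iff algebra_simps)
      finally show "dstate \<alpha> i t \<omega> - deviation \<nu> i t \<omega> =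
        (LINT s:{0..t}|lborel. ?F s \<omega> - a * (dstate \<alpha> i s \<omega> - deviation \<nu> i s \<omega>))" .
    qed
  qed
qed

lemma dstate_regular:
  assumes \<alpha>: "\<alpha> \<in> admissible_profiles" and i: "i \<in> {1..N}"
  shows "regular (dstate \<alpha> i)"
proof -
  obtain \<nu> where \<nu>: "noise_version \<nu>" using noise_version_exists by blast
  have d: "regular (deviation \<nu> i)" "continuous_adapted (deviation \<nu> i)"
    unfolding deviation_def[abs_def]
    by (intro regular_diff continuous_adapted_diff noise_versionD[OF \<nu>] i)+
  have ca: "continuous_adapted (\<lambda>t \<omega>. dstate \<alpha> i t \<omega> - deviation \<nu> i t \<omega>)"
    by (intro continuous_adapted_diff dstate_continuous_adapted \<alpha> i d)
  have "(\<lambda>t \<omega>. deviation \<alpha> i t \<omega> - a * deviation \<nu> i t \<omega>) \<in> admissible"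
    by (intro admissible_diff admissible_cmult admissible_deviation \<alpha> i regular_admissible d)
  from solves_regular(1)[OF this dstate_solves[OF \<alpha> \<nu> i] a_nonneg continuous_adaptedD[OF ca]]
  have "regular (\<lambda>t \<omega>. dstate \<alpha> i t \<omega> - deviation \<nu> i t \<omega>)" .
  from regular_add[OF this d(1)] show ?thesis by simp
qed

lemma dstate_diff_solves:
  assumes "\<alpha> \<in> admissible_profiles" "\<beta> \<in> admissible_profiles" "i \<in> {1..N}"
  shows "solves a (\<lambda>t \<omega>. deviation \<alpha> i t \<omega> - deviation \<beta> i t \<omega>) (\<lambda>t \<omega>. dstate \<alpha> i t \<omega> - dstate \<beta> i t \<omega>)"
proof -
  obtain \<nu> where \<nu>: "noise_version \<nu>" using noise_version_exists by blast
  from solves_diff[OF dstate_solves[OF assms(1) \<nu> assms(3)] dstate_solves[OF assms(2) \<nu> assms(3)]]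
  show ?thesis by simp
qed

section \<open>The cost as a quadratic form\<close>

definition ip :: "(real \<Rightarrow> 'a \<Rightarrow> real) \<Rightarrow> (real \<Rightarrow> 'a \<Rightarrow> real) \<Rightarrow> real" where
  "ip f g = (\<integral>p. on_Q f p * on_Q g p \<partial>Q)"

text \<open>The form A of the overview. Both weights may vanish, so it is only semidefinite.\<close>

definition energy :: "(real \<Rightarrow> 'a \<Rightarrow> real) \<Rightarrow> (real \<Rightarrow> 'a \<Rightarrow> real) \<Rightarrow> real" where
  "energy y z = (\<epsilon> - q\<^sup>2) * ip y z + c * (\<integral>\<omega>. y T \<omega> * z T \<omega> \<partial>completion M)"

lemma ip_commute: "ip f g = ip g f"
  by (simp add: ip_def mult.commute)

lemma ip_add_left: "f \<in> admissible \<Longrightarrow> g \<in> admissible \<Longrightarrow> h \<in> admissible \<Longrightarrow>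
    ip (\<lambda>t \<omega>. f t \<omega> + g t \<omega>) h = ip f h + ip g h"
  by (simp add: ip_def on_Q_simps distrib_right admissible_iff sq_integrable_mult)

lemma ip_cmult_left: "ip (\<lambda>t \<omega>. u * f t \<omega>) h = u * ip f h"
  by (simp add: ip_def on_Q_simps mult.assoc)

lemma ip_cmult_right: "ip f (\<lambda>t \<omega>. u * h t \<omega>) = u * ip f h"
  using ip_cmult_left[of u h f] by (simp add: ip_commute)

lemma ip_add_right: "f \<in> admissible \<Longrightarrow> g \<in> admissible \<Longrightarrow> h \<in> admissible \<Longrightarrow>
    ip h (\<lambda>t \<omega>. f t \<omega> + g t \<omega>) = ip h f + ip h g"
  using ip_add_left[of f g h] by (simp add: ip_commute)

lemma ip_diff_left: "f \<in> admissible \<Longrightarrow> g \<in> admissible \<Longrightarrow> h \<in> admissible \<Longrightarrow>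
    ip (\<lambda>t \<omega>. f t \<omega> - g t \<omega>) h = ip f h - ip g h"
  by (simp add: ip_def on_Q_simps left_diff_distrib admissible_iff sq_integrable_mult)

lemma ip_sum_left: "(\<And>i. i \<in> I \<Longrightarrow> f i \<in> admissible) \<Longrightarrow> h \<in> admissible \<Longrightarrow>
    ip (\<lambda>t \<omega>. \<Sum>i\<in>I. f i t \<omega>) h = (\<Sum>i\<in>I. ip (f i) h)"
proof (induction I rule: infinite_finite_induct)
  case (insert i I)
  then show ?case by (simp add: ip_add_left admissible_sum)
qed (simp_all add: ip_def on_Q_def)

lemma ip_nonneg: "0 \<le> ip f f"
  by (simp add: ip_def)

lemma regular_sq_integrable: "regular z \<Longrightarrow> sq_integrable (completion M) (z T)"
  by (simp add: regular_def)

lemma energy_commute: "energy y z = energy z y"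
  by (simp add: energy_def ip_commute mult.commute)

lemma energy_add_left: "regular f \<Longrightarrow> regular g \<Longrightarrow> regular h \<Longrightarrow>
    energy (\<lambda>t \<omega>. f t \<omega> + g t \<omega>) h = energy f h + energy g h"
  by (simp add: energy_def ip_add_left regular_admissible distrib_right sq_integrable_mult regular_sq_integrable
      distrib_left)

lemma energy_diff_left: "regular f \<Longrightarrow> regular g \<Longrightarrow> regular h \<Longrightarrow>
    energy (\<lambda>t \<omega>. f t \<omega> - g t \<omega>) h = energy f h - energy g h"
  by (simp add: energy_def ip_diff_left regular_admissible left_diff_distrib sq_integrable_mult regular_sq_integrable
      right_diff_distrib)

lemma energy_cmult_left: "energy (\<lambda>t \<omega>. u * f t \<omega>) h = u * energy f h"
  by (simp add: energy_def ip_cmult_left mult.assoc algebra_simps)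

lemma energy_cmult_right: "energy f (\<lambda>t \<omega>. u * h t \<omega>) = u * energy f h"
  using energy_cmult_left[of u h f] by (simp add: energy_commute)

lemma energy_add_right: "regular f \<Longrightarrow> regular g \<Longrightarrow> regular h \<Longrightarrow>
    energy h (\<lambda>t \<omega>. f t \<omega> + g t \<omega>) = energy h f + energy h g"
  using energy_add_left[of f g h] by (simp add: energy_commute)

lemma energy_nonneg: "0 \<le> energy y y"
  using q_le c_nonneg ip_nonneg[of y] by (simp add: energy_def)

text \<open>The two components of each pair are not tied together here. On a residual with its
  deviation the diagonal value is twice the cost; on two directions the value is the energy form E
  of the overview.\<close>

definition form where "form u z h y = ip u h + energy z y"

lemma form_nonneg: "0 \<le> form u z u z"
  by (simp add: form_def ip_nonneg energy_nonneg)

lemma form_expand: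
  assumes "u \<in> admissible" "h \<in> admissible" "regular z" "regular y"
  shows "form (\<lambda>t \<omega>. u t \<omega> + h t \<omega>) (\<lambda>t \<omega>. z t \<omega> + y t \<omega>) (\<lambda>t \<omega>. u t \<omega> + h t \<omega>) (\<lambda>t \<omega>. z t \<omega> + y t \<omega>) =
    form u z u z + 2 * form u z h y + form h y h y"
  using assms
  by (simp add: form_def ip_add_left ip_add_right energy_add_left energy_add_right admissible_add regular_add
    ip_commute[of h u] energy_commute[of y z])

lemma form_cmult: "form u z (\<lambda>t \<omega>. r * h t \<omega>) (\<lambda>t \<omega>. r * y t \<omega>) = r * form u z h y"
    "form (\<lambda>t \<omega>. r * h t \<omega>) (\<lambda>t \<omega>. r * y t \<omega>) u z = r * form h y u z"
  by (simp_all add: form_def ip_cmult_right energy_cmult_right ip_cmult_left energy_cmult_left distrib_left)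

lemma form_diff_left:
  assumes "u \<in> admissible" "v \<in> admissible" "h \<in> admissible" "regular z" "regular w" "regular y"
  shows "form (\<lambda>t \<omega>. u t \<omega> - v t \<omega>) (\<lambda>t \<omega>. z t \<omega> - w t \<omega>) h y = form u z h y - form v w h y"
  using assms by (simp add: form_def ip_diff_left energy_diff_left)

lemma form_Cauchy_Schwarz:
  assumes "u \<in> admissible" "h \<in> admissible" "regular z" "regular y"
  shows "\<bar>form u z h y\<bar> \<le> sqrt (form u z u z) * sqrt (form h y h y)"
proof -
  have "(form u z h y)\<^sup>2 \<le> form u z u z * form h y h y"
  proof (rule quadratic_nonneg_imp_discriminant)
    fix t
    have "form u z u z + 2 * form u z (\<lambda>s \<omega>. t * h s \<omega>) (\<lambda>s \<omega>. t * y s \<omega>) +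
      form (\<lambda>s \<omega>. t * h s \<omega>) (\<lambda>s \<omega>. t * y s \<omega>) (\<lambda>s \<omega>. t * h s \<omega>) (\<lambda>s \<omega>. t * y s \<omega>) \<ge> 0"
      using assms by (subst form_expand[symmetric]) (auto intro: regular_cmult form_nonneg)
    then show "0 \<le> form u z u z + 2 * t * form u z h y + t\<^sup>2 * form h y h y"
      by (simp add: form_cmult power2_eq_square)
  qed
  then show ?thesis
    using real_sqrt_le_mono by (fastforce simp: real_sqrt_mult)
qed

lemma regular_zero [simp]: "regular (\<lambda>t \<omega>. 0)"
  by (rule regular_const)

definition nrm :: "(real \<Rightarrow> 'a \<Rightarrow> real) \<Rightarrow> real" where
  "nrm f = sqrt (ip f f)"

lemma nrm_nonneg [simp]: "0 \<le> nrm f"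
  by (simp add: nrm_def ip_nonneg)

lemma nrm_square: "(nrm f)\<^sup>2 = ip f f"
  by (simp add: nrm_def ip_nonneg)

lemma ip_Cauchy_Schwarz:
  assumes "f \<in> admissible" "g \<in> admissible"
  shows "\<bar>ip f g\<bar> \<le> nrm f * nrm g"
  using form_Cauchy_Schwarz[OF assms regular_zero regular_zero]
  by (simp add: form_def nrm_def energy_def ip_def on_Q_def)

lemma energy_Cauchy_Schwarz:
  assumes "regular y" "regular z"
  shows "\<bar>energy y z\<bar> \<le> sqrt (energy y y) * sqrt (energy z z)"
  using form_Cauchy_Schwarz[OF admissible_zero admissible_zero assms]
  by (simp add: form_def ip_def on_Q_def)

lemma nrm_cmult: "nrm (\<lambda>t \<omega>. r * f t \<omega>) = \<bar>r\<bar> * nrm f"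
proof -
  have "r * (r * ip f f) = r\<^sup>2 * ip f f" by (simp add: power2_eq_square mult.assoc)
  then show ?thesis by (simp add: nrm_def ip_cmult_left ip_cmult_right real_sqrt_mult)
qed

lemma nrm_triangle:
  assumes "f \<in> admissible" "g \<in> admissible"
  shows "nrm (\<lambda>t \<omega>. f t \<omega> + g t \<omega>) \<le> nrm f + nrm g"
proof (rule power2_le_imp_le)
  have "(nrm (\<lambda>t \<omega>. f t \<omega> + g t \<omega>))\<^sup>2 = (nrm f)\<^sup>2 + 2 * ip f g + (nrm g)\<^sup>2"
    using assms by (simp add: nrm_square ip_add_left ip_add_right admissible_add ip_commute[of g f])
  also have "\<dots> \<le> (nrm f)\<^sup>2 + 2 * (nrm f * nrm g) + (nrm g)\<^sup>2"
    using ip_Cauchy_Schwarz[OF assms] by linarith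
  finally show "(nrm (\<lambda>t \<omega>. f t \<omega> + g t \<omega>))\<^sup>2 \<le> (nrm f + nrm g)\<^sup>2"
    by (simp add: power2_sum)
qed simp

lemma nrm_triangle_diff:
  assumes "f \<in> admissible" "g \<in> admissible"
  shows "nrm (\<lambda>t \<omega>. f t \<omega> - g t \<omega>) \<le> nrm f + nrm g"
  using nrm_triangle[OF assms(1) admissible_cmult[OF assms(2), of "-1"]] nrm_cmult[of "-1" g] by simp

lemma nrm_sum:
  assumes "\<And>i. i \<in> I \<Longrightarrow> f i \<in> admissible"
  shows "nrm (\<lambda>t \<omega>. \<Sum>i\<in>I. f i t \<omega>) \<le> (\<Sum>i\<in>I. nrm (f i))"
  using assms
proof (induction I rule: infinite_finite_induct)
  case (insert i I)
  then show ?case using nrm_triangle[of "f i" "\<lambda>t \<omega>. \<Sum>i\<in>I. f i t \<omega>"] admissible_sum[of I f] by force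
qed (simp_all add: nrm_def ip_def on_Q_def)

lemma sq_norm_nrm: "f \<in> admissible \<Longrightarrow> sq_norm f = ennreal ((nrm f)\<^sup>2)"
  using sq_norm_admissible[of f] unfolding nrm_square ip_def unfolding power2_eq_square by simp

lemma AE_on_Q_eq:
  assumes "y \<in> admissible" "z \<in> admissible" "AE \<omega> in completion M. \<forall>t\<in>{0..T}. y t \<omega> = z t \<omega>"
  shows "AE p in Q. on_Q y p = on_Q z p"
proof (rule PL.AE_pair_measure)
  have [measurable]: "on_Q y \<in> borel_measurable Q" "on_Q z \<in> borel_measurable Q"
    using assms(1,2) by (auto simp: admissible_iff intro: progressive_imp_measurable_Q)
  show "{p \<in> space Q. on_Q y p = on_Q z p} \<in> sets Q" by measurable
  show "AE \<omega> in completion M. AE t in lborel_upto T. on_Q y (\<omega>, t) = on_Q z (\<omega>, t)"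
    using assms(3) by eventually_elim (auto simp: on_Q_def intro!: AE_I2)
qed

lemma ip_cong_AE:
  assumes adm: "f \<in> admissible" "f' \<in> admissible" "g \<in> admissible" "g' \<in> admissible"
    and "AE \<omega> in completion M. \<forall>t\<in>{0..T}. f t \<omega> = f' t \<omega>" "AE \<omega> in completion M. \<forall>t\<in>{0..T}. g t \<omega> = g' t \<omega>"
  shows "ip f g = ip f' g'"
proof -
  have [measurable]: "on_Q f \<in> borel_measurable Q" "on_Q f' \<in> borel_measurable Q"
      "on_Q g \<in> borel_measurable Q" "on_Q g' \<in> borel_measurable Q"
    using adm by (auto simp: admissible_iff intro: progressive_imp_measurable_Q)
  show ?thesis
    unfolding ip_def
  proof (rule integral_cong_AE)
    show "AE p in Q. on_Q f p * on_Q g p = on_Q f' p * on_Q g' p"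
      using AE_on_Q_eq[OF adm(1,2) assms(5)] AE_on_Q_eq[OF adm(3,4) assms(6)] by eventually_elim simp
  qed measurable
qed

lemma energy_cong_AE:
  assumes "regular y" "regular z" "AE \<omega> in completion M. \<forall>t\<in>{0..T}. y t \<omega> = z t \<omega>"
  shows "energy y y = energy z z"
proof -
  have "(\<integral>\<omega>. y T \<omega> * y T \<omega> \<partial>completion M) = (\<integral>\<omega>. z T \<omega> * z T \<omega> \<partial>completion M)"
  proof (rule integral_cong_AE)
    show "AE \<omega> in completion M. y T \<omega> * y T \<omega> = z T \<omega> * z T \<omega>"
      using assms(3) by eventually_elim (use T_pos in auto)
  qed (use assms in \<open>auto simp: regular_def sq_integrable_def\<close>)
  then show ?thesis
    using ip_cong_AE[of y z y z] assms by (simp add: energy_def regular_admissible)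
qed

section \<open>Residuals, directions and the first variation of the cost\<close>

text \<open>A change of the own control enters the own state with weight 1 and the average with
  weight 1/N, hence moves the drift of the deviation by \<open>- kappa\<close> times that
  change.\<close>

definition kappa :: real where "kappa = 1 - 1 / real N"

definition rate :: real where "rate = a + kappa * q"

lemma kappa_pos: "0 < kappa" and kappa_le: "kappa \<le> 1"
  using N_ge_2 by (auto simp: kappa_def)

lemma rate_nonneg: "0 \<le> rate"
  using a_nonneg q_nonneg kappa_pos by (simp add: rate_def)

definition residual :: "(nat \<Rightarrow> real \<Rightarrow> 'a \<Rightarrow> real) \<Rightarrow> nat \<Rightarrow> real \<Rightarrow> 'a \<Rightarrow> real" where
  "residual \<alpha> i t \<omega> = \<alpha> i t \<omega> - q * dstate \<alpha> i t \<omega>"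

lemma profile_admissible: "\<alpha> \<in> admissible_profiles \<Longrightarrow> i \<in> {1..N} \<Longrightarrow> \<alpha> i \<in> admissible"
  by (simp add: admissible_profiles_def)

lemma profile_update: "\<alpha> \<in> admissible_profiles \<Longrightarrow> \<beta> \<in> admissible \<Longrightarrow> \<alpha>(i := \<beta>) \<in> admissible_profiles"
  by (auto simp: admissible_profiles_def)

lemma residual_admissible:
  assumes "\<alpha> \<in> admissible_profiles" "i \<in> {1..N}"
  shows "residual \<alpha> i \<in> admissible"
  unfolding residual_def[abs_def]
  by (intro admissible_diff admissible_cmult profile_admissible assms regular_admissible dstate_regular)

text \<open>Completing the square in the own control absorbs the cross term into the residual and
  leaves the weight \<open>\<epsilon> - q^2\<close> on the squared deviation.\<close>

lemma cost_eq:
  assumes \<alpha>: "\<alpha> \<in> admissible_profiles" and i: "i \<in> {1..N}"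
  shows "cost i \<alpha> = 1 / 2 * form (residual \<alpha> i) (dstate \<alpha> i) (residual \<alpha> i) (dstate \<alpha> i)"
proof -
  let ?Z = "dstate \<alpha> i"
  let ?u = "residual \<alpha> i"
  note Z = dstate_regular[OF \<alpha> i]
  have u: "?u \<in> admissible" by (rule residual_admissible[OF \<alpha> i])
  define h where "h p = 1 / 2 * (on_Q ?u p * on_Q ?u p) + (\<epsilon> - q\<^sup>2) / 2 * (on_Q ?Z p * on_Q ?Z p)" for p
  have ui: "integrable Q (\<lambda>p. on_Q ?u p * on_Q ?u p)" and Zi: "integrable Q (\<lambda>p. on_Q ?Z p * on_Q ?Z p)"
    using u Z by (auto simp: admissible_iff regular_def intro!: sq_integrable_mult)
  then have hi: "integrable Q h" unfolding h_def by (intro Bochner_Integration.integrable_add integrable_mult_right)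
  have h_int: "integral\<^sup>L Q h = 1 / 2 * ip ?u ?u + (\<epsilon> - q\<^sup>2) / 2 * ip ?Z ?Z"
    using ui Zi unfolding h_def ip_def by simp
  have ZTi: "integrable (completion M) (\<lambda>\<omega>. ?Z T \<omega> * ?Z T \<omega>)"
    using Z by (auto simp: regular_def intro!: sq_integrable_mult)
  have "cost i \<alpha> = (\<integral>\<omega>. (LINT t|lborel_upto T. h (\<omega>, t)) + c / 2 * (?Z T \<omega> * ?Z T \<omega>) \<partial>completion M)"
    unfolding cost_def Let_def deviation_def[symmetric] lborel_upto_integral(1)[symmetric]
    by (intro Bochner_Integration.integral_cong refl arg_cong2[where f="(+)"])
      (auto simp: h_def on_Q_def residual_def power2_eq_square field_simps)
  also have "\<dots> = (\<integral>\<omega>. (LINT t|lborel_upto T. h (\<omega>, t)) \<partial>completion M) + c / 2 * (\<integral>\<omega>. ?Z T \<omega> * ?Z T \<omega> \<partial>completion M)"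
    using PL.integrable_fst'[OF hi] ZTi by simp
  also have "(\<integral>\<omega>. (LINT t|lborel_upto T. h (\<omega>, t)) \<partial>completion M) = integral\<^sup>L Q h"
    by (rule PL.integral_fst'[OF hi])
  finally show ?thesis by (simp add: h_int form_def energy_def field_simps)
qed

text \<open>Increments are parametrised by the change \<open>h\<close> of the residual \<open>\<alpha>\<^sup>i - q Z\<^sup>i\<close> instead of the change
  \<open>h + q y\<close> of the control: this makes the second order part of the cost coercive and moves the
  decay rate of \<open>Z\<^sup>i\<close> from \<open>a\<close> to \<open>a + kappa q\<close>.\<close>

definition direction :: "(real \<Rightarrow> 'a \<Rightarrow> real) \<Rightarrow> (real \<Rightarrow> 'a \<Rightarrow> real) \<Rightarrow> bool" where
  "direction h y \<longleftrightarrow> h \<in> admissible \<and> regular y \<and> solves rate (\<lambda>t \<omega>. - kappa * h t \<omega>) y"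

lemma directionD:
  assumes "direction h y"
  shows "h \<in> admissible" "regular y" "solves rate (\<lambda>t \<omega>. - kappa * h t \<omega>) y" "y \<in> admissible"
  using assms by (auto simp: direction_def regular_def)

lemma direction_cmult: "direction h y \<Longrightarrow> direction (\<lambda>t \<omega>. r * h t \<omega>) (\<lambda>t \<omega>. r * y t \<omega>)"
  unfolding direction_def
  using solves_cmult[of rate "\<lambda>t \<omega>. - kappa * h t \<omega>" y r]
  by (auto intro: regular_cmult simp: mult.left_commute)

lemma direction_exists:
  assumes "h \<in> admissible"
  obtains y where "direction h y"
  using solves_exists[OF admissible_cmult[OF assms, of "- kappa"] rate_nonneg] assms
  unfolding direction_def by blast

text \<open>Returns from the residual increment \<open>h\<close> to the control increment
  \<open>h + q * y\<close>, shifting the decay rate back to \<open>a\<close>.\<close>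

lemma direction_solves:
  assumes "direction h y"
  shows "solves a (\<lambda>t \<omega>. - kappa * (h t \<omega> + q * y t \<omega>)) y"
  using solves_add_rate[OF directionD(3)[OF assms], of "- kappa * q"]
  by (simp add: rate_def algebra_simps)

lemma regular_progressive: "regular z \<Longrightarrow> progressively_measurable z" "regular z \<Longrightarrow> z T \<in> borel_measurable (completion M)"
  by (auto simp: regular_def admissible_iff sq_integrable_def)

lemma solves_scaled_bounds:
  assumes "f \<in> admissible" "regular y" "solves b (\<lambda>t \<omega>. - kappa * f t \<omega>) y" "0 \<le> b"
  shows "(1 + T\<^sup>2 * b\<^sup>2) * ip y y \<le> (T * kappa)\<^sup>2 * ip f f" "ip y y \<le> (T * kappa)\<^sup>2 * ip f f"
    "(\<integral>\<omega>. (y T \<omega>)\<^sup>2 \<partial>completion M) \<le> T * kappa\<^sup>2 * ip f f"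
proof -
  note b = solves_regular(2,3)[OF admissible_cmult[OF assms(1), of "- kappa"] assms(3,4) regular_progressive[OF assms(2)]]
  have e: "(\<integral>p. (on_Q (\<lambda>t \<omega>. - kappa * f t \<omega>) p)\<^sup>2 \<partial>Q) = kappa\<^sup>2 * ip f f"
    unfolding on_Q_simps by (simp add: ip_def power2_eq_square algebra_simps)
  show 1: "(1 + T\<^sup>2 * b\<^sup>2) * ip y y \<le> (T * kappa)\<^sup>2 * ip f f"
    using b(1) unfolding e by (simp add: ip_def power2_eq_square algebra_simps)
  have "0 \<le> T\<^sup>2 * b\<^sup>2 * ip y y" using ip_nonneg by simp
  with 1 show "ip y y \<le> (T * kappa)\<^sup>2 * ip f f" by (simp add: distrib_right)
  show "(\<integral>\<omega>. (y T \<omega>)\<^sup>2 \<partial>completion M) \<le> T * kappa\<^sup>2 * ip f f"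
    using b(2) unfolding e by (simp add: mult.assoc)
qed

text \<open>The bound of the overview called Lambda: the squared solution operator costs
  \<open>T^2\<close> for the running part and \<open>T\<close> for the terminal value, and the input
  carries the factor \<open>kappa\<close>.\<close>

definition energy_const :: real where "energy_const = (\<epsilon> - q\<^sup>2) * (T * kappa)\<^sup>2 + c * (T * kappa\<^sup>2)"

lemma energy_const_nonneg: "0 \<le> energy_const"
  using q_le c_nonneg T_pos by (simp add: energy_const_def)

lemma energy_scaled_bound:
  assumes "f \<in> admissible" "regular y" "solves b (\<lambda>t \<omega>. - kappa * f t \<omega>) y" "0 \<le> b"
  shows "energy y y \<le> energy_const * ip f f"
proof -
  have "(\<epsilon> - q\<^sup>2) * ip y y \<le> (\<epsilon> - q\<^sup>2) * ((T * kappa)\<^sup>2 * ip f f)"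
    using solves_scaled_bounds(2)[OF assms] q_le by (intro mult_left_mono) auto
  moreover have "c * (\<integral>\<omega>. (y T \<omega>)\<^sup>2 \<partial>completion M) \<le> c * (T * kappa\<^sup>2 * ip f f)"
    using solves_scaled_bounds(3)[OF assms] c_nonneg by (intro mult_left_mono) auto
  ultimately show ?thesis by (simp add: energy_def energy_const_def power2_eq_square[of "y T _"] algebra_simps)
qed

lemma deviation_update:
  assumes "i \<in> {1..N}"
  shows "deviation (\<alpha>(i := \<beta>)) i t \<omega> = (\<Sum>j\<in>{1..N} - {i}. \<alpha> j t \<omega>) / real N - kappa * \<beta> t \<omega>"
proof -
  have "(\<Sum>j = 1..N. (\<alpha>(i := \<beta>)) j t \<omega>) = \<beta> t \<omega> + (\<Sum>j\<in>{1..N} - {i}. \<alpha> j t \<omega>)"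
    using assms by (subst sum.remove[of _ i]) auto
  then show ?thesis
    by (simp add: deviation_def average_def kappa_def add_divide_distrib algebra_simps)
qed

text \<open>Every admissible deviation of player \<open>i\<close> arises from a direction, so
  testing all directions amounts to testing all controls.\<close>

lemma direction_between:
  assumes \<alpha>: "\<alpha> \<in> admissible_profiles" and i: "i \<in> {1..N}" and \<beta>: "\<beta> \<in> admissible"
  defines "y \<equiv> \<lambda>t \<omega>. dstate (\<alpha>(i := \<beta>)) i t \<omega> - dstate \<alpha> i t \<omega>"
  shows "direction (\<lambda>t \<omega>. \<beta> t \<omega> - \<alpha> i t \<omega> - q * y t \<omega>) y"
    and "solves a (\<lambda>t \<omega>. - kappa * (\<beta> t \<omega> - \<alpha> i t \<omega>)) y"
proof -
  have ry: "regular y"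
    unfolding y_def by (intro regular_diff dstate_regular profile_update \<alpha> \<beta> i)
  have e: "deviation (\<alpha>(i := \<beta>)) i t \<omega> - deviation \<alpha> i t \<omega> = - kappa * (\<beta> t \<omega> - \<alpha> i t \<omega>)" for t \<omega>
    using deviation_update[OF i, of \<alpha> \<beta> t \<omega>] deviation_update[OF i, of \<alpha> "\<alpha> i" t \<omega>]
    by (simp add: algebra_simps)
  show s: "solves a (\<lambda>t \<omega>. - kappa * (\<beta> t \<omega> - \<alpha> i t \<omega>)) y"
    using dstate_diff_solves[OF profile_update[OF \<alpha> \<beta>, of i] \<alpha> i] unfolding e y_def .
  show "direction (\<lambda>t \<omega>. \<beta> t \<omega> - \<alpha> i t \<omega> - q * y t \<omega>) y"
    unfolding direction_def
    using solves_add_rate[OF s, of "kappa * q"] ry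
      admissible_diff[OF admissible_diff[OF \<beta> profile_admissible[OF \<alpha> i]] admissible_cmult[OF regular_admissible[OF ry]]]
    by (simp add: rate_def algebra_simps)
qed

text \<open>An exact second order expansion. The state of the changed profile agrees with the old
  deviation plus \<open>y\<close> only up to indistinguishability, by uniqueness of the linear
  equation, so the forms are compared modulo null sets.\<close>

lemma cost_expand:
  assumes \<alpha>: "\<alpha> \<in> admissible_profiles" and i: "i \<in> {1..N}" and d: "direction h y"
  shows "cost i (\<alpha>(i := \<lambda>t \<omega>. \<alpha> i t \<omega> + (h t \<omega> + q * y t \<omega>))) =
    cost i \<alpha> + form (residual \<alpha> i) (dstate \<alpha> i) h y + 1 / 2 * form h y h y"
proof -
  define \<beta> where "\<beta> = (\<lambda>t \<omega>. \<alpha> i t \<omega> + (h t \<omega> + q * y t \<omega>))"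
  note hy = directionD[OF d]
  have \<beta>: "\<beta> \<in> admissible"
    unfolding \<beta>_def by (intro admissible_add admissible_cmult hy profile_admissible[OF \<alpha> i])
  define \<alpha>' where "\<alpha>' = \<alpha>(i := \<beta>)"
  have \<alpha>': "\<alpha>' \<in> admissible_profiles" unfolding \<alpha>'_def by (rule profile_update[OF \<alpha> \<beta>])
  have "solves a (\<lambda>t \<omega>. - kappa * (h t \<omega> + q * y t \<omega>)) (\<lambda>t \<omega>. dstate \<alpha>' i t \<omega> - dstate \<alpha> i t \<omega>)"
    using direction_between(2)[OF \<alpha> i \<beta>] by (simp add: \<alpha>'_def \<beta>_def)
  from solves_unique[OF this direction_solves[OF d] a_nonneg]
  have Z: "AE \<omega> in completion M. \<forall>t\<in>{0..T}. dstate \<alpha>' i t \<omega> = dstate \<alpha> i t \<omega> + y t \<omega>"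
    by eventually_elim (auto simp: algebra_simps)
  have u: "AE \<omega> in completion M. \<forall>t\<in>{0..T}. residual \<alpha>' i t \<omega> = residual \<alpha> i t \<omega> + h t \<omega>"
    using Z by eventually_elim (auto simp: residual_def \<alpha>'_def \<beta>_def algebra_simps)
  note r = residual_admissible[OF \<alpha> i] dstate_regular[OF \<alpha> i] residual_admissible[OF \<alpha>' i] dstate_regular[OF \<alpha>' i]
  have "form (residual \<alpha>' i) (dstate \<alpha>' i) (residual \<alpha>' i) (dstate \<alpha>' i) =
    form (\<lambda>t \<omega>. residual \<alpha> i t \<omega> + h t \<omega>) (\<lambda>t \<omega>. dstate \<alpha> i t \<omega> + y t \<omega>)
      (\<lambda>t \<omega>. residual \<alpha> i t \<omega> + h t \<omega>) (\<lambda>t \<omega>. dstate \<alpha> i t \<omega> + y t \<omega>)"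
    unfolding form_def
    using ip_cong_AE[OF r(3) admissible_add[OF r(1) hy(1)] r(3) admissible_add[OF r(1) hy(1)] u u]
      energy_cong_AE[OF r(4) regular_add[OF r(2) hy(2)] Z] by simp
  also have "\<dots> = form (residual \<alpha> i) (dstate \<alpha> i) (residual \<alpha> i) (dstate \<alpha> i) +
     2 * form (residual \<alpha> i) (dstate \<alpha> i) h y + form h y h y"
    by (rule form_expand[OF r(1) hy(1) r(2) hy(2)])
  finally show ?thesis
    using cost_eq[OF \<alpha> i] cost_eq[OF \<alpha>' i] by (simp add: \<alpha>'_def \<beta>_def algebra_simps)
qed

text \<open>The expansion is exact with nonnegative second order term, so vanishing of the linear
  term is sufficient for minimality; scaling the direction shows that it is necessary.\<close>

lemma best_response_iff:
  assumes \<alpha>: "\<alpha> \<in> admissible_profiles" and i: "i \<in> {1..N}"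
  shows "(\<forall>\<beta>\<in>admissible. cost i \<alpha> \<le> cost i (\<alpha>(i := \<beta>))) \<longleftrightarrow>
    (\<forall>h y. direction h y \<longrightarrow> form (residual \<alpha> i) (dstate \<alpha> i) h y = 0)" (is "?min \<longleftrightarrow> ?foc")
proof
  assume ?min
  show ?foc
  proof (intro allI impI)
    fix h y assume d: "direction h y"
    let ?l = "form (residual \<alpha> i) (dstate \<alpha> i) h y"
    \<comment> \<open>Written with constant term 0 so that the discriminant bound becomes
      \<open>?l^2 \<le> 0\<close>.\<close>
    have "0 \<le> 0 + 2 * t * ?l + t\<^sup>2 * form h y h y" for t
    proof -
      note dt = direction_cmult[OF d, of t]
      have "(\<lambda>s \<omega>. \<alpha> i s \<omega> + (t * h s \<omega> + q * (t * y s \<omega>))) \<in> admissible"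
        by (intro admissible_add admissible_cmult directionD(1,4)[OF d] profile_admissible[OF \<alpha> i])
      with \<open>?min\<close> cost_expand[OF \<alpha> i dt] have "0 \<le> t * ?l + 1 / 2 * (t * (t * form h y h y))"
        by (simp add: form_cmult) (smt (verit))
      then show ?thesis by (simp add: power2_eq_square algebra_simps)
    qed
    from quadratic_nonneg_imp_discriminant[OF this] show "?l = 0" by simp
  qed
next
  assume foc: ?foc
  show ?min
  proof
    fix \<beta> assume \<beta>: "\<beta> \<in> admissible"
    define y where "y = (\<lambda>t \<omega>. dstate (\<alpha>(i := \<beta>)) i t \<omega> - dstate \<alpha> i t \<omega>)"
    define h where "h = (\<lambda>t \<omega>. \<beta> t \<omega> - \<alpha> i t \<omega> - q * y t \<omega>)"
    have d: "direction h y" unfolding h_def y_def by (rule direction_between[OF \<alpha> i \<beta>])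
    have "\<beta> = (\<lambda>t \<omega>. \<alpha> i t \<omega> + (h t \<omega> + q * y t \<omega>))" by (simp add: h_def)
    then have "cost i (\<alpha>(i := \<beta>)) = cost i \<alpha> + 1 / 2 * form h y h y"
      using cost_expand[OF \<alpha> i d] foc d by simp
    then show "cost i \<alpha> \<le> cost i (\<alpha>(i := \<beta>))" using form_nonneg[of h y] by simp
  qed
qed

section \<open>Existence of best responses\<close>

lemma admissible_complete_nrm:
  assumes f: "\<And>n. f n \<in> admissible"
    and Cauchy: "\<And>e. 0 < e \<Longrightarrow> \<exists>K. \<forall>m\<ge>K. \<forall>n\<ge>K. nrm (\<lambda>t \<omega>. f m t \<omega> - f n t \<omega>) < e"
  obtains g where "g \<in> admissible" "(\<lambda>n. nrm (\<lambda>t \<omega>. f n t \<omega> - g t \<omega>)) \<longlonglongrightarrow> 0"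
proof -
  have eq: "(\<integral>p. (on_Q f p - on_Q g p)\<^sup>2 \<partial>Q) = (nrm (\<lambda>t \<omega>. f t \<omega> - g t \<omega>))\<^sup>2" for f g
    unfolding nrm_square ip_def on_Q_simps by (simp add: power2_eq_square)
  have "\<exists>K. \<forall>m\<ge>K. \<forall>n\<ge>K. (\<integral>p. (on_Q (f m) p - on_Q (f n) p)\<^sup>2 \<partial>Q) < e" if e: "0 < e" for e
  proof -
    obtain K where K: "\<forall>m\<ge>K. \<forall>n\<ge>K. nrm (\<lambda>t \<omega>. f m t \<omega> - f n t \<omega>) < sqrt e"
      using Cauchy[of "sqrt e"] e by auto
    have "(nrm (\<lambda>t \<omega>. f m t \<omega> - f n t \<omega>))\<^sup>2 < e" if mn: "m \<ge> K" "n \<ge> K" for m n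
      using power_strict_mono[of "nrm (\<lambda>t \<omega>. f m t \<omega> - f n t \<omega>)" "sqrt e" 2] K mn e by simp
    then show ?thesis unfolding eq by blast
  qed
  from admissible_complete[OF f this] obtain g where g: "g \<in> admissible"
    "(\<lambda>n. (nrm (\<lambda>t \<omega>. f n t \<omega> - g t \<omega>))\<^sup>2) \<longlonglongrightarrow> 0" unfolding eq by blast
  from tendsto_real_sqrt[OF g(2)] have "(\<lambda>n. nrm (\<lambda>t \<omega>. f n t \<omega> - g t \<omega>)) \<longlonglongrightarrow> 0" by simp
  with g(1) show thesis by (rule that)
qed

lemma nrm_scaled_bound:
  assumes "f \<in> admissible" "regular y" "solves b (\<lambda>t \<omega>. - kappa * f t \<omega>) y" "0 \<le> b"
  shows "nrm y \<le> T * kappa * nrm f"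
  using real_sqrt_le_mono[OF solves_scaled_bounds(2)[OF assms]] T_pos kappa_pos
  by (simp add: nrm_def real_sqrt_mult)

lemma form_direction_le:
  assumes "direction h y"
  shows "form h y h y \<le> (1 + energy_const) * (nrm h)\<^sup>2"
  using energy_scaled_bound[OF directionD(1-3)[OF assms] rate_nonneg]
  by (simp add: form_def nrm_square distrib_right)

text \<open>Bounds the passage between control increments and residual increments both ways: they
  differ by \<open>q * y\<close>, and \<open>T * kappa\<close> bounds \<open>y\<close> in terms of
  either one, at rate \<open>a\<close> or at \<open>rate\<close>.\<close>

definition control_const :: real where "control_const = 1 + q * (T * kappa)"

lemma control_const_ge_1: "1 \<le> control_const"
  using q_nonneg T_pos kappa_pos by (simp add: control_const_def)

lemma cost_between:
  assumes \<alpha>: "\<alpha> \<in> admissible_profiles" and i: "i \<in> {1..N}" and \<beta>: "\<beta> \<in> admissible" and \<gamma>: "\<gamma> \<in> admissible"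
  obtains h y where "direction h y" "\<beta> = (\<lambda>t \<omega>. \<gamma> t \<omega> + (h t \<omega> + q * y t \<omega>))"
    "nrm h \<le> control_const * nrm (\<lambda>t \<omega>. \<beta> t \<omega> - \<gamma> t \<omega>)" "nrm (\<lambda>t \<omega>. \<beta> t \<omega> - \<gamma> t \<omega>) \<le> control_const * nrm h"
proof -
  let ?p = "\<alpha>(i := \<gamma>)"
  define y where "y = (\<lambda>t \<omega>. dstate (?p(i := \<beta>)) i t \<omega> - dstate ?p i t \<omega>)"
  define h where "h = (\<lambda>t \<omega>. \<beta> t \<omega> - \<gamma> t \<omega> - q * y t \<omega>)"
  note b = direction_between[OF profile_update[OF \<alpha> \<gamma>, of i] i \<beta>]
  have d: "direction h y" using b(1) by (simp add: h_def y_def)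
  have s: "solves a (\<lambda>t \<omega>. - kappa * (\<beta> t \<omega> - \<gamma> t \<omega>)) y" using b(2) by (simp add: y_def)
  note D = directionD[OF d]
  have k: "(\<lambda>t \<omega>. \<beta> t \<omega> - \<gamma> t \<omega>) \<in> admissible" by (intro admissible_diff \<beta> \<gamma>)
  have "nrm h \<le> nrm (\<lambda>t \<omega>. \<beta> t \<omega> - \<gamma> t \<omega>) + nrm (\<lambda>t \<omega>. q * y t \<omega>)"
    unfolding h_def by (intro nrm_triangle_diff k admissible_cmult D)
  also have "\<dots> \<le> nrm (\<lambda>t \<omega>. \<beta> t \<omega> - \<gamma> t \<omega>) + q * (T * kappa * nrm (\<lambda>t \<omega>. \<beta> t \<omega> - \<gamma> t \<omega>))"
    unfolding nrm_cmult using q_nonneg nrm_scaled_bound[OF k D(2) s a_nonneg]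
    by (intro add_left_mono mult_mono) auto
  finally have 1: "nrm h \<le> control_const * nrm (\<lambda>t \<omega>. \<beta> t \<omega> - \<gamma> t \<omega>)" by (simp add: control_const_def algebra_simps)
  have e: "(\<lambda>t \<omega>. \<beta> t \<omega> - \<gamma> t \<omega>) = (\<lambda>t \<omega>. h t \<omega> + q * y t \<omega>)" by (simp add: h_def)
  have "nrm (\<lambda>t \<omega>. h t \<omega> + q * y t \<omega>) \<le> nrm h + nrm (\<lambda>t \<omega>. q * y t \<omega>)"
    by (intro nrm_triangle admissible_cmult D)
  also have "\<dots> \<le> nrm h + q * (T * kappa * nrm h)"
    unfolding nrm_cmult using q_nonneg nrm_scaled_bound[OF D(1-3) rate_nonneg]
    by (intro add_left_mono mult_mono) auto
  finally have 2: "nrm (\<lambda>t \<omega>. \<beta> t \<omega> - \<gamma> t \<omega>) \<le> control_const * nrm h" unfolding e by (simp add: control_const_def algebra_simps)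
  have "\<beta> = (\<lambda>t \<omega>. \<gamma> t \<omega> + (h t \<omega> + q * y t \<omega>))" by (simp add: h_def)
  from that[OF d this 1 2] show thesis .
qed

text \<open>Parallelogram argument from strong convexity: two nearly optimal controls are close, so
  minimizing sequences are Cauchy.\<close>

lemma cost_midpoint:
  assumes \<alpha>: "\<alpha> \<in> admissible_profiles" and i: "i \<in> {1..N}" and \<beta>: "\<beta> \<in> admissible" and \<beta>': "\<beta>' \<in> admissible"
    and I: "\<And>\<gamma>. \<gamma> \<in> admissible \<Longrightarrow> I \<le> cost i (\<alpha>(i := \<gamma>))"
  shows "(nrm (\<lambda>t \<omega>. \<beta> t \<omega> - \<beta>' t \<omega>))\<^sup>2 \<le> 4 * control_const\<^sup>2 * (cost i (\<alpha>(i := \<beta>)) + cost i (\<alpha>(i := \<beta>')) - 2 * I)"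
proof -
  define \<gamma> where "\<gamma> = (\<lambda>t \<omega>. 1 / 2 * \<beta> t \<omega> + 1 / 2 * \<beta>' t \<omega>)"
  have \<gamma>: "\<gamma> \<in> admissible" unfolding \<gamma>_def by (intro admissible_add admissible_cmult \<beta> \<beta>')
  note p = profile_update[OF \<alpha> \<gamma>, of i]
  from cost_between[OF \<alpha> i \<beta> \<gamma>] obtain h y where d: "direction h y" and \<beta>e: "\<beta> = (\<lambda>t \<omega>. \<gamma> t \<omega> + (h t \<omega> + q * y t \<omega>))"
    and le: "nrm (\<lambda>t \<omega>. \<beta> t \<omega> - \<gamma> t \<omega>) \<le> control_const * nrm h" by blast
  have "\<beta>' t \<omega> = 2 * \<gamma> t \<omega> - \<beta> t \<omega>" for t \<omega> by (simp add: \<gamma>_def)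
  \<comment> \<open>\<open>\<beta>'\<close> mirrors \<open>\<beta>\<close> in the midpoint, so it is
    reached by the opposite direction, and the linear terms cancel when the two expansions are
    added.\<close>
  then have \<beta>'e: "\<beta>' = (\<lambda>t \<omega>. \<gamma> t \<omega> + ((-1) * h t \<omega> + q * ((-1) * y t \<omega>)))"
    by (simp add: \<beta>e fun_eq_iff algebra_simps)
  have "cost i (\<alpha>(i := \<beta>)) + cost i (\<alpha>(i := \<beta>')) = 2 * cost i (\<alpha>(i := \<gamma>)) + form h y h y"
    using cost_expand[OF p i d] cost_expand[OF p i direction_cmult[OF d, of "-1"]]
    unfolding form_cmult \<beta>'e by (simp add: \<beta>e)
  moreover have "(nrm h)\<^sup>2 \<le> form h y h y"
    using energy_nonneg by (simp add: form_def nrm_square)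
  ultimately have h: "(nrm h)\<^sup>2 \<le> cost i (\<alpha>(i := \<beta>)) + cost i (\<alpha>(i := \<beta>')) - 2 * I"
    using I[OF \<gamma>] by linarith
  have "(\<lambda>t \<omega>. \<beta> t \<omega> - \<beta>' t \<omega>) = (\<lambda>t \<omega>. 2 * (\<beta> t \<omega> - \<gamma> t \<omega>))" by (simp add: \<gamma>_def)
  then have "nrm (\<lambda>t \<omega>. \<beta> t \<omega> - \<beta>' t \<omega>) = 2 * nrm (\<lambda>t \<omega>. \<beta> t \<omega> - \<gamma> t \<omega>)"
    by (simp only: nrm_cmult abs_numeral)
  then have "(nrm (\<lambda>t \<omega>. \<beta> t \<omega> - \<beta>' t \<omega>))\<^sup>2 \<le> (2 * (control_const * nrm h))\<^sup>2"
    using le by (intro power_mono) auto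
  also have "\<dots> = 4 * control_const\<^sup>2 * (nrm h)\<^sup>2" by (simp add: power_mult_distrib)
  also have "\<dots> \<le> 4 * control_const\<^sup>2 * (cost i (\<alpha>(i := \<beta>)) + cost i (\<alpha>(i := \<beta>')) - 2 * I)"
    using h by (intro mult_left_mono) auto
  finally show ?thesis .
qed

text \<open>Supplies the lower semicontinuity needed for passing to the limit: in the expansion
  around \<open>\<gamma>\<close> the linear term is bounded by Cauchy-Schwarz and the quadratic one
  is dropped by sign.\<close>

lemma cost_lower_bound:
  assumes \<alpha>: "\<alpha> \<in> admissible_profiles" and i: "i \<in> {1..N}" and \<gamma>: "\<gamma> \<in> admissible"
  obtains S where "0 \<le> S" "\<And>\<beta>. \<beta> \<in> admissible \<Longrightarrow>
    cost i (\<alpha>(i := \<gamma>)) \<le> cost i (\<alpha>(i := \<beta>)) + S * nrm (\<lambda>t \<omega>. \<beta> t \<omega> - \<gamma> t \<omega>)"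
proof -
  let ?p = "\<alpha>(i := \<gamma>)"
  let ?u = "residual ?p i" and ?Z = "dstate ?p i"
  note p = profile_update[OF \<alpha> \<gamma>, of i]
  define S where "S = sqrt (form ?u ?Z ?u ?Z) * (sqrt (1 + energy_const) * control_const)"
  have S: "0 \<le> S" using form_nonneg energy_const_nonneg control_const_ge_1 by (simp add: S_def)
  have "cost i ?p \<le> cost i (\<alpha>(i := \<beta>)) + S * nrm (\<lambda>t \<omega>. \<beta> t \<omega> - \<gamma> t \<omega>)" if \<beta>: "\<beta> \<in> admissible" for \<beta>
  proof -
    from cost_between[OF \<alpha> i \<beta> \<gamma>] obtain h y where d: "direction h y" and \<beta>e: "\<beta> = (\<lambda>t \<omega>. \<gamma> t \<omega> + (h t \<omega> + q * y t \<omega>))"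
      and le: "nrm h \<le> control_const * nrm (\<lambda>t \<omega>. \<beta> t \<omega> - \<gamma> t \<omega>)" by blast
    have "cost i (\<alpha>(i := \<beta>)) = cost i ?p + form ?u ?Z h y + 1 / 2 * form h y h y"
      using cost_expand[OF p i d] by (simp add: \<beta>e)
    moreover have "\<bar>form ?u ?Z h y\<bar> \<le> sqrt (form ?u ?Z ?u ?Z) * sqrt (form h y h y)"
      by (intro form_Cauchy_Schwarz residual_admissible dstate_regular p i directionD[OF d])
    moreover have "sqrt (form h y h y) \<le> sqrt (1 + energy_const) * nrm h"
      using real_sqrt_le_mono[OF form_direction_le[OF d]] by (simp add: real_sqrt_mult)
    then have "sqrt (form ?u ?Z ?u ?Z) * sqrt (form h y h y) \<le>
        sqrt (form ?u ?Z ?u ?Z) * (sqrt (1 + energy_const) * (control_const * nrm (\<lambda>t \<omega>. \<beta> t \<omega> - \<gamma> t \<omega>)))"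
      using le energy_const_nonneg form_nonneg by (intro mult_left_mono order_trans[OF _ mult_left_mono[OF le]]) auto
    ultimately show ?thesis using form_nonneg[of h y] by (simp add: S_def mult.assoc)
  qed
  with S show thesis by (rule that)
qed

lemma best_response_exists:
  assumes \<alpha>: "\<alpha> \<in> admissible_profiles" and i: "i \<in> {1..N}"
  shows "\<exists>\<beta>\<in>admissible. \<forall>\<gamma>\<in>admissible. cost i (\<alpha>(i := \<beta>)) \<le> cost i (\<alpha>(i := \<gamma>))"
proof -
  define J where "J \<beta> = cost i (\<alpha>(i := \<beta>))" for \<beta>
  define I where "I = (INF \<beta>\<in>admissible. J \<beta>)"
  have nonneg: "0 \<le> J \<beta>" if "\<beta> \<in> admissible" for \<beta>
    unfolding J_def cost_eq[OF profile_update[OF \<alpha> that, of i] i] by (simp add: form_nonneg)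
  then have bdd: "bdd_below (J ` admissible)" by (intro bdd_belowI[of _ 0]) auto
  then have I: "I \<le> J \<gamma>" if "\<gamma> \<in> admissible" for \<gamma> unfolding I_def using that by (rule cINF_lower)
  have "\<exists>\<beta>\<in>admissible. J \<beta> < I + 1 / real (Suc n)" for n
  proof -
    have "I < I + 1 / real (Suc n)" by simp
    moreover have "admissible \<noteq> {}" using admissible_zero by blast
    ultimately show ?thesis
      using cINF_less_iff[OF _ bdd, of "I + 1 / real (Suc n)"] unfolding I_def by blast
  qed
  then obtain f where f: "\<And>n. f n \<in> admissible" and fJ: "\<And>n. J (f n) < I + 1 / real (Suc n)" by metis
  have "\<exists>K. \<forall>m\<ge>K. \<forall>n\<ge>K. nrm (\<lambda>t \<omega>. f m t \<omega> - f n t \<omega>) < e" if e: "0 < e" for e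
  proof -
    \<comment> \<open>From \<open>4 * control_const^2\<close> in the midpoint estimate times the
      total excess \<open>2 / (K + 1)\<close> of two members of the sequence.\<close>
    obtain K where K: "8 * control_const\<^sup>2 / e\<^sup>2 < real (Suc K)" using reals_Archimedean2 less_trans lessI of_nat_less_iff by metis
    have "nrm (\<lambda>t \<omega>. f m t \<omega> - f n t \<omega>) < e" if mn: "m \<ge> K" "n \<ge> K" for m n
    proof -
      have "1 / real (Suc m) \<le> 1 / real (Suc K)" "1 / real (Suc n) \<le> 1 / real (Suc K)"
        using mn by (auto intro!: divide_left_mono)
      then have J: "J (f m) + J (f n) - 2 * I < 2 / real (Suc K)" using fJ[of m] fJ[of n] by simp
      have "(nrm (\<lambda>t \<omega>. f m t \<omega> - f n t \<omega>))\<^sup>2 \<le> 4 * control_const\<^sup>2 * (J (f m) + J (f n) - 2 * I)"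
        unfolding J_def using I by (intro cost_midpoint \<alpha> i f) (auto simp: J_def)
      also have "\<dots> < 4 * control_const\<^sup>2 * (2 / real (Suc K))"
        using J control_const_ge_1 by (intro mult_strict_left_mono) auto
      also have "\<dots> < e\<^sup>2" using K e by (simp add: field_simps)
      finally show ?thesis using e by (simp add: power_less_imp_less_base)
    qed
    then show ?thesis by blast
  qed
  from admissible_complete_nrm[OF f this] obtain g where g: "g \<in> admissible"
    "(\<lambda>n. nrm (\<lambda>t \<omega>. f n t \<omega> - g t \<omega>)) \<longlonglongrightarrow> 0" by blast
  obtain S where S: "0 \<le> S" "\<And>\<beta>. \<beta> \<in> admissible \<Longrightarrow> J g \<le> J \<beta> + S * nrm (\<lambda>t \<omega>. \<beta> t \<omega> - g t \<omega>)"
    using cost_lower_bound[OF \<alpha> i g(1)] unfolding J_def by blast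
  have "(\<lambda>n. I + 1 / real (Suc n) + S * nrm (\<lambda>t \<omega>. f n t \<omega> - g t \<omega>)) \<longlonglongrightarrow> I + 0 + S * 0"
    by (intro tendsto_intros g(2) LIMSEQ_Suc[OF lim_const_over_n])
  moreover have "J g \<le> I + 1 / real (Suc n) + S * nrm (\<lambda>t \<omega>. f n t \<omega> - g t \<omega>)" for n
    using S(2)[OF f, of n] fJ[of n] by linarith
  ultimately have "J g \<le> I + 0 + S * 0" by (intro LIMSEQ_le_const) auto
  then have "J g \<le> J \<gamma>" if "\<gamma> \<in> admissible" for \<gamma> using I[OF that] by simp
  then show ?thesis using g(1) unfolding J_def by blast
qed

text \<open>The contraction takes place not in the \<open>L\<^sup>2\<close> norm but in the equivalent norm dual to
  \<open>h \<mapsto> sqrt (form h y h y)\<close>, where \<open>y\<close> is the state increment caused by \<open>h\<close>.\<close>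

definition dual_bound :: "(real \<Rightarrow> 'a \<Rightarrow> real) \<Rightarrow> real \<Rightarrow> bool" where
  "dual_bound f C \<longleftrightarrow> (\<forall>h y. direction h y \<longrightarrow> \<bar>ip f h\<bar> \<le> C * sqrt (form h y h y))"

lemma nrm_le_sqrt_form: "nrm h \<le> sqrt (form h y h y)"
  unfolding nrm_def form_def using energy_nonneg by simp

lemma dual_bound_nrm:
  assumes "f \<in> admissible" "nrm f \<le> C"
  shows "dual_bound f C"
  unfolding dual_bound_def
proof (intro allI impI)
  fix h y assume d: "direction h y"
  have "\<bar>ip f h\<bar> \<le> nrm f * nrm h" by (intro ip_Cauchy_Schwarz assms directionD[OF d])
  also have "\<dots> \<le> C * sqrt (form h y h y)"
    using assms order_trans[OF nrm_nonneg assms(2)] by (intro mult_mono nrm_le_sqrt_form) auto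
  finally show "\<bar>ip f h\<bar> \<le> C * sqrt (form h y h y)" .
qed

text \<open>Testing with \<open>f\<close> itself. Together with \<open>dual_bound_nrm\<close> this
  makes the dual norm equivalent to the L2 norm.\<close>

lemma nrm_le_dual_bound:
  assumes f: "f \<in> admissible" and b: "dual_bound f C" "0 \<le> C"
  shows "nrm f \<le> C * sqrt (1 + energy_const)"
proof (cases "nrm f = 0")
  case False
  obtain y where d: "direction f y" using direction_exists[OF f] .
  have "nrm f * nrm f = ip f f" using nrm_square[of f] by (simp add: power2_eq_square)
  also have "\<dots> \<le> \<bar>ip f f\<bar>" by simp
  also have "\<dots> \<le> C * sqrt (form f y f y)" using b(1) d unfolding dual_bound_def by blast
  also have "\<dots> \<le> C * (sqrt (1 + energy_const) * nrm f)"
    using real_sqrt_le_mono[OF form_direction_le[OF d]] b(2) by (intro mult_left_mono) (auto simp: real_sqrt_mult)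
  finally have "nrm f * nrm f \<le> (C * sqrt (1 + energy_const)) * nrm f" by simp
  moreover have "0 < nrm f" using False nrm_nonneg[of f] by linarith
  ultimately show ?thesis by simp
next
  case True
  have "0 \<le> C * sqrt (1 + energy_const)" using b(2) energy_const_nonneg by simp
  then show ?thesis using True by simp
qed

section \<open>The contraction estimate for best responses\<close>

text \<open>The constant v of the overview, read off from the sharper bound with
  \<open>1 + T^2 * rate^2\<close> in \<open>solves_scaled_bounds\<close>.\<close>

definition drift_factor :: real where "drift_factor = q * (T * kappa) / sqrt (1 + T\<^sup>2 * rate\<^sup>2)"

definition contraction_factor :: real where "contraction_factor = (energy_const + drift_factor) / (energy_const + 1)"

text \<open>Since \<open>kappa * q \<le> rate\<close>, the squared numerator is at most
  \<open>T^2 * rate^2\<close>; the summand 1 under the root makes the inequality strict.\<close>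

lemma drift_factor: "0 \<le> drift_factor" "drift_factor < 1"
proof -
  have pos: "0 < 1 + T\<^sup>2 * rate\<^sup>2" by (simp add: add_pos_nonneg)
  show "0 \<le> drift_factor" using q_nonneg T_pos kappa_pos pos by (simp add: drift_factor_def)
  have "q * (T * kappa) \<le> T * rate"
    using a_nonneg T_pos by (simp add: rate_def algebra_simps)
  then have "(q * (T * kappa))\<^sup>2 \<le> (T * rate)\<^sup>2"
    using q_nonneg T_pos kappa_pos by (intro power_mono) auto
  then have "(q * (T * kappa))\<^sup>2 < 1 + T\<^sup>2 * rate\<^sup>2" by (simp add: power_mult_distrib)
  then have "q * (T * kappa) < sqrt (1 + T\<^sup>2 * rate\<^sup>2)" by (rule real_less_rsqrt)
  then show "drift_factor < 1" using pos by (simp add: drift_factor_def)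
qed

lemma contraction_factor: "0 \<le> contraction_factor" "contraction_factor < 1"
  using drift_factor energy_const_nonneg by (auto simp: contraction_factor_def)

lemma nrm_direction_le:
  assumes d: "direction h y"
  shows "q * nrm y \<le> drift_factor * nrm h"
proof -
  have pos: "0 < 1 + T\<^sup>2 * rate\<^sup>2" by (simp add: add_pos_nonneg)
  have "sqrt (1 + T\<^sup>2 * rate\<^sup>2) * nrm y \<le> T * kappa * nrm h"
    using real_sqrt_le_mono[OF solves_scaled_bounds(1)[OF directionD(1-3)[OF d] rate_nonneg]] T_pos kappa_pos
    by (simp add: nrm_def real_sqrt_mult)
  then have "nrm y \<le> T * kappa * nrm h / sqrt (1 + T\<^sup>2 * rate\<^sup>2)"
    using pos by (simp add: field_simps)
  from mult_left_mono[OF this q_nonneg] show ?thesis by (simp add: drift_factor_def mult.assoc)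
qed

lemma best_response_contraction:
  assumes \<alpha>: "\<alpha> \<in> admissible_profiles" and \<alpha>': "\<alpha>' \<in> admissible_profiles" and i: "i \<in> {1..N}"
    and \<beta>: "\<beta> \<in> admissible" and \<beta>': "\<beta>' \<in> admissible"
    and opt: "\<And>h y. direction h y \<Longrightarrow> form (residual (\<alpha>(i := \<beta>)) i) (dstate (\<alpha>(i := \<beta>)) i) h y = 0"
    and opt': "\<And>h y. direction h y \<Longrightarrow> form (residual (\<alpha>'(i := \<beta>')) i) (dstate (\<alpha>'(i := \<beta>')) i) h y = 0"
    and C: "0 \<le> C" and bound: "\<And>j. j \<in> {1..N} \<Longrightarrow> dual_bound (\<lambda>t \<omega>. \<alpha> j t \<omega> - \<alpha>' j t \<omega>) C"
  shows "dual_bound (\<lambda>t \<omega>. \<beta> t \<omega> - \<beta>' t \<omega>) (contraction_factor * C)"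
proof -
  define p where "p = \<alpha>(i := \<beta>)"
  define p' where "p' = \<alpha>'(i := \<beta>')"
  have p: "p \<in> admissible_profiles" "p' \<in> admissible_profiles"
    unfolding p_def p'_def by (intro profile_update \<alpha> \<alpha>' \<beta> \<beta>')+
  define z where "z = (\<lambda>t \<omega>. dstate p i t \<omega> - dstate p' i t \<omega>)"
  define m where "m = (\<lambda>t \<omega>. 1 / real N * (\<Sum>j\<in>{1..N} - {i}. \<alpha> j t \<omega> - \<alpha>' j t \<omega>))"
  define u where "u = (\<lambda>t \<omega>. residual p i t \<omega> - residual p' i t \<omega>)"
  define e where "e = (\<lambda>t \<omega>. m t \<omega> - kappa * u t \<omega>)"
  \<comment> \<open>\<open>z\<close> solves the equation at \<open>rate\<close> with forcing
    \<open>e\<close>; the factor \<open>- kappa\<close> makes \<open>y0\<close> the increment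
    belonging to the direction \<open>e\<close>, so that \<open>e\<close> can serve as a test
    function.\<close>
  define y0 where "y0 = (\<lambda>t \<omega>. - kappa * z t \<omega>)"
  have z: "regular z" unfolding z_def by (intro regular_diff dstate_regular p i)
  have u: "u \<in> admissible" unfolding u_def by (intro admissible_diff residual_admissible p i)
  have dj: "(\<lambda>t \<omega>. \<alpha> j t \<omega> - \<alpha>' j t \<omega>) \<in> admissible" if "j \<in> {1..N} - {i}" for j
    using that by (intro admissible_diff profile_admissible \<alpha> \<alpha>') auto
  have m: "m \<in> admissible" unfolding m_def by (intro admissible_cmult admissible_sum dj)
  have e: "e \<in> admissible" unfolding e_def by (intro admissible_diff admissible_cmult m u)
  have u_eq: "u t \<omega> = \<beta> t \<omega> - \<beta>' t \<omega> - q * z t \<omega>" for t \<omega>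
    by (simp add: u_def residual_def p_def p'_def z_def algebra_simps)
  have dev: "deviation p i t \<omega> - deviation p' i t \<omega> = m t \<omega> - kappa * (\<beta> t \<omega> - \<beta>' t \<omega>)" for t \<omega>
    using deviation_update[OF i, of \<alpha> \<beta> t \<omega>] deviation_update[OF i, of \<alpha>' \<beta>' t \<omega>]
    by (simp add: m_def p_def p'_def sum_subtractf diff_divide_distrib algebra_simps)
  have "solves a (\<lambda>t \<omega>. m t \<omega> - kappa * (\<beta> t \<omega> - \<beta>' t \<omega>)) z"
    using dstate_diff_solves[OF p i] unfolding dev z_def .
  \<comment> \<open>The added forcing \<open>kappa * q * z\<close> turns the control difference into
    the residual difference \<open>u\<close>, so the total forcing is
    \<open>m - kappa * u = e\<close>.\<close>
  from solves_add_rate[OF this, of "kappa * q"]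
  have "solves rate e z" by (simp add: rate_def e_def u_eq algebra_simps)
  from solves_cmult[OF this, of "- kappa"] have d0: "direction e y0"
    unfolding direction_def y0_def using e regular_cmult[OF z, of "- kappa"] by simp
  have foc: "ip u h = - energy z y" if d: "direction h y" for h y
  proof -
    have "form u z h y = 0"
      unfolding u_def z_def
      using form_diff_left[OF residual_admissible[OF p(1) i] residual_admissible[OF p(2) i] directionD(1)[OF d]
          dstate_regular[OF p(1) i] dstate_regular[OF p(2) i] directionD(2)[OF d]] opt[OF d] opt'[OF d]
      by (simp add: p_def p'_def)
    then show ?thesis by (simp add: form_def)
  qed
  have e_form: "form e y0 h y = ip m h" if d: "direction h y" for h y
  proof -
    have "ip e h = ip m h - kappa * ip u h"
      unfolding e_def using m u directionD[OF d] by (simp add: ip_diff_left ip_cmult_left admissible_cmult)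
    then show ?thesis unfolding form_def y0_def energy_cmult_left using foc[OF d] by simp
  qed
  \<comment> \<open>There are N - 1 opponents of weight 1/N, hence the factor \<open>kappa\<close>;
    it cancels at the end against the \<open>kappa\<close> in \<open>k_ip\<close>.\<close>
  have m_bound: "\<bar>ip m h\<bar> \<le> kappa * C * sqrt (form h y h y)" if d: "direction h y" for h y
  proof -
    have "\<bar>ip m h\<bar> = \<bar>\<Sum>j\<in>{1..N} - {i}. ip (\<lambda>t \<omega>. \<alpha> j t \<omega> - \<alpha>' j t \<omega>) h\<bar> / real N"
    proof -
      have "ip (\<lambda>t \<omega>. \<Sum>j\<in>{1..N} - {i}. \<alpha> j t \<omega> - \<alpha>' j t \<omega>) h = (\<Sum>j\<in>{1..N} - {i}. ip (\<lambda>t \<omega>. \<alpha> j t \<omega> - \<alpha>' j t \<omega>) h)"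
        by (rule ip_sum_left[OF dj directionD(1)[OF d]])
      then show ?thesis unfolding m_def ip_cmult_left by (simp add: abs_mult)
    qed
    also have "\<dots> \<le> (\<Sum>j\<in>{1..N} - {i}. C * sqrt (form h y h y)) / real N"
      using bound d by (intro divide_right_mono order_trans[OF sum_abs] sum_mono) (auto simp: dual_bound_def)
    also have "\<dots> = kappa * C * sqrt (form h y h y)"
      using i N_ge_2 by (simp add: kappa_def card_Diff_singleton of_nat_diff field_simps)
    finally show ?thesis .
  qed
  \<comment> \<open>Testing \<open>e_form\<close> with \<open>e\<close> itself bounds the square of
    its energy norm by \<open>kappa * C\<close> times that norm; division is possible unless the
    norm is 0.\<close>
  have e_le: "sqrt (form e y0 e y0) \<le> kappa * C"
  proof (cases "form e y0 e y0 = 0")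
    case False
    let ?s = "sqrt (form e y0 e y0)"
    have "?s * ?s \<le> kappa * C * ?s"
      using m_bound[OF d0] e_form[OF d0] form_nonneg[of e y0] by simp
    moreover have "0 < ?s" using False form_nonneg[of e y0] by simp
    ultimately show ?thesis by (rule mult_right_le_imp_le)
  qed (use kappa_pos C in simp)
  show ?thesis
    unfolding dual_bound_def
  proof (intro allI impI)
    fix h y assume d: "direction h y"
    note D = directionD[OF d]
    note D0 = directionD[OF d0]
    have "(\<lambda>t \<omega>. \<beta> t \<omega> - \<beta>' t \<omega>) = (\<lambda>t \<omega>. u t \<omega> + q * z t \<omega>)" by (simp add: u_eq)
    then have "kappa * ip (\<lambda>t \<omega>. \<beta> t \<omega> - \<beta>' t \<omega>) h = kappa * (ip u h + q * ip z h)"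
      using u z D by (simp add: ip_add_left ip_cmult_left admissible_cmult regular_admissible)
    also have "\<dots> = energy y0 y - q * ip y0 h"
      unfolding foc[OF d] y0_def energy_cmult_left ip_cmult_left by (simp add: algebra_simps)
    finally have k_ip: "kappa * ip (\<lambda>t \<omega>. \<beta> t \<omega> - \<beta>' t \<omega>) h = energy y0 y - q * ip y0 h" .
    have "kappa * \<bar>ip (\<lambda>t \<omega>. \<beta> t \<omega> - \<beta>' t \<omega>) h\<bar> = \<bar>kappa * ip (\<lambda>t \<omega>. \<beta> t \<omega> - \<beta>' t \<omega>) h\<bar>"
      using kappa_pos by (simp add: abs_mult)
    also have "\<dots> = \<bar>energy y0 y - q * ip y0 h\<bar>" by (simp only: k_ip)
    also have "\<dots> \<le> \<bar>energy y0 y\<bar> + q * \<bar>ip y0 h\<bar>"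
      using q_nonneg abs_triangle_ineq4[of "energy y0 y" "q * ip y0 h"] by (simp add: abs_mult)
    \<comment> \<open>The energy term is a symmetric form and is split by its own Cauchy-Schwarz
      inequality; the drift term is not symmetric and is bounded through norms.
      \<open>sqrt_mult_add_le\<close> recombines the two.\<close>
    also have "\<dots> \<le> sqrt (energy y0 y0) * sqrt (energy y y) + drift_factor * nrm e * nrm h"
    proof (rule add_mono)
      show "\<bar>energy y0 y\<bar> \<le> sqrt (energy y0 y0) * sqrt (energy y y)"
        by (intro energy_Cauchy_Schwarz D D0)
      have "q * \<bar>ip y0 h\<bar> \<le> q * (nrm y0 * nrm h)"
        by (intro mult_left_mono ip_Cauchy_Schwarz D D0 q_nonneg)
      also have "\<dots> \<le> drift_factor * nrm e * nrm h"
        using mult_right_mono[OF nrm_direction_le[OF d0], of "nrm h"] by (simp add: mult.assoc)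
      finally show "q * \<bar>ip y0 h\<bar> \<le> drift_factor * nrm e * nrm h" .
    qed
    also have "\<dots> \<le> contraction_factor * (sqrt (energy y0 y0 + (nrm e)\<^sup>2) * sqrt (energy y y + (nrm h)\<^sup>2))"
      unfolding contraction_factor_def
      using energy_scaled_bound[OF D(1-3) rate_nonneg] energy_scaled_bound[OF D0(1-3) rate_nonneg]
        drift_factor energy_const_nonneg
      by (intro sqrt_mult_add_le) (auto simp: nrm_square energy_nonneg)
    also have "\<dots> = contraction_factor * (sqrt (form e y0 e y0) * sqrt (form h y h y))"
      by (simp add: form_def nrm_square add.commute)
    also have "\<dots> \<le> contraction_factor * (kappa * C * sqrt (form h y h y))"
      using e_le form_nonneg contraction_factor by (intro mult_left_mono mult_right_mono) auto
    finally have "kappa * \<bar>ip (\<lambda>t \<omega>. \<beta> t \<omega> - \<beta>' t \<omega>) h\<bar> \<le> kappa * (contraction_factor * C * sqrt (form h y h y))"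
      by (simp add: mult_ac)
    then show "\<bar>ip (\<lambda>t \<omega>. \<beta> t \<omega> - \<beta>' t \<omega>) h\<bar> \<le> contraction_factor * C * sqrt (form h y h y)"
      using kappa_pos by simp
  qed
qed


section \<open>Convergence of fictitious play\<close>

definition plays :: "(nat \<Rightarrow> nat \<Rightarrow> real \<Rightarrow> 'a \<Rightarrow> real) \<Rightarrow> bool" where
  "plays \<alpha> \<longleftrightarrow> \<alpha> 0 \<in> admissible_profiles \<and> fictitious_play (\<alpha> 0) \<alpha>"

lemma plays_step:
  assumes "plays \<alpha>" "i \<in> {1..N}"
  shows "\<alpha> (Suc n) i \<in> admissible"
    and "\<beta> \<in> admissible \<Longrightarrow> cost i ((\<alpha> n)(i := \<alpha> (Suc n) i)) \<le> cost i ((\<alpha> n)(i := \<beta>))"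
  using assms by (auto simp: plays_def fictitious_play_def is_arg_min_def not_less)

lemma plays_admissible:
  assumes "plays \<alpha>"
  shows "\<alpha> n \<in> admissible_profiles"
proof (cases n)
  case 0
  then show ?thesis using assms by (simp add: plays_def)
next
  case (Suc m)
  then show ?thesis using plays_step(1)[OF assms] by (auto simp: admissible_profiles_def)
qed

lemma plays_critical:
  assumes \<alpha>: "plays \<alpha>" and i: "i \<in> {1..N}" and d: "direction h y"
  shows "form (residual ((\<alpha> n)(i := \<alpha> (Suc n) i)) i) (dstate ((\<alpha> n)(i := \<alpha> (Suc n) i)) i) h y = 0"
proof -
  have "\<forall>\<beta>\<in>admissible. cost i ((\<alpha> n)(i := \<alpha> (Suc n) i)) \<le> cost i ((\<alpha> n)(i := \<alpha> (Suc n) i, i := \<beta>))"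
    using plays_step(2)[OF \<alpha> i] by simp
  then show ?thesis
    using best_response_iff[OF profile_update[OF plays_admissible[OF \<alpha>] plays_step(1)[OF \<alpha> i]] i] d by blast
qed

text \<open>Lets a play be compared with its own shift, which bounds successive differences
  geometrically.\<close>

lemma plays_Suc: "plays \<alpha> \<Longrightarrow> plays (\<lambda>n. \<alpha> (Suc n))"
  using plays_admissible[of \<alpha> "Suc 0"] by (simp add: plays_def fictitious_play_def)

lemma plays_exists:
  assumes "\<alpha>\<^sub>0 \<in> admissible_profiles"
  obtains \<alpha> where "plays \<alpha>" "\<alpha> 0 = \<alpha>\<^sub>0"
proof -
  define F where "F \<alpha> i = (SOME \<beta>. \<beta> \<in> admissible \<and> (\<forall>\<gamma>\<in>admissible. cost i (\<alpha>(i := \<beta>)) \<le> cost i (\<alpha>(i := \<gamma>))))" for \<alpha> i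
  have F: "F \<alpha> i \<in> admissible \<and> (\<forall>\<gamma>\<in>admissible. cost i (\<alpha>(i := F \<alpha> i)) \<le> cost i (\<alpha>(i := \<gamma>)))"
    if "\<alpha> \<in> admissible_profiles" "i \<in> {1..N}" for \<alpha> i
  proof -
    have "\<exists>\<beta>. \<beta> \<in> admissible \<and> (\<forall>\<gamma>\<in>admissible. cost i (\<alpha>(i := \<beta>)) \<le> cost i (\<alpha>(i := \<gamma>)))"
      using best_response_exists[OF that] by blast
    from someI_ex[OF this] show ?thesis unfolding F_def .
  qed
  define \<alpha> where "\<alpha> n = (F ^^ n) \<alpha>\<^sub>0" for n
  have adm: "\<alpha> n \<in> admissible_profiles" for n
  proof (induction n)
    case (Suc n)
    then show ?case using F[of "\<alpha> n"] by (auto simp: \<alpha>_def admissible_profiles_def)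
  qed (use assms in \<open>simp add: \<alpha>_def\<close>)
  have "fictitious_play (\<alpha> 0) \<alpha>"
    using F[OF adm] by (auto simp: fictitious_play_def is_arg_min_def not_less \<alpha>_def)
  then show thesis using that[of \<alpha>] adm[of 0] by (simp add: plays_def \<alpha>_def)
qed

text \<open>The contraction is iterated in the dual norm; the L2 norm is used only at the start and
  at the end, so the equivalence constant enters once.\<close>

lemma plays_distance:
  assumes \<alpha>: "plays \<alpha>" and \<beta>: "plays \<beta>"
  obtains C where "0 \<le> C" "\<And>n i. i \<in> {1..N} \<Longrightarrow> nrm (\<lambda>t \<omega>. \<alpha> n i t \<omega> - \<beta> n i t \<omega>) \<le> C * contraction_factor ^ n"
proof -
  define C0 where "C0 = (\<Sum>i = 1..N. nrm (\<lambda>t \<omega>. \<alpha> 0 i t \<omega> - \<beta> 0 i t \<omega>))"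
  have C0: "0 \<le> C0" by (simp add: C0_def sum_nonneg)
  have adm: "(\<lambda>t \<omega>. \<alpha> n i t \<omega> - \<beta> n i t \<omega>) \<in> admissible" if "i \<in> {1..N}" for n i
    using that by (intro admissible_diff profile_admissible plays_admissible \<alpha> \<beta>)
  have db: "\<forall>i\<in>{1..N}. dual_bound (\<lambda>t \<omega>. \<alpha> n i t \<omega> - \<beta> n i t \<omega>) (contraction_factor ^ n * C0)" for n
  proof (induction n)
    case 0
    have "nrm (\<lambda>t \<omega>. \<alpha> 0 i t \<omega> - \<beta> 0 i t \<omega>) \<le> C0" if "i \<in> {1..N}" for i
      unfolding C0_def using that by (intro member_le_sum) auto
    then show ?case using adm by (auto intro!: dual_bound_nrm)
  next
    case (Suc n)
    show ?case
    proof
      fix i assume i: "i \<in> {1..N}"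
      have "dual_bound (\<lambda>t \<omega>. \<alpha> (Suc n) i t \<omega> - \<beta> (Suc n) i t \<omega>) (contraction_factor * (contraction_factor ^ n * C0))"
        using Suc C0 contraction_factor
        by (intro best_response_contraction[OF plays_admissible[OF \<alpha>, of n] plays_admissible[OF \<beta>, of n] i]
            plays_step(1) plays_critical \<alpha> \<beta> i) auto
      then show "dual_bound (\<lambda>t \<omega>. \<alpha> (Suc n) i t \<omega> - \<beta> (Suc n) i t \<omega>) (contraction_factor ^ Suc n * C0)"
        by (simp add: mult.assoc)
    qed
  qed
  have "nrm (\<lambda>t \<omega>. \<alpha> n i t \<omega> - \<beta> n i t \<omega>) \<le> (C0 * sqrt (1 + energy_const)) * contraction_factor ^ n" if "i \<in> {1..N}" for n i
    using nrm_le_dual_bound[OF adm[OF that] bspec[OF db that]] C0 contraction_factor by (simp add: mult_ac)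
  moreover have "0 \<le> C0 * sqrt (1 + energy_const)" using C0 energy_const_nonneg by simp
  ultimately show thesis using that by blast
qed

lemma plays_limit:
  assumes \<alpha>: "plays \<alpha>"
  obtains \<alpha>' where "\<alpha>' \<in> admissible_profiles"
    "\<And>i. i \<in> {1..N} \<Longrightarrow> (\<lambda>n. nrm (\<lambda>t \<omega>. \<alpha> n i t \<omega> - \<alpha>' i t \<omega>)) \<longlonglongrightarrow> 0"
proof -
  let ?k = contraction_factor
  obtain C where C: "0 \<le> C" "\<And>n i. i \<in> {1..N} \<Longrightarrow> nrm (\<lambda>t \<omega>. \<alpha> n i t \<omega> - \<alpha> (Suc n) i t \<omega>) \<le> C * ?k ^ n"
    using plays_distance[OF \<alpha> plays_Suc[OF \<alpha>]] by blast
  have "\<exists>g. g \<in> admissible \<and> (\<lambda>n. nrm (\<lambda>t \<omega>. \<alpha> n i t \<omega> - g t \<omega>)) \<longlonglongrightarrow> 0" if i: "i \<in> {1..N}" for i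
  proof -
    have adm: "\<alpha> n i \<in> admissible" for n by (rule profile_admissible[OF plays_admissible[OF \<alpha>] i])
    \<comment> \<open>The bound is the geometric sum of the \<open>l\<close> single steps in closed
      form, which makes the induction step an identity.\<close>
    have step: "nrm (\<lambda>t \<omega>. \<alpha> m i t \<omega> - \<alpha> (m + l) i t \<omega>) \<le> C * (?k ^ m - ?k ^ (m + l)) / (1 - ?k)" for m l
    proof (induction l)
      case 0
      show ?case by (simp add: nrm_def ip_def on_Q_def)
    next
      case (Suc l)
      have "nrm (\<lambda>t \<omega>. (\<alpha> m i t \<omega> - \<alpha> (m + l) i t \<omega>) + (\<alpha> (m + l) i t \<omega> - \<alpha> (Suc (m + l)) i t \<omega>)) \<le>
          C * (?k ^ m - ?k ^ (m + l)) / (1 - ?k) + C * ?k ^ (m + l)"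
        by (intro order_trans[OF nrm_triangle] add_mono Suc C(2) i admissible_diff adm)
      also have "\<dots> = C * (?k ^ m - ?k ^ (m + Suc l)) / (1 - ?k)"
        using contraction_factor by (simp add: field_simps)
      finally show ?case by simp
    qed
    have *: "nrm (\<lambda>t \<omega>. \<alpha> m i t \<omega> - \<alpha> n i t \<omega>) \<le> C / (1 - ?k) * ?k ^ K" if "K \<le> m" "m \<le> n" for K m n
    proof -
      have "nrm (\<lambda>t \<omega>. \<alpha> m i t \<omega> - \<alpha> n i t \<omega>) \<le> C * (?k ^ m - ?k ^ n) / (1 - ?k)"
        using step[of m "n - m"] that by simp
      also have "\<dots> \<le> C * ?k ^ K / (1 - ?k)"
      proof (intro divide_right_mono mult_left_mono C(1))
        have "?k ^ m \<le> ?k ^ K" using that contraction_factor by (intro power_decreasing) auto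
        then show "?k ^ m - ?k ^ n \<le> ?k ^ K" using contraction_factor zero_le_power[of ?k n] by linarith
      qed (use contraction_factor in simp)
      finally show ?thesis by simp
    qed
    have "(\<lambda>K. C / (1 - ?k) * ?k ^ K) \<longlonglongrightarrow> C / (1 - ?k) * 0"
      using contraction_factor by (intro tendsto_intros LIMSEQ_power_zero) auto
    then have lim: "(\<lambda>K. C / (1 - ?k) * ?k ^ K) \<longlonglongrightarrow> 0" by simp
    have "\<exists>K. \<forall>m\<ge>K. \<forall>n\<ge>K. nrm (\<lambda>t \<omega>. \<alpha> m i t \<omega> - \<alpha> n i t \<omega>) < e" if e: "0 < e" for e
    proof -
      from order_tendstoD(2)[OF lim e] obtain K where K: "C / (1 - ?k) * ?k ^ K < e"
        by (auto simp: eventually_sequentially)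
      have sym: "nrm (\<lambda>t \<omega>. \<alpha> m i t \<omega> - \<alpha> n i t \<omega>) = nrm (\<lambda>t \<omega>. \<alpha> n i t \<omega> - \<alpha> m i t \<omega>)" for m n
        using nrm_cmult[of "-1" "\<lambda>t \<omega>. \<alpha> n i t \<omega> - \<alpha> m i t \<omega>"] by simp
      have "nrm (\<lambda>t \<omega>. \<alpha> m i t \<omega> - \<alpha> n i t \<omega>) < e" if "m \<ge> K" "n \<ge> K" for m n
        using *[of K m n] *[of K n m] sym[of m n] that K by (cases "m \<le> n") auto
      then show ?thesis by blast
    qed
    from admissible_complete_nrm[OF adm this] show ?thesis by blast
  qed
  then have "\<forall>i\<in>{1..N}. \<exists>g. g \<in> admissible \<and> (\<lambda>n. nrm (\<lambda>t \<omega>. \<alpha> n i t \<omega> - g t \<omega>)) \<longlonglongrightarrow> 0" by blast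
  from bchoice[OF this] obtain \<alpha>' where
    "\<forall>i\<in>{1..N}. \<alpha>' i \<in> admissible \<and> (\<lambda>n. nrm (\<lambda>t \<omega>. \<alpha> n i t \<omega> - \<alpha>' i t \<omega>)) \<longlonglongrightarrow> 0" by blast
  then show thesis using that[of \<alpha>'] by (auto simp: admissible_profiles_def)
qed

text \<open>Optimality passes to the limit through the first order condition: the profile in which
  player \<open>i\<close> alone has updated is critical for \<open>i\<close>, it tends to
  \<open>\<alpha>'\<close>, and the first variation is continuous.\<close>

lemma limit_critical:
  assumes \<alpha>: "plays \<alpha>" and \<alpha>': "\<alpha>' \<in> admissible_profiles" and i: "i \<in> {1..N}" and d: "direction h y"
    and lim: "\<And>i. i \<in> {1..N} \<Longrightarrow> (\<lambda>n. nrm (\<lambda>t \<omega>. \<alpha> n i t \<omega> - \<alpha>' i t \<omega>)) \<longlonglongrightarrow> 0"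
  shows "form (residual \<alpha>' i) (dstate \<alpha>' i) h y = 0"
proof -
  define p where "p n = (\<alpha> n)(i := \<alpha> (Suc n) i)" for n
  define g where "g n = (\<lambda>t \<omega>. \<alpha> (Suc n) i t \<omega> - \<alpha>' i t \<omega>)" for n
  \<comment> \<open>Chosen so that the difference of the control deviations is
    \<open>- kappa * f n\<close>, opponents included; the estimates for scaled forcing then apply
    directly.\<close>
  define f where "f n = (\<lambda>t \<omega>. g n t \<omega> - 1 / (kappa * real N) * (\<Sum>j\<in>{1..N} - {i}. \<alpha> n j t \<omega> - \<alpha>' j t \<omega>))" for n
  define z where "z n = (\<lambda>t \<omega>. dstate (p n) i t \<omega> - dstate \<alpha>' i t \<omega>)" for n
  define u where "u n = (\<lambda>t \<omega>. residual (p n) i t \<omega> - residual \<alpha>' i t \<omega>)" for n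
  have p: "p n \<in> admissible_profiles" for n
    unfolding p_def by (intro profile_update plays_admissible plays_step(1) \<alpha> i)
  have dj: "(\<lambda>t \<omega>. \<alpha> n j t \<omega> - \<alpha>' j t \<omega>) \<in> admissible" if "j \<in> {1..N} - {i}" for n j
    using that by (intro admissible_diff profile_admissible plays_admissible \<alpha> \<alpha>') auto
  have g: "g n \<in> admissible" for n
    unfolding g_def by (intro admissible_diff plays_step(1) profile_admissible \<alpha> \<alpha>' i)
  have f: "f n \<in> admissible" for n
    unfolding f_def by (intro admissible_diff admissible_cmult admissible_sum g dj)
  have z: "regular (z n)" for n unfolding z_def by (intro regular_diff dstate_regular p \<alpha>' i)
  have u: "u n \<in> admissible" for n unfolding u_def by (intro admissible_diff residual_admissible p \<alpha>' i)
  have u_eq: "u n = (\<lambda>t \<omega>. g n t \<omega> - q * z n t \<omega>)" for n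
    by (simp add: u_def residual_def[abs_def] p_def z_def g_def fun_eq_iff algebra_simps)
  have "deviation (p n) i t \<omega> - deviation \<alpha>' i t \<omega> = - kappa * f n t \<omega>" for n t \<omega>
  proof -
    have "kappa * f n t \<omega> = kappa * g n t \<omega> - (\<Sum>j\<in>{1..N} - {i}. \<alpha> n j t \<omega> - \<alpha>' j t \<omega>) / real N"
      using kappa_pos by (simp add: f_def right_diff_distrib)
    then show ?thesis
      using deviation_update[OF i, of "\<alpha> n" "\<alpha> (Suc n) i" t \<omega>] deviation_update[OF i, of \<alpha>' "\<alpha>' i" t \<omega>]
      by (simp add: g_def p_def sum_subtractf diff_divide_distrib algebra_simps)
  qed
  then have zs: "solves a (\<lambda>t \<omega>. - kappa * f n t \<omega>) (z n)" for n
    using dstate_diff_solves[OF p[of n] \<alpha>' i] by (simp add: z_def)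
  define r where "r n = nrm (g n) + 1 / (kappa * real N) * (\<Sum>j\<in>{1..N} - {i}. nrm (\<lambda>t \<omega>. \<alpha> n j t \<omega> - \<alpha>' j t \<omega>))" for n
  have f_le: "nrm (f n) \<le> r n" for n
  proof -
    have "nrm (f n) \<le> nrm (g n) + nrm (\<lambda>t \<omega>. 1 / (kappa * real N) * (\<Sum>j\<in>{1..N} - {i}. \<alpha> n j t \<omega> - \<alpha>' j t \<omega>))"
      unfolding f_def by (intro nrm_triangle_diff admissible_cmult admissible_sum g dj)
    also have "\<dots> \<le> r n"
    proof -
      have "nrm (\<lambda>t \<omega>. \<Sum>j\<in>{1..N} - {i}. \<alpha> n j t \<omega> - \<alpha>' j t \<omega>)
          \<le> (\<Sum>j\<in>{1..N} - {i}. nrm (\<lambda>t \<omega>. \<alpha> n j t \<omega> - \<alpha>' j t \<omega>))"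
        by (rule nrm_sum[OF dj])
      then show ?thesis
        unfolding r_def nrm_cmult using kappa_pos by (intro add_left_mono mult_mono) auto
    qed
    finally show ?thesis .
  qed
  have u_le: "nrm (u n) \<le> nrm (g n) + q * (T * kappa * r n)" for n
  proof -
    have "nrm (u n) \<le> nrm (g n) + nrm (\<lambda>t \<omega>. q * z n t \<omega>)"
      unfolding u_eq by (intro nrm_triangle_diff admissible_cmult g regular_admissible z)
    also have "\<dots> \<le> nrm (g n) + q * (T * kappa * r n)"
      unfolding nrm_cmult using q_nonneg T_pos kappa_pos
        order_trans[OF nrm_scaled_bound[OF f z zs a_nonneg] mult_left_mono[OF f_le]]
      by (intro add_left_mono mult_mono) auto
    finally show ?thesis .
  qed
  \<comment> \<open>Majorant of the squared norm of the pair \<open>(u n, z n)\<close>, assembled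
    from norms that tend to 0.\<close>
  define B where "B n = (nrm (g n) + q * (T * kappa * r n))\<^sup>2 + energy_const * (r n)\<^sup>2" for n
  have B: "form (u n) (z n) (u n) (z n) \<le> B n" for n
  proof -
    have "ip (u n) (u n) \<le> (nrm (g n) + q * (T * kappa * r n))\<^sup>2"
      unfolding nrm_square[symmetric] by (intro power_mono u_le) simp
    moreover have "energy (z n) (z n) \<le> energy_const * (nrm (f n))\<^sup>2"
      unfolding nrm_square by (rule energy_scaled_bound[OF f z zs a_nonneg])
    moreover have "energy_const * (nrm (f n))\<^sup>2 \<le> energy_const * (r n)\<^sup>2"
      by (intro mult_left_mono power_mono f_le energy_const_nonneg) simp
    ultimately show ?thesis by (simp add: form_def B_def)
  qed
  have g0: "(\<lambda>n. nrm (g n)) \<longlonglongrightarrow> 0"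
    unfolding g_def using LIMSEQ_Suc[OF lim[OF i]] .
  have "r \<longlonglongrightarrow> 0 + 1 / (kappa * real N) * (\<Sum>j\<in>{1..N} - {i}. 0)"
    unfolding r_def by (intro tendsto_intros g0 lim) auto
  then have r0: "r \<longlonglongrightarrow> 0" by simp
  have "B \<longlonglongrightarrow> (0 + q * (T * kappa * 0))\<^sup>2 + energy_const * 0\<^sup>2"
    unfolding B_def by (intro tendsto_intros g0 r0)
  then have B0: "B \<longlonglongrightarrow> 0" by simp
  let ?l = "form (residual \<alpha>' i) (dstate \<alpha>' i) h y"
  have "\<bar>?l\<bar> \<le> sqrt (B n) * sqrt (form h y h y)" for n
  proof -
    have "form (u n) (z n) h y = form (residual (p n) i) (dstate (p n) i) h y - ?l"
      unfolding u_def z_def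
      by (intro form_diff_left residual_admissible dstate_regular p \<alpha>' i directionD[OF d])
    also have "\<dots> = - ?l" using plays_critical[OF \<alpha> i d, of n] by (simp add: p_def)
    finally have "\<bar>?l\<bar> \<le> sqrt (form (u n) (z n) (u n) (z n)) * sqrt (form h y h y)"
      using form_Cauchy_Schwarz[OF u directionD(1)[OF d] z directionD(2)[OF d], of n n] by simp
    also have "\<dots> \<le> sqrt (B n) * sqrt (form h y h y)"
      using form_nonneg by (intro mult_right_mono real_sqrt_le_mono B) auto
    finally show ?thesis .
  qed
  moreover have "(\<lambda>n. sqrt (B n) * sqrt (form h y h y)) \<longlonglongrightarrow> sqrt 0 * sqrt (form h y h y)"
    by (intro tendsto_intros B0)
  ultimately have "\<bar>?l\<bar> \<le> sqrt 0 * sqrt (form h y h y)" by (intro LIMSEQ_le_const) auto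
  then show ?thesis by simp
qed

text \<open>One limit is constructed and shown to be an equilibrium; all other plays are then
  compared with it.\<close>

lemma fictitious_play_converges:
  "(\<forall>\<alpha>\<^sub>0 \<in> admissible_profiles. \<exists>\<alpha>. fictitious_play \<alpha>\<^sub>0 \<alpha>) \<and>
    (\<exists>\<alpha>' \<in> admissible_profiles. open_loop_nash \<alpha>' \<and>
      (\<forall>\<alpha>\<^sub>0 \<in> admissible_profiles. \<forall>\<alpha>. fictitious_play \<alpha>\<^sub>0 \<alpha> \<longrightarrow> converges_to \<alpha> \<alpha>'))"
proof (intro conjI ballI)
  fix \<alpha>\<^sub>0 assume "\<alpha>\<^sub>0 \<in> admissible_profiles"
  then show "\<exists>\<alpha>. fictitious_play \<alpha>\<^sub>0 \<alpha>" using plays_exists[of \<alpha>\<^sub>0] by (auto simp: plays_def)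
next
  \<comment> \<open>Zero controls are an arbitrary admissible starting point for producing the
    equilibrium.\<close>
  have "(\<lambda>i t \<omega>. 0) \<in> admissible_profiles" by (simp add: admissible_profiles_def)
  then obtain \<alpha>1 where \<alpha>1: "plays \<alpha>1" using plays_exists by blast
  obtain \<alpha>' where \<alpha>': "\<alpha>' \<in> admissible_profiles"
    "\<And>i. i \<in> {1..N} \<Longrightarrow> (\<lambda>n. nrm (\<lambda>t \<omega>. \<alpha>1 n i t \<omega> - \<alpha>' i t \<omega>)) \<longlonglongrightarrow> 0"
    using plays_limit[OF \<alpha>1] by blast
  have best: "\<forall>\<beta>\<in>admissible. cost i \<alpha>' \<le> cost i (\<alpha>'(i := \<beta>))" if "i \<in> {1..N}" for i
    using best_response_iff[OF \<alpha>'(1) that] limit_critical[OF \<alpha>1 \<alpha>'(1) that _ \<alpha>'(2)] by blast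
  have nash: "open_loop_nash \<alpha>'" using best \<alpha>'(1) by (simp add: open_loop_nash_def)
  \<comment> \<open>At an equilibrium each own control is a best response, so the constant sequence
    is a play and \<open>plays_distance\<close> applies to it.\<close>
  have const: "plays (\<lambda>n. \<alpha>')"
    using best \<alpha>'(1) by (auto simp: plays_def fictitious_play_def is_arg_min_def not_less profile_admissible)
  have "converges_to \<alpha> \<alpha>'" if "\<alpha>\<^sub>0 \<in> admissible_profiles" "fictitious_play \<alpha>\<^sub>0 \<alpha>" for \<alpha>\<^sub>0 \<alpha>
    unfolding converges_to_def
  proof
    fix i assume i: "i \<in> {1..N}"
    have \<alpha>: "plays \<alpha>" using that by (auto simp: plays_def fictitious_play_def)
    obtain C where C: "0 \<le> C" "\<And>n i. i \<in> {1..N} \<Longrightarrow> nrm (\<lambda>t \<omega>. \<alpha> n i t \<omega> - \<alpha>' i t \<omega>) \<le> C * contraction_factor ^ n"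
      using plays_distance[OF \<alpha> const] by blast
    have adm: "(\<lambda>t \<omega>. \<alpha> n i t \<omega> - \<alpha>' i t \<omega>) \<in> admissible" for n
      by (intro admissible_diff profile_admissible plays_admissible \<alpha> \<alpha>'(1) i)
    have "(\<lambda>n. C * contraction_factor ^ n) \<longlonglongrightarrow> C * 0"
      using contraction_factor by (intro tendsto_intros LIMSEQ_power_zero) auto
    then have "(\<lambda>n. C * contraction_factor ^ n) \<longlonglongrightarrow> 0" by simp
    then have "(\<lambda>n. nrm (\<lambda>t \<omega>. \<alpha> n i t \<omega> - \<alpha>' i t \<omega>)) \<longlonglongrightarrow> 0"
      by (rule Lim_null_comparison[rotated]) (use C(2)[OF i] in simp)
    from tendsto_power[OF this, of 2] have "(\<lambda>n. ennreal ((nrm (\<lambda>t \<omega>. \<alpha> n i t \<omega> - \<alpha>' i t \<omega>))\<^sup>2)) \<longlonglongrightarrow> ennreal 0"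
      by (intro tendsto_ennrealI) simp
    then show "(\<lambda>n. sq_norm (\<lambda>t \<omega>. \<alpha> n i t \<omega> - \<alpha>' i t \<omega>)) \<longlonglongrightarrow> 0"
      by (simp add: sq_norm_nrm[OF adm])
  qed
  with nash \<alpha>'(1) show "\<exists>\<alpha>' \<in> admissible_profiles. open_loop_nash \<alpha>' \<and>
      (\<forall>\<alpha>\<^sub>0 \<in> admissible_profiles. \<forall>\<alpha>. fictitious_play \<alpha>\<^sub>0 \<alpha> \<longrightarrow> converges_to \<alpha> \<alpha>')" by blast
qed

end

text \<open>Existence of plays is stated separately so that the claim about all plays is not
  vacuous. The limit is quantified before the initial belief, which expresses its independence of
  that belief.\<close>

theorem theorem3p1:
  fixes M :: "'a measure"
    and W :: "nat \<Rightarrow> real \<Rightarrow> 'a \<Rightarrow> real"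
    and N :: nat
    and T a \<sigma> \<rho> q \<epsilon> c :: real
    and x :: "nat \<Rightarrow> real"
    and K :: "real \<Rightarrow> real"
  assumes "prob_space M"
    and "independent_brownian_motions M N W"
    and "N \<ge> 2" and "T > 0"
    and "a \<ge> 0" and "\<epsilon> \<ge> 0" and "c \<ge> 0" and "q \<ge> 0" and "q\<^sup>2 \<le> \<epsilon>"
    and "\<rho> \<in> {-1..1}"
    and "riccati_solution N T a q \<epsilon> c K"
    and "exp_quotient T (gamma_min N T a q K) * C_const N T a q K < 1"
  shows "(\<forall>\<alpha>\<^sub>0 \<in> lq_game.admissible_profiles M W N T.
            \<exists>\<alpha>. lq_game.fictitious_play M W N T a \<sigma> \<rho> x q \<epsilon> c \<alpha>\<^sub>0 \<alpha>) \<and>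
         (\<exists>\<alpha>' \<in> lq_game.admissible_profiles M W N T.
            lq_game.open_loop_nash M W N T a \<sigma> \<rho> x q \<epsilon> c \<alpha>' \<and>
            (\<forall>\<alpha>\<^sub>0 \<in> lq_game.admissible_profiles M W N T.
               \<forall>\<alpha>. lq_game.fictitious_play M W N T a \<sigma> \<rho> x q \<epsilon> c \<alpha>\<^sub>0 \<alpha> \<longrightarrow>
                 lq_game.converges_to M N T \<alpha> \<alpha>'))"
proof -
  interpret prob_space M by fact
  interpret lq_game_assumptions M W N T a \<sigma> \<rho> x q \<epsilon> c
    using assms by unfold_locales (auto simp: independent_brownian_motions_def)
  show ?thesis by (rule fictitious_play_converges)
qed

end
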